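(* Let $k\ge 1$ be an integer and let $j\geq k$. Then the moduli $\mathcal{M}_j(k)$ of rank-$2$ holomorphic bundles on $Z_k=\mathrm{Tot}(\mathcal{O}_{\mathbb{P}^1}(-k))$ of splitting type $j$ has an open, dense subspace homeomorphic to a complex projective space $\mathbb{P}^{2j-k-2}$ minus a closed subvariety of codimension at least $k+1$.
   Context: For $k\ge1$, $Z_k=\mathrm{Tot}(\mathcal{O}_{\mathbb{P}^1}(-k))$ is covered by charts $U=\mathbb{C}^2_{z,u}$ and $V=\mathbb{C}^2_{\zeta,v}$ glued by $\zeta=z^{-1}$, $v=z^ku$; $\ell\cong\mathbb{P}^1$ is the zero section. A rank-$2$ holomorphic bundle $E$ on $Z_k$ has splitting type $j\ge0$ if $E|_\ell\cong\mathcal{O}_{\mathbb{P}^1}(j)\oplus\mathcal{O}_{\mathbb{P}^1}(-j)$. $\mathcal{M}_j(k)$ is the set of isomorphism classes of rank-$2$ holomorphic bundles on $Z_k$ of splitting type $j$, topologised as follows. Every such bundle is (known result) given by a transition matrix $\begin{pmatrix} z^j & p\\ 0& z^{-j}\end{pmatrix}$ from $U$ to $V$ with $$p(z,u)=\sum_{r=1}^{N}\ \sum_{s=kr-j+1}^{j-1}p_{rs}z^su^r,\qquad N=\Bigl\lfloor\frac{2j-2}{k}\Bigr\rfloor,\quad p_{rs}\in\mathbb{C}.$$ Such a $p$ has $m=N(2j-1)-k\binom{N+1}{2}$ coefficients, so it is identified with a point of $\mathbb{C}^m$. Put $p\sim p'$ if the two matrices define isomorphic bundles on $Z_k$. Then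 $\mathcal{M}_j(k)$ is in bijection with $\mathbb{C}^m/\!\sim$, and it is given the quotient topology (analytic topology on $\mathbb{C}^m$). *)

theory Defs
  imports "HOL-Analysis.Analysis" "HOL-Library.Poly_Mapping"
begin

section \<open>Quotient topologies\<close>

definition quotient_topology :: "'a topology \<Rightarrow> ('a \<Rightarrow> 'b) \<Rightarrow> 'b topology" where
  "quotient_topology X q =
     topology (\<lambda>S. S \<subseteq> q ` topspace X \<and> openin X {x \<in> topspace X. q x \<in> S})"

lemma openin_quotient_topology:
  "openin (quotient_topology X q) S \<longleftrightarrow>
     S \<subseteq> q ` topspace X \<and> openin X {x \<in> topspace X. q x \<in> S}"
proof -
  have "istopology (\<lambda>S. S \<subseteq> q ` topspace X \<and> openin X {x \<in> topspace X. q x \<in> S})"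
    unfolding istopology_def
  proof (intro conjI allI impI)
    fix S T
    assume S: "S \<subseteq> q ` topspace X \<and> openin X {x \<in> topspace X. q x \<in> S}"
      and T: "T \<subseteq> q ` topspace X \<and> openin X {x \<in> topspace X. q x \<in> T}"
    show "S \<inter> T \<subseteq> q ` topspace X" using S by blast
    have "{x \<in> topspace X. q x \<in> S \<inter> T} =
          {x \<in> topspace X. q x \<in> S} \<inter> {x \<in> topspace X. q x \<in> T}" by blast
    then show "openin X {x \<in> topspace X. q x \<in> S \<inter> T}" using S T by (simp add: openin_Int)
  next
    fix K
    assume K: "\<forall>S\<in>K. S \<subseteq> q ` topspace X \<and> openin X {x \<in> topspace X. q x \<in> S}"
    show "\<Union>K \<subseteq> q ` topspace X" using K by blast
    have "{x \<in> topspace X. q x \<in> \<Union>K} = \<Union>((\<lambda>S. {x \<in> topspace X. q x \<in> S}) ` K)" by blast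
    then show "openin X {x \<in> topspace X. q x \<in> \<Union>K}" using K by (auto intro!: openin_Union)
  qed
  then show ?thesis by (simp add: quotient_topology_def)
qed

lemma topspace_quotient_topology: "topspace (quotient_topology X q) = q ` topspace X"
proof
  show "topspace (quotient_topology X q) \<subseteq> q ` topspace X"
    using openin_topspace openin_quotient_topology by metis
  have "{x \<in> topspace X. q x \<in> q ` topspace X} = topspace X" by blast
  then have "openin (quotient_topology X q) (q ` topspace X)"
    by (simp add: openin_quotient_topology)
  then show "q ` topspace X \<subseteq> topspace (quotient_topology X q)"
    by (rule openin_subset)
qed

lemma quotient_map_quotient_topology: "quotient_map X (quotient_topology X q) q"
  by (simp add: quotient_map_def topspace_quotient_topology openin_quotient_topology)


section \<open>Rank 2 holomorphic bundles on Z_k\<close>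

text \<open>Holomorphic functions of two variables, i.e. functions on an open subset of \<open>\<complex>\<^sup>2\<close> with a
  complex linear Frechet derivative at every point.\<close>

definition holomorphic2_on :: "(complex \<times> complex \<Rightarrow> complex) \<Rightarrow> (complex \<times> complex) set \<Rightarrow> bool"
  where "holomorphic2_on f S \<longleftrightarrow>
    open S \<and> (\<forall>x\<in>S. \<exists>a b. (f has_derivative (\<lambda>h. a * fst h + b * snd h)) (at x))"

definition holomorphic_GL2_on ::
    "(complex \<times> complex \<Rightarrow> complex^2^2) \<Rightarrow> (complex \<times> complex) set \<Rightarrow> bool"
  where "holomorphic_GL2_on A S \<longleftrightarrow>
    (\<forall>i l. holomorphic2_on (\<lambda>x. A x $ i $ l) S) \<and> (\<forall>x\<in>S. invertible (A x))"

definition overlap :: "(complex \<times> complex) set"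
  where "overlap = {(z, u). z \<noteq> 0}"

text \<open>\<open>Z_k\<close> is glued from \<open>U = \<complex>\<^sup>2\<close> with coordinates \<open>(z, u)\<close> and \<open>V = \<complex>\<^sup>2\<close> with coordinates
  \<open>(\<zeta>, v)\<close> along \<open>U \<inter> V = {z \<noteq> 0}\<close>. This is the change of coordinates on \<open>U \<inter> V\<close>.\<close>

definition to_V :: "nat \<Rightarrow> complex \<times> complex \<Rightarrow> complex \<times> complex"
  where "to_V k x = (inverse (fst x), fst x ^ k * snd x)"

text \<open>Holomorphic bundles on \<open>\<complex>\<^sup>2\<close> are trivial, so a rank 2 bundle on \<open>Z_k\<close> is given by its
  transition matrix from \<open>U\<close> to \<open>V\<close>, written in the coordinates \<open>(z, u)\<close>. Only the values on
  the overlap matter.\<close>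

definition rank2_bundle :: "(complex \<times> complex \<Rightarrow> complex^2^2) \<Rightarrow> bool"
  where "rank2_bundle T \<longleftrightarrow> holomorphic_GL2_on T overlap"

text \<open>An isomorphism from the bundle of \<open>T\<close> to the bundle of \<open>T'\<close> is a pair of holomorphic
  invertible matrices \<open>A\<close> on \<open>U\<close> and \<open>B\<close> on \<open>V\<close> that is compatible with the gluing.\<close>

definition bundle_iso ::
    "nat \<Rightarrow> (complex \<times> complex \<Rightarrow> complex^2^2) \<Rightarrow> (complex \<times> complex \<Rightarrow> complex^2^2) \<Rightarrow> bool"
  where "bundle_iso k T T' \<longleftrightarrow>
    (\<exists>A B. holomorphic_GL2_on A UNIV \<and> holomorphic_GL2_on B UNIV \<and>
       (\<forall>x\<in>overlap. B (to_V k x) ** T x = T' x ** A x))"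

definition bundle_class ::
    "nat \<Rightarrow> (complex \<times> complex \<Rightarrow> complex^2^2) \<Rightarrow> (complex \<times> complex \<Rightarrow> complex^2^2) set"
  where "bundle_class k T = {T'. rank2_bundle T' \<and> bundle_iso k T T'}"

definition mat2 :: "complex \<Rightarrow> complex \<Rightarrow> complex \<Rightarrow> complex \<Rightarrow> complex^2^2"
  where "mat2 a b c d = vector [vector [a, b], vector [c, d]]"

text \<open>The zero section is \<open>{u = 0}\<close>, and \<open>\<O>(j) \<oplus> \<O>(-j)\<close> on it has transition matrix
  \<open>diag (z\<^sup>j) (z\<^sup>-\<^sup>j)\<close> up to the order of the summands.\<close>

definition splitting_type :: "(complex \<times> complex \<Rightarrow> complex^2^2) \<Rightarrow> nat \<Rightarrow> bool"
  where "splitting_type T j \<longleftrightarrow>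
    (\<exists>A B :: complex \<Rightarrow> complex^2^2.
       (\<forall>i l. (\<lambda>z. A z $ i $ l) holomorphic_on UNIV) \<and> (\<forall>z. invertible (A z)) \<and>
       (\<forall>i l. (\<lambda>z. B z $ i $ l) holomorphic_on UNIV) \<and> (\<forall>z. invertible (B z)) \<and>
       (\<forall>z. z \<noteq> 0 \<longrightarrow>
          B (inverse z) ** T (z, 0) = mat2 (z ^ j) 0 0 (inverse z ^ j) ** A z))"


section \<open>The moduli space\<close>

definition coeff_index :: "nat \<Rightarrow> nat \<Rightarrow> (nat \<times> int) set"
  where "coeff_index k j =
    (SIGMA r:{1..(2 * j - 2) div k}. {int k * int r - int j + 1..int j - 1})"

text \<open>\<open>\<complex>\<^sup>m\<close> with coordinates indexed by \<open>coeff_index k j\<close>.\<close>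

definition coeff_space :: "nat \<Rightarrow> nat \<Rightarrow> (nat \<times> int \<Rightarrow> complex) topology"
  where "coeff_space k j = product_topology (\<lambda>_. euclidean) (coeff_index k j)"

definition ext_poly :: "nat \<Rightarrow> nat \<Rightarrow> (nat \<times> int \<Rightarrow> complex) \<Rightarrow> complex \<times> complex \<Rightarrow> complex"
  where "ext_poly k j p x =
    (\<Sum>r = 1..(2 * j - 2) div k. \<Sum>s = int k * int r - int j + 1..int j - 1.
        p (r, s) * fst x powi s * snd x ^ r)"

definition transition ::
    "nat \<Rightarrow> nat \<Rightarrow> (nat \<times> int \<Rightarrow> complex) \<Rightarrow> complex \<times> complex \<Rightarrow> complex^2^2"
  where "transition k j p x = mat2 (fst x ^ j) (ext_poly k j p x) 0 (inverse (fst x) ^ j)"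

text \<open>A point of \<open>\<M>\<^sub>j(k)\<close> is the isomorphism class, among all rank 2 holomorphic bundles on \<open>Z_k\<close>,
  of a bundle with transition matrix \<open>transition k j p\<close>. Every bundle of splitting type \<open>j\<close>
  is of this form up to isomorphism, and two coefficient vectors have the same image
  if and only if they define isomorphic bundles (\<open>bundle_class_eq_iff\<close> below), so this is
  \<open>\<complex>\<^sup>m/\<sim>\<close> with the quotient topology.\<close>

definition moduli ::
    "nat \<Rightarrow> nat \<Rightarrow> (complex \<times> complex \<Rightarrow> complex^2^2) set topology"
  where "moduli k j = quotient_topology (coeff_space k j) (\<lambda>p. bundle_class k (transition k j p))"


section \<open>Projective space and its closed subvarieties\<close>

definition punctured_space :: "nat \<Rightarrow> (nat \<Rightarrow> complex) topology"
  where "punctured_space n =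
    subtopology (product_topology (\<lambda>_. euclidean) {..n}) {x. \<exists>i\<le>n. x i \<noteq> 0}"

definition line_through :: "nat \<Rightarrow> (nat \<Rightarrow> complex) \<Rightarrow> (nat \<Rightarrow> complex) set"
  where "line_through n x = {(\<lambda>i\<in>{..n}. c * x i) |c. c \<noteq> 0}"

text \<open>\<open>\<P>\<^sup>n\<close> with the analytic topology and homogeneous coordinates indexed by \<open>0, \<dots>, n\<close>.
  The dimension is a natural number. In the dimension \<open>2 * j - k - 2\<close> with \<open>1 \<le> k \<le> j\<close> the
  subtraction truncates only for \<open>j = k = 1\<close>, where there is no projective space of dimension
  \<open>-1\<close>; it then gives \<open>\<P>\<^sup>0\<close>, a point, and \<open>moduli 1 1\<close> is a point too.\<close>

definition proj_space :: "nat \<Rightarrow> (nat \<Rightarrow> complex) set topology"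
  where "proj_space n = quotient_topology (punctured_space n) (line_through n)"

text \<open>Polynomials over \<open>\<complex>\<close> in variables indexed by \<open>nat\<close> are finitely supported maps from
  exponent vectors to coefficients.\<close>

type_synonym mpoly = "(nat \<Rightarrow>\<^sub>0 nat) \<Rightarrow>\<^sub>0 complex"

definition mpoly_eval :: "mpoly \<Rightarrow> (nat \<Rightarrow> complex) \<Rightarrow> complex"
  where "mpoly_eval f x =
    (\<Sum>m\<in>Poly_Mapping.keys f. Poly_Mapping.lookup f m *
        (\<Prod>i\<in>Poly_Mapping.keys m. x i ^ Poly_Mapping.lookup m i))"

definition homogeneous_poly :: "nat \<Rightarrow> mpoly \<Rightarrow> bool"
  where "homogeneous_poly n f \<longleftrightarrow>
    (\<exists>d. \<forall>m\<in>Poly_Mapping.keys f. Poly_Mapping.keys m \<subseteq> {..n} \<and>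
       (\<Sum>i\<in>Poly_Mapping.keys m. Poly_Mapping.lookup m i) = d)"

text \<open>Closed subvarieties may be empty or reducible.\<close>

definition closed_subvariety :: "nat \<Rightarrow> (nat \<Rightarrow> complex) set set \<Rightarrow> bool"
  where "closed_subvariety n X \<longleftrightarrow>
    (\<exists>F. (\<forall>f\<in>F. homogeneous_poly n f) \<and>
       X = line_through n ` {x \<in> topspace (punctured_space n). \<forall>f\<in>F. mpoly_eval f x = 0})"

definition irreducible_subvariety :: "nat \<Rightarrow> (nat \<Rightarrow> complex) set set \<Rightarrow> bool"
  where "irreducible_subvariety n X \<longleftrightarrow>
    closed_subvariety n X \<and> X \<noteq> {} \<and>
    (\<forall>Y Z. closed_subvariety n Y \<and> closed_subvariety n Z \<and> X = Y \<union> Z \<longrightarrow> X = Y \<or> X = Z)"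

text \<open>The Krull dimension: the supremum of the lengths \<open>l\<close> of chains
  \<open>C 0 \<subset> \<dots> \<subset> C l\<close> of irreducible closed subsets of \<open>X\<close>. It is \<open>-\<infinity>\<close> for empty \<open>X\<close>,
  so that the empty subvariety has codimension \<open>\<infinity>\<close>.\<close>

definition subvariety_dim :: "nat \<Rightarrow> (nat \<Rightarrow> complex) set set \<Rightarrow> ereal"
  where "subvariety_dim n X =
    Sup {ereal (real l) |l. \<exists>C. (\<forall>i\<le>l. irreducible_subvariety n (C i) \<and> C i \<subseteq> X) \<and>
                                (\<forall>i<l. C i \<subset> C (Suc i))}"

definition subvariety_codim :: "nat \<Rightarrow> (nat \<Rightarrow> complex) set set \<Rightarrow> ereal"
  where "subvariety_codim n X = ereal (real n) - subvariety_dim n X"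


section \<open>Basic consistency facts\<close>

lemma card_coeff_index:
  assumes "k \<ge> 1" "j \<ge> 1"
  defines "N \<equiv> (2 * j - 2) div k"
  shows "int (card (coeff_index k j)) = int N * (2 * int j - 1) - int k * int ((N + 1) choose 2)"
proof -
  have le: "k * r \<le> 2 * j - 2" if "r \<in> {1..N}" for r
  proof -
    have "k * r \<le> k * N" using that by simp
    also have "\<dots> \<le> 2 * j - 2" by (simp add: N_def)
    finally show ?thesis .
  qed
  have "int (card (coeff_index k j)) =
      (\<Sum>r\<in>{1..N}. int (nat (2 * int j - 1 - int k * int r)))"
    by (simp add: coeff_index_def N_def algebra_simps)
  also have "\<dots> = (\<Sum>r\<in>{1..N}. 2 * int j - 1 - int k * int r)"
  proof (rule sum.cong)
    fix r assume "r \<in> {1..N}"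
    from le[OF this] assms(2) have "int (k * r) \<le> 2 * int j - 2" by linarith
    then show "int (nat (2 * int j - 1 - int k * int r)) = 2 * int j - 1 - int k * int r" by simp
  qed simp
  also have "\<dots> = int N * (2 * int j - 1) - int k * (\<Sum>r\<in>{1..N}. int r)"
    by (simp add: sum_subtractf sum_distrib_left)
  also have "(\<Sum>r\<in>{1..N}. int r) = int ((N + 1) choose 2)"
    by (induction N) (simp_all add: numeral_2_eq_2)
  finally show ?thesis .
qed

lemma mat2_nth [simp]:
  "mat2 a b c d $ 1 $ 1 = a" "mat2 a b c d $ 1 $ 2 = b"
  "mat2 a b c d $ 2 $ 1 = c" "mat2 a b c d $ 2 $ 2 = d"
  by (simp_all add: mat2_def)

lemma det_mat2: "det (mat2 a b c d) = a * d - b * c"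
  by (simp add: det_2)

lemma holomorphic2_on_const [intro]: "open S \<Longrightarrow> holomorphic2_on (\<lambda>x. c) S"
  unfolding holomorphic2_on_def
  by (auto intro!: exI[of _ 0])

lemma holomorphic2_on_add:
  assumes "holomorphic2_on f S" "holomorphic2_on g S"
  shows "holomorphic2_on (\<lambda>x. f x + g x) S"
  unfolding holomorphic2_on_def
proof (intro conjI ballI)
  show "open S" using assms by (simp add: holomorphic2_on_def)
  fix x assume "x \<in> S"
  with assms obtain a b c d where
    "(f has_derivative (\<lambda>h. a * fst h + b * snd h)) (at x)"
    "(g has_derivative (\<lambda>h. c * fst h + d * snd h)) (at x)"
    unfolding holomorphic2_on_def by blast
  from has_derivative_add[OF this]
  have "((\<lambda>x. f x + g x) has_derivative (\<lambda>h. (a + c) * fst h + (b + d) * snd h)) (at x)"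
    by (simp add: algebra_simps)
  then show "\<exists>a b. ((\<lambda>x. f x + g x) has_derivative (\<lambda>h. a * fst h + b * snd h)) (at x)" by blast
qed

lemma holomorphic2_on_mult:
  assumes "holomorphic2_on f S" "holomorphic2_on g S"
  shows "holomorphic2_on (\<lambda>x. f x * g x) S"
  unfolding holomorphic2_on_def
proof (intro conjI ballI)
  show "open S" using assms by (simp add: holomorphic2_on_def)
  fix x assume "x \<in> S"
  with assms obtain a b c d where
    "(f has_derivative (\<lambda>h. a * fst h + b * snd h)) (at x)"
    "(g has_derivative (\<lambda>h. c * fst h + d * snd h)) (at x)"
    unfolding holomorphic2_on_def by blast
  from has_derivative_mult[OF this]
  have "((\<lambda>x. f x * g x) has_derivative
     (\<lambda>h. (f x * c + a * g x) * fst h + (f x * d + b * g x) * snd h)) (at x)"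
    by (simp add: algebra_simps)
  then show "\<exists>a b. ((\<lambda>x. f x * g x) has_derivative (\<lambda>h. a * fst h + b * snd h)) (at x)" by blast
qed

lemma holomorphic2_on_compose1:
  assumes "open S" and g: "holomorphic2_on g S"
    and f: "\<And>x. x \<in> S \<Longrightarrow> \<exists>D. (f has_field_derivative D) (at (g x))"
  shows "holomorphic2_on (\<lambda>x. f (g x)) S"
  unfolding holomorphic2_on_def
proof (intro conjI ballI)
  show "open S" by fact
  fix x assume x: "x \<in> S"
  with g obtain a b where g': "(g has_derivative (\<lambda>h. a * fst h + b * snd h)) (at x)"
    unfolding holomorphic2_on_def by blast
  from f[OF x] obtain D where "(f has_derivative (*) D) (at (g x))"
    by (auto simp: has_field_derivative_def)
  from has_derivative_compose[OF g' this]
  have "((\<lambda>x. f (g x)) has_derivative (\<lambda>h. (D * a) * fst h + (D * b) * snd h)) (at x)"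
    by (simp add: algebra_simps)
  then show "\<exists>a b. ((\<lambda>x. f (g x)) has_derivative (\<lambda>h. a * fst h + b * snd h)) (at x)" by blast
qed

lemma holomorphic2_on_fst: "open S \<Longrightarrow> holomorphic2_on fst S"
  unfolding holomorphic2_on_def
proof (intro conjI ballI exI)
  fix x :: "complex \<times> complex"
  show "(fst has_derivative (\<lambda>h. 1 * fst h + 0 * snd h)) (at x)"
    using has_derivative_fst[OF has_derivative_ident, of "at x"] by simp
qed

lemma holomorphic2_on_snd: "open S \<Longrightarrow> holomorphic2_on snd S"
  unfolding holomorphic2_on_def
proof (intro conjI ballI exI)
  fix x :: "complex \<times> complex"
  show "(snd has_derivative (\<lambda>h. 0 * fst h + 1 * snd h)) (at x)"
    using has_derivative_snd[OF has_derivative_ident, of "at x"] by simp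
qed

lemma holomorphic2_on_sum:
  assumes "open S" "\<And>i. i \<in> I \<Longrightarrow> holomorphic2_on (f i) S"
  shows "holomorphic2_on (\<lambda>x. \<Sum>i\<in>I. f i x) S"
  using assms(2)
proof (induction I rule: infinite_finite_induct)
  case (insert i I)
  then show ?case by (simp add: holomorphic2_on_add)
qed (simp_all add: holomorphic2_on_const assms(1))

lemma holomorphic2_on_power:
  assumes "open S" "holomorphic2_on f S"
  shows "holomorphic2_on (\<lambda>x. f x ^ r) S"
  by (induction r) (simp_all add: holomorphic2_on_const holomorphic2_on_mult assms)

lemma open_overlap: "open overlap"
proof -
  have "overlap = fst -` (- {0})" by (auto simp: overlap_def)
  moreover have "open (fst -` (- {0::complex}) :: (complex \<times> complex) set)"
    by (intro open_vimage_fst open_Compl closed_singleton)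
  ultimately show ?thesis by simp
qed

lemma holomorphic2_on_inverse_fst: "holomorphic2_on (\<lambda>x. inverse (fst x)) overlap"
proof (rule holomorphic2_on_compose1[OF open_overlap holomorphic2_on_fst[OF open_overlap]])
  fix x assume "x \<in> overlap"
  then show "\<exists>D. (inverse has_field_derivative D) (at (fst x))"
    using DERIV_inverse[of "fst x" UNIV] by (auto simp: overlap_def)
qed

lemma holomorphic2_on_powi_fst: "holomorphic2_on (\<lambda>x. fst x powi s) overlap"
  unfolding power_int_def
  by (cases "s \<ge> 0")
     (simp_all add: holomorphic2_on_power open_overlap holomorphic2_on_fst
       holomorphic2_on_inverse_fst)

lemma rank2_bundle_transition: "rank2_bundle (transition k j p)"
proof -
  have "holomorphic2_on (ext_poly k j p) overlap"
    unfolding ext_poly_def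
    by (intro holomorphic2_on_sum holomorphic2_on_mult holomorphic2_on_const
         holomorphic2_on_power holomorphic2_on_powi_fst holomorphic2_on_snd open_overlap)
  moreover have "holomorphic2_on (\<lambda>x. fst x ^ j) overlap"
    by (intro holomorphic2_on_power holomorphic2_on_fst open_overlap)
  moreover have "holomorphic2_on (\<lambda>x. inverse (fst x) ^ j) overlap"
    by (intro holomorphic2_on_power holomorphic2_on_inverse_fst open_overlap)
  ultimately have "\<forall>i l. holomorphic2_on (\<lambda>x. transition k j p x $ i $ l) overlap"
    unfolding forall_2 transition_def
    by (simp add: holomorphic2_on_const open_overlap)
  moreover have "invertible (transition k j p x)" if "x \<in> overlap" for x
    using that by (simp add: transition_def invertible_det_nz det_mat2 overlap_def
        case_prod_beta)
  ultimately show ?thesis by (simp add: rank2_bundle_def holomorphic_GL2_on_def)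
qed

lemma splitting_type_transition: "splitting_type (transition k j p) j"
proof -
  have "ext_poly k j p (z, 0) = 0" for z
    unfolding ext_poly_def by (intro sum.neutral ballI) simp
  then have "mat 1 ** transition k j p (z, 0) = mat2 (z ^ j) 0 0 (inverse z ^ j) ** mat 1" for z
    by (simp add: transition_def)
  then show ?thesis
    unfolding splitting_type_def
    by (intro exI[of _ "\<lambda>z. mat 1"])
       (auto simp: invertible_def intro!: exI[of _ "mat 1"])
qed

lemma bundle_iso_refl: "bundle_iso k T T"
proof -
  have "holomorphic_GL2_on (\<lambda>x. mat 1) UNIV"
    by (auto simp: holomorphic_GL2_on_def invertible_def intro!: exI[of _ "mat 1"])
  then show ?thesis
    unfolding bundle_iso_def
    by (intro exI[of _ "\<lambda>x. mat 1"] exI[of _ "\<lambda>x. mat 1"]) auto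
qed

lemma holomorphic_GL2_on_mult:
  assumes "holomorphic_GL2_on A S" "holomorphic_GL2_on B S"
  shows "holomorphic_GL2_on (\<lambda>x. A x ** B x) S"
  unfolding holomorphic_GL2_on_def
proof (intro conjI allI ballI)
  fix i l
  show "holomorphic2_on (\<lambda>x. (A x ** B x) $ i $ l) S"
    using assms unfolding holomorphic_GL2_on_def
    by (simp add: matrix_matrix_mult_def sum_2 holomorphic2_on_add holomorphic2_on_mult)
  show "invertible (A x ** B x)" if "x \<in> S" for x
    using assms that by (simp add: holomorphic_GL2_on_def invertible_mult)
qed

definition inv2 :: "complex^2^2 \<Rightarrow> complex^2^2"
  where "inv2 A = mat2 (A$2$2 / det A) (- A$1$2 / det A) (- A$2$1 / det A) (A$1$1 / det A)"

lemma inv2: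
  assumes "invertible A"
  shows "inv2 A ** A = mat 1" "A ** inv2 A = mat 1"
proof -
  have "det A \<noteq> 0" using assms by (simp add: invertible_det_nz)
  then show "A ** inv2 A = mat 1"
    unfolding vec_eq_iff forall_2
    by (simp add: matrix_matrix_mult_def sum_2 inv2_def mat_def field_simps) (simp add: det_2)
  then show "inv2 A ** A = mat 1" by (simp add: matrix_left_right_inverse)
qed

lemma holomorphic_GL2_on_inv2:
  assumes "holomorphic_GL2_on A S" "open S"
  shows "holomorphic_GL2_on (\<lambda>x. inv2 (A x)) S"
proof -
  have A: "holomorphic2_on (\<lambda>x. A x $ i $ l) S" for i l
    using assms by (simp add: holomorphic_GL2_on_def)
  have nz: "det (A x) \<noteq> 0" if "x \<in> S" for x
    using assms that by (simp add: holomorphic_GL2_on_def invertible_det_nz)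
  have "holomorphic2_on (\<lambda>x. A x $ 1 $ 1 * A x $ 2 $ 2 + (-1) * (A x $ 1 $ 2 * A x $ 2 $ 1)) S"
    by (intro holomorphic2_on_add holomorphic2_on_mult holomorphic2_on_const A assms)
  then have det: "holomorphic2_on (\<lambda>x. det (A x)) S"
    by (simp add: det_2)
  have inv: "holomorphic2_on (\<lambda>x. inverse (det (A x))) S"
  proof (rule holomorphic2_on_compose1[OF assms(2) det])
    fix x assume "x \<in> S"
    then show "\<exists>D. (inverse has_field_derivative D) (at (det (A x)))"
      using DERIV_inverse[of "det (A x)" UNIV] nz by auto
  qed
  have "holomorphic2_on (\<lambda>x. A x $ i $ l * inverse (det (A x))) S"
       "holomorphic2_on (\<lambda>x. (-1) * (A x $ i $ l * inverse (det (A x)))) S" for i l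
    by (intro holomorphic2_on_mult holomorphic2_on_const A inv assms)+
  then have "\<forall>i l. holomorphic2_on (\<lambda>x. inv2 (A x) $ i $ l) S"
    unfolding forall_2 inv2_def by (simp add: divide_inverse)
  moreover have "invertible (inv2 (A x))" if "x \<in> S" for x
    using assms that inv2[of "A x"] unfolding holomorphic_GL2_on_def invertible_def by blast
  ultimately show ?thesis by (simp add: holomorphic_GL2_on_def)
qed

lemma bundle_iso_sym:
  assumes "bundle_iso k T T'"
  shows "bundle_iso k T' T"
proof -
  obtain A B where A: "holomorphic_GL2_on A UNIV" and B: "holomorphic_GL2_on B UNIV"
    and eq: "\<And>x. x \<in> overlap \<Longrightarrow> B (to_V k x) ** T x = T' x ** A x"
    using assms unfolding bundle_iso_def by blast
  have iA: "invertible (A x)" and iB: "invertible (B x)" for x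
    using A B unfolding holomorphic_GL2_on_def by blast+
  have "inv2 (B (to_V k x)) ** T' x = T x ** inv2 (A x)" if "x \<in> overlap" for x
  proof -
    have "inv2 (B (to_V k x)) ** T' x = inv2 (B (to_V k x)) ** (T' x ** A x) ** inv2 (A x)"
      by (simp add: matrix_mul_assoc[symmetric] inv2[OF iA])
    also have "\<dots> = inv2 (B (to_V k x)) ** (B (to_V k x) ** T x) ** inv2 (A x)"
      by (simp add: eq[OF that])
    also have "\<dots> = T x ** inv2 (A x)"
      by (simp add: matrix_mul_assoc inv2[OF iB])
    finally show ?thesis .
  qed
  with holomorphic_GL2_on_inv2[OF A] holomorphic_GL2_on_inv2[OF B]
  show ?thesis unfolding bundle_iso_def
    by (intro exI[of _ "\<lambda>x. inv2 (A x)"] exI[of _ "\<lambda>x. inv2 (B x)"]) simp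
qed

lemma bundle_iso_trans:
  assumes "bundle_iso k T T'" "bundle_iso k T' T''"
  shows "bundle_iso k T T''"
proof -
  obtain A B where A: "holomorphic_GL2_on A UNIV" and B: "holomorphic_GL2_on B UNIV"
    and eq: "\<And>x. x \<in> overlap \<Longrightarrow> B (to_V k x) ** T x = T' x ** A x"
    using assms unfolding bundle_iso_def by blast
  obtain A' B' where A': "holomorphic_GL2_on A' UNIV" and B': "holomorphic_GL2_on B' UNIV"
    and eq': "\<And>x. x \<in> overlap \<Longrightarrow> B' (to_V k x) ** T' x = T'' x ** A' x"
    using assms unfolding bundle_iso_def by blast
  have "(B' (to_V k x) ** B (to_V k x)) ** T x = T'' x ** (A' x ** A x)" if "x \<in> overlap" for x
    using eq[OF that] eq'[OF that] by (metis matrix_mul_assoc)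
  with holomorphic_GL2_on_mult[OF A' A] holomorphic_GL2_on_mult[OF B' B]
  show ?thesis unfolding bundle_iso_def
    by (intro exI[of _ "\<lambda>x. A' x ** A x"] exI[of _ "\<lambda>x. B' x ** B x"]) simp
qed

lemma bundle_class_eq_iff:
  "bundle_class k (transition k j p) = bundle_class k (transition k j p') \<longleftrightarrow>
     bundle_iso k (transition k j p) (transition k j p')"
proof
  assume "bundle_class k (transition k j p) = bundle_class k (transition k j p')"
  then have "transition k j p' \<in> bundle_class k (transition k j p)"
    by (simp add: bundle_class_def rank2_bundle_transition bundle_iso_refl)
  then show "bundle_iso k (transition k j p) (transition k j p')"
    by (simp add: bundle_class_def)
next
  assume "bundle_iso k (transition k j p) (transition k j p')"
  then show "bundle_class k (transition k j p) = bundle_class k (transition k j p')"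
    unfolding bundle_class_def using bundle_iso_sym bundle_iso_trans by blast
qed

end

theory Submission
  imports Defs "HOL-Complex_Analysis.Cauchy_Integral_Formula"
begin

text \<open>The first order part of \<open>p\<close>, i.e. its \<open>2 j - k - 1\<close> coefficients with \<open>r = 1\<close>, is an isomorphism
  invariant up to scaling. Conversely, a generic first order part determines the bundle. Choosing another
  line subbundle \<open>\<O>(-j)\<close>, spanned on \<open>U\<close> by a column \<open>(1 - h, \<gamma> z\<^sup>t u\<^bsup>r-2\<^esup>)\<close>, changes the coefficients of
  order \<open>r \<ge> 2\<close> by \<open>\<gamma>\<close> times quadratic forms in the first order part and leaves those of lower order alone, so
  \<open>p\<close> can be reduced to its first order part as soon as certain square matrices \<open>M\<^sub>r\<close> of quadratic forms
  are invertible. If \<open>x\<^sub>s\<close> is the first nonzero first order coefficient and \<open>0 \<le> s \<le> k\<close>, then \<open>M\<^sub>r\<close> is triangular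
  with diagonal entries \<open>\<plusminus>x\<^sub>s\<^sup>2\<close>. So there are forms \<open>F\<^sub>0, \<dots>, F\<^sub>k\<close>, each a pure power of \<open>x\<^sub>s\<close> up to monomials
  involving a smaller variable, such that all first order parts outside their common zero locus are generic, and the
  shape of these equations forces the zero locus to have codimension at least \<open>k + 1\<close>.\<close>

section \<open>Laurent polynomials and isomorphisms\<close>

text \<open>The range 0 \<le> s \<le> k comes from holomorphy in both charts. The lower entry of the
  spanning column is \<gamma> z^t u^(r-2) on U and \<gamma> \<zeta>^(2j - t + k(r-2)) v^(r-2) on V,
  so 0 \<le> t \<le> 2j + k(r-2) is required. To get \<plusminus>x_s^2 on the diagonal, the column
  of index d must use t = d - 2s + j, and as d runs over the exponents of order r this stays in
  range for all r \<ge> 2 if 0 \<le> s \<le> k; r = 2 is the tight case. These k + 1 positions give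
  the k + 1 of the codimension bound. They are all available once j > k; for j = k the projective
  space has dimension k - 2 and only an empty subvariety can qualify. The codimension is bounded by
  counting. A chain of l + 1 irreducible subvarieties carries l + 1 forms that are algebraically
  independent on its top member, so there are E^(l+1) independent power products of degree O(E). The
  equations leave a space spanned by O(E^(n-k)) monomials of such degrees, where n is the dimension
  of the projective space; hence l \<le> n - k - 1.\<close>

type_synonym laurent = "(int \<times> int) \<Rightarrow>\<^sub>0 complex"

abbreviation lkeys :: "laurent \<Rightarrow> (int \<times> int) set" where "lkeys \<equiv> Poly_Mapping.keys"
abbreviation lcoeff :: "laurent \<Rightarrow> int \<times> int \<Rightarrow> complex" where "lcoeff \<equiv> Poly_Mapping.lookup"
abbreviation lmonom :: "int \<times> int \<Rightarrow> complex \<Rightarrow> laurent" where "lmonom \<equiv> Poly_Mapping.single"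

section \<open>Evaluation and supports of Laurent polynomials\<close>

definition lrestrict :: "(int \<times> int \<Rightarrow> bool) \<Rightarrow> laurent \<Rightarrow> laurent"
  where "lrestrict P f = Poly_Mapping.mapp (\<lambda>a c. if P a then c else 0) f"

lemma lcoeff_lrestrict: "lcoeff (lrestrict P f) a = (if P a then lcoeff f a else 0)"
  by (auto simp: lrestrict_def lookup_mapp when_def in_keys_iff)

lemma lkeys_lrestrict: "lkeys (lrestrict P f) = {a \<in> lkeys f. P a}"
  by (auto simp: in_keys_iff lcoeff_lrestrict split: if_splits)

lemma lrestrict_split: "lrestrict P f + lrestrict (\<lambda>a. \<not> P a) f = f"
  by (rule poly_mapping_eqI) (simp add: lookup_add lcoeff_lrestrict)

lemma sum_lmonom: "(\<Sum>a\<in>lkeys f. lmonom a (lcoeff f a)) = f"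
  by (rule poly_mapping_eqI)
     (auto simp: lookup_sum lookup_single when_def sum.delta' in_keys_iff)

definition leval :: "(int \<times> int \<Rightarrow> complex) \<Rightarrow> laurent \<Rightarrow> complex"
  where "leval w f = (\<Sum>a\<in>lkeys f. lcoeff f a * w a)"

lemma leval_superset:
  assumes "finite K" "lkeys f \<subseteq> K"
  shows "leval w f = (\<Sum>a\<in>K. lcoeff f a * w a)"
  unfolding leval_def using assms
  by (intro sum.mono_neutral_left) (auto simp: in_keys_iff)

lemma leval_add: "leval w (f + g) = leval w f + leval w g"
proof -
  let ?K = "lkeys f \<union> lkeys g"
  have "lkeys (f + g) \<subseteq> ?K" by (rule keys_add)
  then show ?thesis
    using leval_superset[of ?K f w] leval_superset[of ?K g w] leval_superset[of ?K "f + g" w]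
    by (simp add: lookup_add algebra_simps sum.distrib)
qed

lemma leval_zero [simp]: "leval w 0 = 0"
  by (simp add: leval_def)

lemma leval_uminus: "leval w (- f) = - leval w f"
  using leval_add[of w f "- f"] by (simp add: eq_neg_iff_add_eq_0 add.commute)

lemma leval_diff: "leval w (f - g) = leval w f - leval w g"
  using leval_add[of w f "- g"] by (simp add: leval_uminus)

lemma leval_sum: "leval w (\<Sum>i\<in>I. f i) = (\<Sum>i\<in>I. leval w (f i))"
  by (induction I rule: infinite_finite_induct) (simp_all add: leval_add)

lemma leval_lmonom [simp]: "leval w (lmonom a c) = c * w a"
  by (cases "c = 0") (simp_all add: leval_def)

text \<open>Multiplicativity of \<open>w\<close> is asked for on the supports only:
  \<open>monU\<close> and \<open>monV\<close> cut off negative exponents by \<open>nat\<close>, so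
  they are not multiplicative on all pairs of integers.\<close>

lemma leval_mult:
  assumes "\<And>a b. a \<in> lkeys f \<Longrightarrow> b \<in> lkeys g \<Longrightarrow> w (a + b) = w a * w b"
  shows "leval w (f * g) = leval w f * leval w g"
proof -
  have "f * g = (\<Sum>a\<in>lkeys f. \<Sum>b\<in>lkeys g. lmonom (a + b) (lcoeff f a * lcoeff g b))"
    by (subst (1) sum_lmonom[of f, symmetric], subst (1) sum_lmonom[of g, symmetric])
       (simp add: sum_product mult_single)
  then have "leval w (f * g) =
      (\<Sum>a\<in>lkeys f. \<Sum>b\<in>lkeys g. lcoeff f a * lcoeff g b * w (a + b))"
    by (simp add: leval_sum)
  also have "\<dots> = (\<Sum>a\<in>lkeys f. \<Sum>b\<in>lkeys g. (lcoeff f a * w a) * (lcoeff g b * w b))"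
    using assms by (intro sum.cong refl) (simp add: mult_ac)
  finally show ?thesis by (simp add: leval_def sum_product)
qed

lemma leval_cong:
  assumes "\<And>a. a \<in> lkeys f \<Longrightarrow> w a = w' a"
  shows "leval w f = leval w' f"
  unfolding leval_def using assms by (intro sum.cong) auto

lemma lkeys_mult:
  assumes "lkeys f \<subseteq> K" "lkeys g \<subseteq> L" "\<And>a b. a \<in> K \<Longrightarrow> b \<in> L \<Longrightarrow> a + b \<in> M"
  shows "lkeys (f * g) \<subseteq> M"
  using keys_mult[of f g] assms by blast

lemma lkeys_add:
  fixes f g :: laurent
  shows "lkeys f \<subseteq> K \<Longrightarrow> lkeys g \<subseteq> K \<Longrightarrow> lkeys (f + g) \<subseteq> K"
  using keys_add[of f g] by blast

lemma lkeys_uminus: "lkeys (- f) = lkeys f"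
  by (auto simp: in_keys_iff)

lemma lkeys_diff:
  fixes f g :: laurent
  shows "lkeys f \<subseteq> K \<Longrightarrow> lkeys g \<subseteq> K \<Longrightarrow> lkeys (f - g) \<subseteq> K"
  using lkeys_add[of f K "- g"] by (simp add: lkeys_uminus)

lemma lkeys_sum:
  fixes f :: "'i \<Rightarrow> laurent"
  assumes "\<And>i. i \<in> I \<Longrightarrow> lkeys (f i) \<subseteq> K"
  shows "lkeys (\<Sum>i\<in>I. f i) \<subseteq> K"
  using assms by (induction I rule: infinite_finite_induct) (simp_all add: lkeys_add)

lemma lkeys_power:
  assumes "lkeys f \<subseteq> {(r, s). r \<ge> \<rho> \<and> s \<ge> \<sigma>}"
  shows "lkeys (f ^ i) \<subseteq> {(r, s). r \<ge> int i * \<rho> \<and> s \<ge> int i * \<sigma>}"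
proof (induction i)
  case (Suc i)
  show ?case unfolding power_Suc
    by (rule lkeys_mult[OF assms Suc]) (auto simp: algebra_simps)
qed (auto simp: zero_prod_def)

lemma lkeys_power_V:
  assumes "lkeys f \<subseteq> {(r, s). r \<ge> \<rho> \<and> \<kappa> * r - s \<ge> \<sigma>}"
  shows "lkeys (f ^ i) \<subseteq> {(r, s). r \<ge> int i * \<rho> \<and> \<kappa> * r - s \<ge> int i * \<sigma>}"
proof (induction i)
  case (Suc i)
  show ?case unfolding power_Suc
    by (rule lkeys_mult[OF assms Suc]) (auto simp: algebra_simps)
qed (auto simp: zero_prod_def)

text \<open>The exponent \<open>(r, s)\<close> stands for the monomial \<open>z\<^sup>s u\<^sup>r = \<zeta>\<^bsup>k r - s\<^esup> v\<^sup>r\<close>.\<close>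

definition monU :: "complex \<times> complex \<Rightarrow> int \<times> int \<Rightarrow> complex"
  where "monU x a = fst x powi snd a * snd x ^ nat (fst a)"

definition monV :: "nat \<Rightarrow> complex \<times> complex \<Rightarrow> int \<times> int \<Rightarrow> complex"
  where "monV k y a = fst y ^ nat (int k * fst a - snd a) * snd y ^ nat (fst a)"

text \<open>Supports of polynomials in (z, u), respectively in (\<zeta>, v): on V the exponent k r -
  s of \<zeta> has to be nonnegative.\<close>

definition Upos :: "(int \<times> int) set" where "Upos = {(r, s). r \<ge> 0 \<and> s \<ge> 0}"
definition Vpos :: "nat \<Rightarrow> (int \<times> int) set" where "Vpos k = {(r, s). r \<ge> 0 \<and> s \<le> int k * r}"

lemma monU_add:
  assumes "fst a \<ge> 0" "fst b \<ge> 0" "fst x \<noteq> 0"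
  shows "monU x (a + b) = monU x a * monU x b"
  using assms by (simp add: monU_def power_int_add nat_add_distrib power_add)

lemma monV_to_V:
  assumes "a \<in> Vpos k" "fst x \<noteq> 0"
  shows "monV k (to_V k x) a = monU x a"
proof -
  define r where "r = nat (fst a)"
  define m where "m = nat (int k * fst a - snd a)"
  have r: "fst a = int r" and s: "snd a = int (k * r) - int m"
    using assms(1) by (auto simp: Vpos_def r_def m_def)
  have "monV k (to_V k x) a = inverse (fst x) ^ m * (fst x ^ (k * r) * snd x ^ r)"
    unfolding monV_def to_V_def by (simp add: r_def m_def power_mult_distrib power_mult)
  also have "\<dots> = fst x powi (int (k * r) - int m) * snd x ^ r"
    using assms(2) by (simp add: power_int_diff field_simps del: of_nat_mult)
  finally show ?thesis by (simp add: monU_def r s)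
qed

lemma holomorphic2_on_leval_monU:
  assumes "lkeys f \<subseteq> Upos"
  shows "holomorphic2_on (\<lambda>x. leval (monU x) f) UNIV"
proof -
  have "leval (monU x) f = leval (\<lambda>a. fst x ^ nat (snd a) * snd x ^ nat (fst a)) f" for x
    using assms by (intro leval_cong) (auto simp: Upos_def monU_def power_int_def)
  then show ?thesis unfolding leval_def
    by (simp, intro holomorphic2_on_sum holomorphic2_on_mult holomorphic2_on_const
         holomorphic2_on_power holomorphic2_on_fst holomorphic2_on_snd open_UNIV)
qed

lemma holomorphic2_on_leval_monV: "holomorphic2_on (\<lambda>x. leval (monV k x) f) UNIV"
  unfolding leval_def monV_def
  by (intro holomorphic2_on_sum holomorphic2_on_mult holomorphic2_on_const
      holomorphic2_on_power holomorphic2_on_fst holomorphic2_on_snd open_UNIV)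

section \<open>Isomorphisms given by matrices of Laurent polynomials\<close>

definition matrixU :: "laurent \<Rightarrow> laurent \<Rightarrow> laurent \<Rightarrow> laurent \<Rightarrow> complex \<times> complex \<Rightarrow> complex^2^2"
  where "matrixU a b c d x =
    mat2 (leval (monU x) a) (leval (monU x) b) (leval (monU x) c) (leval (monU x) d)"

definition matrixV ::
    "nat \<Rightarrow> laurent \<Rightarrow> laurent \<Rightarrow> laurent \<Rightarrow> laurent \<Rightarrow> complex \<times> complex \<Rightarrow> complex^2^2"
  where "matrixV k a b c d x =
    mat2 (leval (monV k x) a) (leval (monV k x) b) (leval (monV k x) c) (leval (monV k x) d)"

lemma leval_one_U [simp]: "leval (monU x) 1 = 1"
  unfolding single_one[symmetric] leval_lmonom by (simp add: monU_def)

lemma leval_one_V [simp]: "leval (monV k x) 1 = 1"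
  unfolding single_one[symmetric] leval_lmonom by (simp add: monV_def)

text \<open>This covers z = 0, where \<open>powi\<close> is not additive in the exponent;
  nonnegative exponents save it. The determinant has to be evaluated at such points too.\<close>

lemma leval_mult_U0:
  assumes "lkeys f \<subseteq> Upos" "lkeys g \<subseteq> Upos"
  shows "leval (monU x) (f * g) = leval (monU x) f * leval (monU x) g"
proof (rule leval_mult)
  fix a b assume "a \<in> lkeys f" "b \<in> lkeys g"
  then have "a \<in> Upos" "b \<in> Upos" using assms by auto
  then show "monU x (a + b) = monU x a * monU x b"
    by (auto simp: Upos_def monU_def power_int_def nat_add_distrib power_add)
qed

lemma leval_mult_V:
  assumes "lkeys f \<subseteq> Vpos k" "lkeys g \<subseteq> Vpos k"
  shows "leval (monV k x) (f * g) = leval (monV k x) f * leval (monV k x) g"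
proof (rule leval_mult)
  fix a b assume "a \<in> lkeys f" "b \<in> lkeys g"
  then have "a \<in> Vpos k" "b \<in> Vpos k" using assms by auto
  then obtain r s r' s' where "a = (r, s)" "b = (r', s')" "r \<ge> 0" "r' \<ge> 0"
     "int k * r - s \<ge> 0" "int k * r' - s' \<ge> 0"
    by (auto simp: Vpos_def)
  moreover have "int k * (r + r') - (s + s') = (int k * r - s) + (int k * r' - s')"
    by (simp add: algebra_simps)
  ultimately have "nat (int k * (r + r') - (s + s')) = nat (int k * r - s) + nat (int k * r' - s')"
    by (simp add: nat_add_distrib)
  with \<open>a = (r, s)\<close> \<open>b = (r', s')\<close> \<open>r \<ge> 0\<close> \<open>r' \<ge> 0\<close> show "monV k x (a + b) = monV k x a * monV k x b"
    by (simp add: monV_def nat_add_distrib power_add)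
qed

lemma holomorphic_GL2_matrixU:
  assumes "lkeys a \<subseteq> Upos" "lkeys b \<subseteq> Upos" "lkeys c \<subseteq> Upos" "lkeys d \<subseteq> Upos"
    and "a * d - b * c = 1"
  shows "holomorphic_GL2_on (matrixU a b c d) UNIV"
proof -
  have "det (matrixU a b c d x) = 1" for x
    using arg_cong[OF assms(5), of "leval (monU x)"] assms(1-4)
    by (simp add: matrixU_def det_mat2 leval_diff leval_mult_U0)
  then have "invertible (matrixU a b c d x)" for x
    by (simp add: invertible_det_nz)
  then show ?thesis
    using assms by (simp add: holomorphic_GL2_on_def forall_2 matrixU_def holomorphic2_on_leval_monU)
qed

lemma holomorphic_GL2_matrixV:
  assumes "lkeys a \<subseteq> Vpos k" "lkeys b \<subseteq> Vpos k" "lkeys c \<subseteq> Vpos k" "lkeys d \<subseteq> Vpos k"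
    and "a * d - b * c = 1"
  shows "holomorphic_GL2_on (matrixV k a b c d) UNIV"
proof -
  have "det (matrixV k a b c d x) = 1" for x
    using arg_cong[OF assms(5), of "leval (monV k x)"] assms(1-4)
    by (simp add: matrixV_def det_mat2 leval_diff leval_mult_V)
  then have "invertible (matrixV k a b c d x)" for x
    by (simp add: invertible_det_nz)
  then show ?thesis
    using assms by (simp add: holomorphic_GL2_on_def forall_2 matrixV_def holomorphic2_on_leval_monV)
qed

definition laurent_transition :: "nat \<Rightarrow> laurent \<Rightarrow> complex \<times> complex \<Rightarrow> complex^2^2"
  where "laurent_transition j P x =
    mat2 (fst x ^ j) (leval (monU x) P) 0 (inverse (fst x) ^ j)"

definition rpos :: "(int \<times> int) set" where "rpos = {(r, s). r \<ge> 0}"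

lemma leval_mult_U:
  assumes "lkeys f \<subseteq> rpos" "lkeys g \<subseteq> rpos" "fst x \<noteq> 0"
  shows "leval (monU x) (f * g) = leval (monU x) f * leval (monU x) g"
  using assms by (intro leval_mult monU_add) (auto simp: rpos_def)

lemma leval_to_V:
  assumes "lkeys f \<subseteq> Vpos k" "fst x \<noteq> 0"
  shows "leval (monV k (to_V k x)) f = leval (monU x) f"
  using assms by (intro leval_cong monV_to_V) auto

lemma mat2_mult: "mat2 a b c d ** mat2 a' b' c' d' =
    mat2 (a * a' + b * c') (a * b' + b * d') (c * a' + d * c') (c * b' + d * d')"
  unfolding vec_eq_iff forall_2 by (simp add: matrix_matrix_mult_def sum_2)

lemma Upos_rpos: "Upos \<subseteq> rpos" and Vpos_rpos: "Vpos k \<subseteq> rpos"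
  by (auto simp: Upos_def Vpos_def rpos_def)

text \<open>The last four equations are the entries of B T_Q = T_P A for A = (a, b; c, d) on U and B
  = (a', b'; c', d') on V. As identities of Laurent polynomials they can be evaluated at every point
  of the overlap, and determinant 1 gives invertibility on the whole of each chart.\<close>

lemma bundle_iso_laurent:
  fixes j k :: nat and Q :: laurent
  defines "Z \<equiv> lmonom (0, int j) 1" and "Zi \<equiv> lmonom (0, - int j) 1"
  assumes U: "lkeys a \<subseteq> Upos" "lkeys b \<subseteq> Upos" "lkeys c \<subseteq> Upos" "lkeys d \<subseteq> Upos"
    and V: "lkeys a' \<subseteq> Vpos k" "lkeys b' \<subseteq> Vpos k" "lkeys c' \<subseteq> Vpos k" "lkeys d' \<subseteq> Vpos k"
    and PQ: "lkeys P \<subseteq> rpos" "lkeys Q \<subseteq> rpos"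
    and det: "a * d - b * c = 1" "a' * d' - b' * c' = 1"
    and "a' * Z = Z * a + P * c" "c' * Z = Zi * c"
    and "a' * Q + b' * Zi = Z * b + P * d" "c' * Q + d' * Zi = Zi * d"
  shows "bundle_iso k (laurent_transition j Q) (laurent_transition j P)"
proof -
  have "matrixV k a' b' c' d' (to_V k x) ** laurent_transition j Q x =
      laurent_transition j P x ** matrixU a b c d x" if "x \<in> overlap" for x
  proof -
    have x: "fst x \<noteq> 0" using that by (auto simp: overlap_def)
    have rp: "lkeys a \<subseteq> rpos" "lkeys b \<subseteq> rpos" "lkeys c \<subseteq> rpos" "lkeys d \<subseteq> rpos"
      "lkeys a' \<subseteq> rpos" "lkeys b' \<subseteq> rpos" "lkeys c' \<subseteq> rpos" "lkeys d' \<subseteq> rpos"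
      using U V Upos_rpos Vpos_rpos by (meson order_trans)+
    have ZZ: "lkeys Z \<subseteq> rpos" "lkeys Zi \<subseteq> rpos" by (auto simp: Z_def Zi_def rpos_def)
    have e: "leval (monU x) Z = fst x ^ j" "leval (monU x) Zi = inverse (fst x) ^ j"
      by (simp_all add: Z_def Zi_def monU_def power_int_minus power_inverse)
    note m = leval_mult_U[OF _ _ x] leval_add
    show ?thesis unfolding matrixV_def matrixU_def laurent_transition_def mat2_mult
      using assms(15-18)[THEN arg_cong[of _ _ "leval (monU x)"]]
      by (simp add: leval_to_V[OF _ x] V m rp ZZ PQ e)
  qed
  then show ?thesis unfolding bundle_iso_def
    using holomorphic_GL2_matrixU[OF U det(1)] holomorphic_GL2_matrixV[OF V det(2)]
    by blast
qed

section \<open>The filtration by order in u, and a change of line subbundle\<close>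

definition order_ge :: "int \<Rightarrow> (int \<times> int) set" where "order_ge m = {a. fst a \<ge> m}"

lemma order_ge_mono: "m \<le> m' \<Longrightarrow> order_ge m' \<subseteq> order_ge m"
  by (auto simp: order_ge_def)

lemma lkeys_mult_order:
  assumes "lkeys f \<subseteq> order_ge m" "lkeys g \<subseteq> order_ge m'" "l \<le> m + m'"
  shows "lkeys (f * g) \<subseteq> order_ge l"
  using assms by (intro lkeys_mult[OF assms(1,2)]) (auto simp: order_ge_def)

lemma lcoeff_order: "lkeys f \<subseteq> order_ge m \<Longrightarrow> r < m \<Longrightarrow> lcoeff f (r, s) = 0"
  by (force simp: order_ge_def in_keys_iff)

text \<open>If f is written as h - H with h its part divisible by z, this is h + H. It arises
  because the charts U and V absorb h and H separately, and each contributes with a plus sign to the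
  linear term of the new transition function.\<close>

definition signed :: "laurent \<Rightarrow> laurent"
  where "signed f = lrestrict (\<lambda>a. snd a \<ge> 1) f - lrestrict (\<lambda>a. \<not> snd a \<ge> 1) f"

definition pm_sign :: "int \<Rightarrow> complex" where "pm_sign s = (if s \<ge> 1 then 1 else - 1)"

lemma lcoeff_signed: "lcoeff (signed f) a = pm_sign (snd a) * lcoeff f a"
  by (simp add: signed_def pm_sign_def lookup_minus lcoeff_lrestrict)

lemma lkeys_signed: "lkeys (signed f) = lkeys f"
  by (auto simp: in_keys_iff lcoeff_signed pm_sign_def)

lemma signed_add: "signed (f + g) = signed f + signed g"
  by (rule poly_mapping_eqI) (simp add: lcoeff_signed lookup_add algebra_simps)

lemma signed_zero [simp]: "signed 0 = 0"
  by (rule poly_mapping_eqI) (simp add: lcoeff_signed)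

lemma signed_sum: "signed (\<Sum>i\<in>I. f i) = (\<Sum>i\<in>I. signed (f i))"
  by (induction I rule: infinite_finite_induct) (simp_all add: signed_add)

lemma signed_lmonom: "signed (lmonom a c) = lmonom a (pm_sign (snd a) * c)"
  by (rule poly_mapping_eqI) (simp add: lcoeff_signed lookup_single when_def)

text \<open>A column (1 - h, c) is completed to determinant 1: the geometric sum telescopes to 1 -
  h^n and the other product returns h^n. The inverse \<open>ci\<close> has poles where this is used,
  but for large n the entry \<open>ci * h ^ n\<close> has none.\<close>

lemma unipotent_completion:
  fixes h c ci :: laurent
  assumes "c * ci = 1"
  shows "(1 - h) * (\<Sum>i<n. h ^ i) - (- (ci * h ^ n)) * c = 1"
proof -
  have "(1 - h) * (\<Sum>i<n. h ^ i) = 1 - h ^ n"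
    by (simp add: one_diff_power_eq)
  moreover have "ci * h ^ n * c = h ^ n"
    using assms by (metis mult.commute mult.left_commute mult.right_neutral)
  ultimately show ?thesis by simp
qed

text \<open>With A = (f, b; Z w, d) and B = (F, be; Zi w, e) of determinant 1, Q is the upper right
  entry of B^(-1) T_P A. The equation for F expresses the first column of B T_Q = T_P A; the
  conclusions are its second column.\<close>

lemma transition_identity:
  fixes Z Zi w P f d b F e be Q :: "'a::comm_ring_1"
  assumes Z: "Z * Zi = 1" and F: "F = f + w * P"
    and U: "f * d - b * (Z * w) = 1" and V: "F * e - be * (Zi * w) = 1"
    and Q: "Q = Z * e * b + e * P * d - Zi * be * d"
  shows "F * Q + be * Zi = Z * b + P * d" "(Zi * w) * Q + e * Zi = Zi * d"
proof -
  have "w * (b * (Z * Zi)) = w * b" by (simp add: Z)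
  then have Z': "Zi * (b * (Z * w)) = w * b" by (simp add: mult_ac)
  have Fe: "F * e = 1 + be * (Zi * w)" and fd: "f * d = 1 + b * (Z * w)"
    using U V by (simp_all add: algebra_simps)
  have Fd: "F * d = 1 + b * (Z * w) + w * P * d"
    unfolding F using fd by (simp add: algebra_simps)
  have "F * Q = (F * e) * (Z * b + P * d) - Zi * be * (F * d)"
    unfolding Q by (simp add: algebra_simps)
  also have "\<dots> = Z * b + P * d - Zi * be"
    unfolding Fe Fd by (simp add: algebra_simps)
  finally show "F * Q + be * Zi = Z * b + P * d" by (simp add: algebra_simps)
  \<comment> \<open>Both determinants are 1; inserted crosswise, they leave d e times F - f = w
    P.\<close>
  have "d - e = d * (F * e - be * (Zi * w)) - e * (f * d - b * (Z * w))"
    by (simp add: U V)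
  also have "\<dots> = w * (e * P * d) - d * be * (Zi * w) + e * (b * (Z * w))"
    unfolding F by (simp add: algebra_simps)
  finally have de: "d - e = w * (e * P * d) - d * be * (Zi * w) + e * (b * (Z * w))" .
  have "Zi * (d - e) =
      Zi * (w * (e * P * d)) - Zi * (d * be * (Zi * w)) + e * (Zi * (b * (Z * w)))"
    unfolding de by (simp add: algebra_simps)
  also have "\<dots> = Zi * w * (e * P * d - Zi * be * d) + e * (w * b)"
    unfolding Z' by (simp add: algebra_simps)
  also have "e * (w * b) = e * (Zi * (b * (Z * w)))" by (simp add: Z')
  also have "Zi * w * (e * P * d - Zi * be * d) + e * (Zi * (b * (Z * w))) = Zi * w * Q"
    unfolding Q by (simp add: algebra_simps)
  finally show "(Zi * w) * Q + e * Zi = Zi * d" by (simp add: algebra_simps)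
qed

text \<open>Replacing the line subbundle \<open>\<O>(-j)\<close> by the one spanned on \<open>U\<close> by \<open>(1 - h, \<gamma> z\<^sup>t u\<^sup>q)\<close>:
  \<open>h\<close> collects the monomials of \<open>\<gamma> z\<^bsup>t-j\<^esup> u\<^sup>q P\<close> that are divisible by \<open>z u\<close>, so a power of it is divisible
  by \<open>z\<^sup>t u\<^sup>q\<close> and a geometric sum completes the column to a matrix of determinant 1.\<close>

lemma subbundle_change:
  fixes P :: laurent and k j q t :: nat and \<gamma> :: complex
  assumes "k \<ge> 1" and P: "lkeys P \<subseteq> order_ge 1" and t: "t \<le> 2 * j + k * q" and "\<gamma> \<noteq> 0"
  obtains Q where "lkeys Q \<subseteq> order_ge 1"
    "bundle_iso k (laurent_transition j Q) (laurent_transition j P)"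
    "lkeys (Q - (P + P * signed (lmonom (int q, int t - int j) \<gamma> * P))) \<subseteq> order_ge (int q + 3)"
proof -
  define w where "w = lmonom (int q, int t - int j) \<gamma>"
  define Z where "Z = lmonom (0, int j) 1"
  define Zi where "Zi = lmonom (0, - int j) 1"
  define h where "h = lrestrict (\<lambda>a. snd a \<ge> 1) (w * P)"
  \<comment> \<open>The sign is chosen so that 1 - H = (1 - h) + w P, the upper left entry that the
    first column forces on V.\<close>
  define H where "H = - lrestrict (\<lambda>a. \<not> snd a \<ge> 1) (w * P)"
  \<comment> \<open>Large enough for three purposes: n \<ge> t clears the pole of \<open>ci\<close>
    in z, n \<ge> k q + 2 j that of \<open>Gi\<close> in \<zeta>, and n (q + 1) \<ge> 2 q + 3 pushes
    both upper right entries to order q + 3.\<close>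
  define n where "n = q + 2 * t + 2 * j + k * q + 3"
  \<comment> \<open>\<open>ci\<close> and \<open>Gi\<close> invert the lower left entries \<gamma>
    z^t u^q on U and \<gamma> z^(t - 2 j) u^q on V.\<close>
  define ci where "ci = lmonom (- int q, - int t) (1 / \<gamma>)"
  define Gi where "Gi = lmonom (- int q, 2 * int j - int t) (1 / \<gamma>)"
  define f where "f = 1 - h"
  define F where "F = 1 - H"
  define d where "d = (\<Sum>i<n. h ^ i)"
  define e where "e = (\<Sum>i<n. H ^ i)"
  define b where "b = - (ci * h ^ n)"
  define be where "be = - (Gi * H ^ n)"
  define Q where "Q = Z * e * b + e * P * d - Zi * be * d"
  have ZZi: "Z * Zi = 1" by (simp add: Z_def Zi_def mult_single flip: zero_prod_def)
  have c: "Z * w * ci = 1" and G: "Zi * w * Gi = 1"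
    using \<open>\<gamma> \<noteq> 0\<close> by (simp_all add: Z_def Zi_def w_def ci_def Gi_def mult_single flip: zero_prod_def)
  have "h - H = w * P"
    unfolding h_def H_def using lrestrict_split[of "\<lambda>a. snd a \<ge> 1" "w * P"] by simp
  then have F: "F = f + w * P" by (simp add: F_def f_def algebra_simps)
  have U: "f * d - b * (Z * w) = 1"
    unfolding f_def d_def b_def by (rule unipotent_completion[OF c])
  have V: "F * e - be * (Zi * w) = 1"
    unfolding F_def e_def be_def by (rule unipotent_completion[OF G])
  have w: "lkeys w \<subseteq> order_ge q" by (auto simp: w_def order_ge_def)
  have wP: "lkeys (w * P) \<subseteq> order_ge (int q + 1)" by (rule lkeys_mult_order[OF w P]) simp
  have h: "lkeys h \<subseteq> {(r, s). r \<ge> int q + 1 \<and> s \<ge> 1}"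
    using wP by (auto simp: h_def lkeys_lrestrict order_ge_def)
  have H: "lkeys H \<subseteq> {(r, s). r \<ge> int q + 1 \<and> int k * r - s \<ge> 1}"
  proof
    fix a assume "a \<in> lkeys H"
    then have "fst a \<ge> int q + 1" "snd a \<le> 0"
      using wP by (auto simp: H_def lkeys_uminus lkeys_lrestrict order_ge_def)
    moreover from this have "int k * fst a \<ge> 1 * 1" using \<open>k \<ge> 1\<close> by (intro mult_mono) auto
    ultimately show "a \<in> {(r, s). r \<ge> int q + 1 \<and> int k * r - s \<ge> 1}" by (cases a) auto
  qed
  have hO: "lkeys h \<subseteq> order_ge (int q + 1)" and HO: "lkeys H \<subseteq> order_ge (int q + 1)"
    using h H by (auto simp: order_ge_def)
  have pow_h: "lkeys (h ^ i) \<subseteq> Upos" for i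
  proof -
    have "int i * (int q + 1) \<ge> 0" by simp
    then have "{(r, s). r \<ge> int i * (int q + 1) \<and> s \<ge> int i * 1} \<subseteq> Upos"
      unfolding Upos_def by (clarify, intro conjI; linarith)
    then show ?thesis using lkeys_power[OF h, of i] by (rule order_trans[rotated])
  qed
  have pow_H: "lkeys (H ^ i) \<subseteq> Vpos k" for i
  proof -
    have "int i * (int q + 1) \<ge> 0" by simp
    then have "{(r, s). r \<ge> int i * (int q + 1) \<and> int k * r - s \<ge> int i * 1} \<subseteq> Vpos k"
      unfolding Vpos_def by (clarify, intro conjI; linarith)
    then show ?thesis using lkeys_power_V[OF H, of i] by (rule order_trans[rotated])
  qed
  have d: "lkeys d \<subseteq> Upos" unfolding d_def by (intro lkeys_sum pow_h)
  have e: "lkeys e \<subseteq> Vpos k" unfolding e_def by (intro lkeys_sum pow_H)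
  have one: "lkeys 1 \<subseteq> Upos" "lkeys 1 \<subseteq> Vpos k"
    by (auto simp: Upos_def Vpos_def zero_prod_def)
  have f: "lkeys f \<subseteq> Upos" unfolding f_def using pow_h[of 1] by (intro lkeys_diff one) simp
  have FV: "lkeys F \<subseteq> Vpos k" unfolding F_def using pow_H[of 1] by (intro lkeys_diff one) simp
  have nq: "int n * (int q + 1) \<ge> 2 * int q + 3"
  proof -
    have "3 * (int q + 1) \<le> int n * (int q + 1)" by (intro mult_right_mono) (simp_all add: n_def)
    then show ?thesis by simp
  qed
  have nt: "int n \<ge> int t" "int n \<ge> int k * int q + 2 * int j"
    unfolding n_def of_nat_le_iff by (simp_all del: of_nat_mult of_nat_add flip: of_nat_mult of_nat_add)
  have b: "lkeys b \<subseteq> Upos" "lkeys b \<subseteq> order_ge (int q + 3)"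
  proof -
    have "lkeys (ci * h ^ n) \<subseteq> {(r, s). r \<ge> int q + 3 \<and> s \<ge> 0}"
      using nq nt by (intro lkeys_mult[OF _ lkeys_power[OF h, of n], of _ "{(- int q, - int t)}"])
        (auto simp: ci_def)
    then show "lkeys b \<subseteq> Upos" "lkeys b \<subseteq> order_ge (int q + 3)"
      by (auto simp: b_def lkeys_uminus Upos_def order_ge_def)
  qed
  have be: "lkeys be \<subseteq> Vpos k" "lkeys be \<subseteq> order_ge (int q + 3)"
  proof -
    have "lkeys (Gi * H ^ n) \<subseteq> {(r, s). r \<ge> int q + 3 \<and> s \<le> int k * r}"
      using nq nt
      by (intro lkeys_mult[OF _ lkeys_power_V[OF H, of n], of _ "{(- int q, 2 * int j - int t)}"])
        (auto simp: Gi_def algebra_simps)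
    then show "lkeys be \<subseteq> Vpos k" "lkeys be \<subseteq> order_ge (int q + 3)"
      by (auto simp: be_def lkeys_uminus Vpos_def order_ge_def)
  qed
  have O0: "Upos \<subseteq> order_ge 0" "Vpos k \<subseteq> order_ge 0" "lkeys Z \<subseteq> order_ge 0" "lkeys Zi \<subseteq> order_ge 0"
    by (auto simp: Upos_def Vpos_def order_ge_def Z_def Zi_def)
  \<comment> \<open>Expansion to second order: the quadratic terms have order at least 2 q + 2,
    hence at least q + 3 after multiplication by P.\<close>
  have geom: "(\<Sum>i<n. x ^ i) = 1 + x + x * x * (\<Sum>i<n-2. x ^ i)" for x :: laurent
  proof -
    have n: "n = Suc (Suc (n - 2))" by (simp add: n_def)
    show ?thesis
      by (subst n) (simp add: sum.lessThan_Suc_shift sum_distrib_left algebra_simps del: sum.lessThan_Suc)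
  qed
  define d' where "d' = (\<Sum>i<n-2. h ^ i)"
  define e' where "e' = (\<Sum>i<n-2. H ^ i)"
  have d': "lkeys d' \<subseteq> order_ge 0" and dO: "lkeys d \<subseteq> order_ge 0"
    unfolding d'_def d_def using O0 pow_h by (meson lkeys_sum order_trans)+
  have e': "lkeys e' \<subseteq> order_ge 0" and eO: "lkeys e \<subseteq> order_ge 0"
    unfolding e'_def e_def using O0 pow_H by (meson lkeys_sum order_trans)+
  have s: "signed (w * P) = h + H" by (simp add: signed_def h_def H_def)
  have "Q - (P + P * signed (w * P)) =
      Z * e * b - Zi * be * d + P * (H * h + H * H * e' * d + h * h * d' * (1 + H))"
    unfolding s Q_def
    unfolding d_def e_def geom[of H] geom[of h] unfolding d'_def[symmetric] e'_def[symmetric]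
    by (simp add: algebra_simps)
  moreover have "lkeys (Z * e * b - Zi * be * d + P * (H * h + H * H * e' * d + h * h * d' * (1 + H)))
       \<subseteq> order_ge (int q + 3)"
  proof (intro lkeys_add lkeys_diff)
    show "lkeys (Z * e * b) \<subseteq> order_ge (int q + 3)"
      by (intro lkeys_mult_order[of _ 0 _ "int q + 3"] lkeys_mult_order[of _ 0 _ 0] O0 eO b) auto
    show "lkeys (Zi * be * d) \<subseteq> order_ge (int q + 3)"
      by (intro lkeys_mult_order[of _ "int q + 3" _ 0] lkeys_mult_order[of _ 0 _ "int q + 3"] O0 dO be) auto
    have H1: "lkeys (1 + H) \<subseteq> order_ge 0"
      using HO one O0 by (intro lkeys_add) (auto simp: order_ge_def zero_prod_def)
    have sq: "lkeys (H * h) \<subseteq> order_ge (2 * int q + 2)"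
      "lkeys (H * H) \<subseteq> order_ge (2 * int q + 2)" "lkeys (h * h) \<subseteq> order_ge (2 * int q + 2)"
      by (rule lkeys_mult_order[OF HO hO] lkeys_mult_order[OF HO HO] lkeys_mult_order[OF hO hO], simp)+
    have mono: "lkeys (f * g) \<subseteq> order_ge (2 * int q + 2)"
      if "lkeys f \<subseteq> order_ge (2 * int q + 2)" "lkeys g \<subseteq> order_ge 0" for f g
      by (rule lkeys_mult_order[OF that]) simp
    have "lkeys (H * h + H * H * e' * d + h * h * d' * (1 + H)) \<subseteq> order_ge (2 * int q + 2)"
      by (intro lkeys_add sq(1) mono[OF mono[OF sq(2) e'] dO] mono[OF mono[OF sq(3) d'] H1])
    then show "lkeys (P * (H * h + H * H * e' * d + h * h * d' * (1 + H))) \<subseteq> order_ge (int q + 3)"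
      by (rule lkeys_mult_order[OF P]) simp
  qed
  ultimately have 1: "lkeys (Q - (P + P * signed (w * P))) \<subseteq> order_ge (int q + 3)" by simp
  have Q1: "lkeys Q \<subseteq> order_ge 1"
  proof -
    have "lkeys (P + P * signed (w * P)) \<subseteq> order_ge 1"
      using wP by (intro lkeys_add P lkeys_mult_order[of _ 1 _ "int q + 1"]) (auto simp: lkeys_signed)
    moreover have "lkeys (Q - (P + P * signed (w * P))) \<subseteq> order_ge 1"
      using 1 order_ge_mono[of 1 "int q + 3"] by auto
    ultimately have "lkeys (Q - (P + P * signed (w * P)) + (P + P * signed (w * P))) \<subseteq> order_ge 1"
      by (rule lkeys_add[rotated])
    then show ?thesis by simp
  qed
  have cU: "lkeys (Z * w) \<subseteq> Upos"
    by (auto simp: Z_def w_def mult_single Upos_def)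
  \<comment> \<open>The exponent of \<zeta> in the lower left entry on V is k q + 2 j - t; the upper
    bound on t makes it nonnegative.\<close>
  have "int t \<le> int (2 * j + k * q)" using t by (simp only: of_nat_le_iff)
  then have GV: "lkeys (Zi * w) \<subseteq> Vpos k"
    by (auto simp: Zi_def w_def mult_single Vpos_def)
  have "bundle_iso k (laurent_transition j Q) (laurent_transition j P)"
  proof (rule bundle_iso_laurent[OF f b(1) cU d FV be(1) GV e])
    show "lkeys P \<subseteq> rpos" "lkeys Q \<subseteq> rpos" using P Q1 by (auto simp: rpos_def order_ge_def)
    show "f * d - b * (Z * w) = 1" "F * e - be * (Zi * w) = 1" by fact+
    show "F * lmonom (0, int j) 1 = lmonom (0, int j) 1 * f + P * (Z * w)"
      unfolding Z_def[symmetric] F by (simp add: algebra_simps)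
    show "Zi * w * lmonom (0, int j) 1 = lmonom (0, - int j) 1 * (Z * w)"
      unfolding Z_def[symmetric] Zi_def[symmetric] by (simp add: algebra_simps)
    show "F * Q + be * lmonom (0, - int j) 1 = lmonom (0, int j) 1 * b + P * d"
         "Zi * w * Q + e * lmonom (0, - int j) 1 = lmonom (0, - int j) 1 * d"
      using transition_identity[OF ZZi F U V Q_def] unfolding Z_def[symmetric] Zi_def[symmetric] .
  qed
  with 1 Q1 show ?thesis using that unfolding w_def by blast
qed

section \<open>Coefficient vectors as Laurent polynomials, and truncation to the window\<close>

lemma finite_coeff_index: "finite (coeff_index k j)"
  by (simp add: coeff_index_def)

definition laurent_of :: "nat \<Rightarrow> nat \<Rightarrow> (nat \<times> int \<Rightarrow> complex) \<Rightarrow> laurent"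
  where "laurent_of k j p = (\<Sum>(r, s)\<in>coeff_index k j. lmonom (int r, s) (p (r, s)))"

lemma transition_eq_laurent: "transition k j p = laurent_transition j (laurent_of k j p)"
proof -
  have "ext_poly k j p x = leval (monU x) (laurent_of k j p)" for x
    unfolding ext_poly_def laurent_of_def leval_sum case_prod_unfold leval_lmonom
    by (subst sum.Sigma)
       (simp_all add: coeff_index_def monU_def case_prod_unfold algebra_simps)
  then show ?thesis by (simp add: fun_eq_iff transition_def laurent_transition_def)
qed

lemma lcoeff_laurent_of:
  "lcoeff (laurent_of k j p) (int r, s) = (if (r, s) \<in> coeff_index k j then p (r, s) else 0)"
proof -
  have "lcoeff (laurent_of k j p) (int r, s) =
     (\<Sum>a\<in>coeff_index k j. if a = (r, s) then p (r, s) else 0)"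
    unfolding laurent_of_def lookup_sum
    by (intro sum.cong refl) (auto simp: lookup_single when_def split: if_splits)
  then show ?thesis by (simp add: sum.delta' finite_coeff_index)
qed

lemma lkeys_laurent_of: "lkeys (laurent_of k j p) \<subseteq> order_ge 1"
  unfolding laurent_of_def by (intro lkeys_sum) (auto simp: order_ge_def coeff_index_def split: if_splits)

text \<open>For r beyond the summation range, k r \<ge> 2 j - 1, so the two alternatives together
  exhaust the integers.\<close>

lemma outside_window:
  assumes "k \<ge> 1" "r \<ge> 1" "(r, s) \<notin> coeff_index k j"
  shows "s \<ge> int j \<or> s \<le> int k * int r - int j"
proof (cases "r \<le> (2 * j - 2) div k")
  case True
  then show ?thesis using assms by (auto simp: coeff_index_def)
next
  case False
  then have "2 * j - 2 < k * r" using assms(1)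
    by (simp add: not_le div_less_iff_less_mult mult.commute)
  then have "2 * int j - 1 \<le> int (k * r)" by linarith
  then show ?thesis by auto
qed

text \<open>Monomials outside the window split off as \<open>z\<^sup>j g\<^sub>1 + z\<^sup>-\<^sup>j g\<^sub>2\<close> with \<open>g\<^sub>1\<close> holomorphic on \<open>U\<close> and
  \<open>g\<^sub>2\<close> holomorphic on \<open>V\<close>.\<close>

lemma bundle_iso_truncate:
  assumes "k \<ge> 1" and Q: "lkeys Q \<subseteq> order_ge 1"
  shows "bundle_iso k (laurent_transition j Q) (transition k j (\<lambda>(r, s). lcoeff Q (int r, s)))"
proof -
  define P where "P = laurent_of k j (\<lambda>(r, s). lcoeff Q (int r, s))"
  define Z where "Z = lmonom (0, int j) 1"
  define Zi where "Zi = lmonom (0, - int j) 1"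
  define R where "R = Q - P"
  define R1 where "R1 = lrestrict (\<lambda>a. snd a \<ge> int j) R"
  define R2 where "R2 = lrestrict (\<lambda>a. \<not> snd a \<ge> int j) R"
  have ZZi: "Z * Zi = 1" by (simp add: Z_def Zi_def mult_single flip: zero_prod_def)
  have P1: "lkeys P \<subseteq> order_ge 1" unfolding P_def by (rule lkeys_laurent_of)
  have R: "fst a \<ge> 1 \<and> (snd a \<ge> int j \<or> snd a \<le> int k * fst a - int j)" if "a \<in> lkeys R" for a
  proof -
    obtain r s where a: "a = (r, s)" by (cases a)
    have "lkeys R \<subseteq> order_ge 1" unfolding R_def by (intro lkeys_diff Q P1)
    then have "r \<ge> 1" using that a by (auto simp: order_ge_def)
    then obtain m where m: "r = int m" "m \<ge> 1"
      by (cases r) auto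
    have "(m, s) \<notin> coeff_index k j"
    proof
      assume "(m, s) \<in> coeff_index k j"
      then have "lcoeff R a = 0" by (simp add: R_def P_def lookup_minus lcoeff_laurent_of a m)
      then show False using that by (simp add: in_keys_iff)
    qed
    with outside_window[OF assms(1) m(2)] show ?thesis using m \<open>r \<ge> 1\<close> by (auto simp: a)
  qed
  have R12: "R = R1 + R2" unfolding R1_def R2_def by (rule lrestrict_split[symmetric])
  have U: "lkeys (Zi * R1) \<subseteq> Upos"
  proof (rule lkeys_mult)
    show "lkeys Zi \<subseteq> {(0, - int j)}" by (simp add: Zi_def)
    show "lkeys R1 \<subseteq> {a. fst a \<ge> 1 \<and> snd a \<ge> int j}"
      using R by (auto simp: R1_def lkeys_lrestrict)
  qed (auto simp: Upos_def)
  have V: "lkeys (Z * R2) \<subseteq> Vpos k"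
  proof (rule lkeys_mult)
    show "lkeys Z \<subseteq> {(0, int j)}" by (simp add: Z_def)
    show "lkeys R2 \<subseteq> {a. fst a \<ge> 1 \<and> snd a \<le> int k * fst a - int j}"
      using R by (auto simp: R2_def lkeys_lrestrict)
  qed (auto simp: Vpos_def)
  have one: "lkeys 1 \<subseteq> Upos" "lkeys 1 \<subseteq> Vpos k"
    by (auto simp: Upos_def Vpos_def zero_prod_def)
  have R1: "Z * (Zi * R1) = R1" and R2: "Zi * (Z * R2) = R2"
    using ZZi by (simp_all only: mult.assoc[symmetric] mult.commute[of Zi Z] mult_1_left)
  have "bundle_iso k (laurent_transition j P) (laurent_transition j Q)"
  proof (rule bundle_iso_laurent[of 1 "- (Zi * R1)" 0 1 1 k "Z * R2" 0 1])
    show "lkeys Q \<subseteq> rpos" "lkeys P \<subseteq> rpos" using P1 Q by (auto simp: rpos_def order_ge_def)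
    have "Q = P + R1 + R2" using R12 by (simp add: R_def algebra_simps)
    then show "1 * P + Z * R2 * lmonom (0, - int j) 1 = lmonom (0, int j) 1 * - (Zi * R1) + Q * 1"
      unfolding Z_def[symmetric] Zi_def[symmetric] using R1 R2 by (simp add: algebra_simps)
  qed (use one U V in \<open>simp_all add: lkeys_uminus\<close>)
  then have "bundle_iso k (laurent_transition j Q) (laurent_transition j P)" by (rule bundle_iso_sym)
  then show ?thesis by (simp add: transition_eq_laurent P_def)
qed

section \<open>Moves within an isomorphism class\<close>

definition window :: "nat \<Rightarrow> nat \<Rightarrow> nat \<Rightarrow> int set"
  where "window k j r = {int k * int r - int j + 1..int j - 1}"

text \<open>The coefficient of z^s in x(z) times the sign twist of z^(t-j) x(z), where x(z) is the
  first order part: the effect on a coefficient of order r of a move with parameter t. It is the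
  same quadratic form for every r.\<close>

definition shift_form :: "nat \<Rightarrow> nat \<Rightarrow> int \<Rightarrow> int \<Rightarrow> (int \<Rightarrow> complex) \<Rightarrow> complex"
  where "shift_form k j t s x =
    (\<Sum>a\<in>window k j 1. \<Sum>b\<in>window k j 1.
       if a + b + t - int j = s then pm_sign (b + t - int j) * x a * x b else 0)"

lemma coeff_index_iff:
  "(r, s) \<in> coeff_index k j \<longleftrightarrow> 1 \<le> r \<and> r \<le> (2 * j - 2) div k \<and> s \<in> window k j r"
  by (auto simp: coeff_index_def window_def)

text \<open>The correction \<open>P * signed (w * P)\<close> starts at order q + 2 = r, so lower
  orders are untouched, and its part of order r is quadratic in the first order part of p. Cutting
  the result back to the window keeps the coefficients concerned.\<close>

lemma bundle_move:
  fixes p :: "nat \<times> int \<Rightarrow> complex" and t :: int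
  assumes "k \<ge> 1" "r \<ge> 2" "0 \<le> t" "t \<le> 2 * int j + int k * (int r - 2)"
  obtains p' where "bundle_iso k (transition k j p) (transition k j p')"
    "\<And>m s. m < r \<Longrightarrow> (m, s) \<in> coeff_index k j \<Longrightarrow> p' (m, s) = p (m, s)"
    "\<And>s. (r, s) \<in> coeff_index k j \<Longrightarrow> p' (r, s) = p (r, s) + \<gamma> * shift_form k j t s (\<lambda>i. p (1, i))"
proof (cases "\<gamma> = 0")
  case True
  then show ?thesis using that[of p] bundle_iso_refl by simp
next
  case False
  define q where "q = r - 2"
  define P where "P = laurent_of k j p"
  define w where "w = lmonom (int q, t - int j) \<gamma>"
  have r: "r = q + 2" using assms by (simp add: q_def)
  have "int (nat t) \<le> int (2 * j + k * q)" using assms r by simp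
  then have t: "nat t \<le> 2 * j + k * q" by (simp only: of_nat_le_iff)
  have P: "lkeys P \<subseteq> order_ge 1" unfolding P_def by (rule lkeys_laurent_of)
  obtain Q where Q: "lkeys Q \<subseteq> order_ge 1"
    "bundle_iso k (laurent_transition j Q) (laurent_transition j P)"
    "lkeys (Q - (P + P * signed (w * P))) \<subseteq> order_ge (int q + 3)"
    using subbundle_change[OF assms(1) P t False] assms(3) unfolding w_def by auto
  have Qc: "lcoeff Q (int m, s) = lcoeff P (int m, s) + lcoeff (P * signed (w * P)) (int m, s)"
    if "m \<le> r" for m s
    using lcoeff_order[OF Q(3), of "int m" s] that r by (simp add: lookup_minus lookup_add)
  have wP: "lkeys (w * P) \<subseteq> order_ge (int q + 1)"
    by (rule lkeys_mult_order[OF _ P, of _ "int q"]) (auto simp: w_def order_ge_def)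
  have low: "lcoeff (P * signed (w * P)) (int m, s) = 0" if "m < r" for m s
  proof (rule lcoeff_order)
    show "lkeys (P * signed (w * P)) \<subseteq> order_ge (int q + 2)"
      using wP by (intro lkeys_mult_order[OF P, of _ "int q + 1"]) (auto simp: lkeys_signed)
    show "int m < int q + 2" using that r by simp
  qed
  define P1 where "P1 = (\<Sum>a\<in>window k j 1. lmonom (1, a) (p (1, a)))"
  have P1: "lkeys P1 \<subseteq> order_ge 1" unfolding P1_def by (intro lkeys_sum) (auto simp: order_ge_def)
  have top: "lcoeff (P * signed (w * P)) (int r, s) = \<gamma> * shift_form k j t s (\<lambda>i. p (1, i))"
    if rs: "(r, s) \<in> coeff_index k j" for s
  proof -
    have N: "1 \<le> (2 * j - 2) div k" using rs r by (simp add: coeff_index_iff)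
    have P1c: "lcoeff P1 (1, b) = (if b \<in> window k j 1 then p (1, b) else 0)" for b
    proof -
      have "finite (window k j 1)" by (simp add: window_def)
      then show ?thesis unfolding P1_def lookup_sum
        by (simp add: lookup_single when_def sum.delta)
    qed
    have PP: "lkeys (P - P1) \<subseteq> order_ge 2"
    proof
      fix a assume a: "a \<in> lkeys (P - P1)"
      obtain m b where mb: "a = (m, b)" by (cases a)
      have "lkeys (P - P1) \<subseteq> order_ge 1" by (intro lkeys_diff P P1)
      then have m: "m \<ge> 1" using a mb by (auto simp: order_ge_def)
      have "m \<noteq> 1"
      proof
        assume "m = 1"
        then have "lcoeff (P - P1) a = 0"
          using lcoeff_laurent_of[of k j p 1 b] N
          by (simp add: mb lookup_minus P1c P_def coeff_index_iff)
        then show False using a by (simp add: in_keys_iff)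
      qed
      then show "a \<in> order_ge 2" using m by (simp add: mb order_ge_def)
    qed
    have w: "lkeys w \<subseteq> order_ge (int q)" by (auto simp: w_def order_ge_def)
    \<comment> \<open>Replacing P by its first order part in either factor costs one order, which is
      invisible at order r.\<close>
    have "P * signed (w * P) - P1 * signed (w * P1) =
        (P - P1) * signed (w * P) + P1 * signed (w * (P - P1))"
    proof -
      have "signed (w * P) = signed (w * P1) + signed (w * (P - P1))"
        by (simp add: algebra_simps flip: signed_add)
      then show ?thesis by (simp add: algebra_simps)
    qed
    moreover have "lkeys ((P - P1) * signed (w * P) + P1 * signed (w * (P - P1))) \<subseteq> order_ge (int q + 3)"
    proof (intro lkeys_add)
      show "lkeys ((P - P1) * signed (w * P)) \<subseteq> order_ge (int q + 3)"
        using wP by (intro lkeys_mult_order[OF PP, of _ "int q + 1"]) (auto simp: lkeys_signed)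
      show "lkeys (P1 * signed (w * (P - P1))) \<subseteq> order_ge (int q + 3)"
        using lkeys_mult_order[OF w PP, of "int q + 2"]
        by (intro lkeys_mult_order[OF P1, of _ "int q + 2"]) (auto simp: lkeys_signed)
    qed
    ultimately have "lcoeff (P * signed (w * P) - P1 * signed (w * P1)) (int r, s) = 0"
      using lcoeff_order[of _ "int q + 3" "int r" s] r by simp
    then have "lcoeff (P * signed (w * P)) (int r, s) = lcoeff (P1 * signed (w * P1)) (int r, s)"
      by (simp add: lookup_minus)
    also have "signed (w * P1) =
       (\<Sum>b\<in>window k j 1. lmonom (int q + 1, b + t - int j) (pm_sign (b + t - int j) * (\<gamma> * p (1, b))))"
      unfolding P1_def w_def sum_distrib_left signed_sum
      by (simp add: mult_single signed_lmonom algebra_simps)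
    also have "P1 * \<dots> = (\<Sum>a\<in>window k j 1. \<Sum>b\<in>window k j 1.
        lmonom (int r, a + b + t - int j) (p (1, a) * (pm_sign (b + t - int j) * (\<gamma> * p (1, b)))))"
      unfolding P1_def sum_product by (simp add: mult_single r algebra_simps)
    also have "lcoeff \<dots> (int r, s) = \<gamma> * shift_form k j t s (\<lambda>i. p (1, i))"
      unfolding lookup_sum shift_form_def sum_distrib_left
      by (intro sum.cong refl) (auto simp: lookup_single when_def mult_ac)
    finally show ?thesis .
  qed
  let ?p' = "\<lambda>(r, s). lcoeff Q (int r, s)"
  show ?thesis
  proof (rule that[of ?p'])
    have "bundle_iso k (transition k j p) (laurent_transition j Q)"
      using bundle_iso_sym[OF Q(2)] by (simp add: transition_eq_laurent P_def)
    then show "bundle_iso k (transition k j p) (transition k j ?p')"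
      using bundle_iso_truncate[OF assms(1) Q(1)] bundle_iso_trans by blast
    show "?p' (m, s) = p (m, s)" if "m < r" "(m, s) \<in> coeff_index k j" for m s
      using that low[of m s] by (simp add: Qc P_def lcoeff_laurent_of)
    show "?p' (r, s) = p (r, s) + \<gamma> * shift_form k j t s (\<lambda>i. p (1, i))"
      if "(r, s) \<in> coeff_index k j" for s
      using that top[of s] by (simp add: Qc P_def lcoeff_laurent_of)
  qed
qed

text \<open>Coefficients are killed order by order, from below. Moves of order r \<ge> 2 do not
  touch the first order part, so a succession of them acts on order r linearly, with one fixed
  matrix of \<open>shift_form\<close> values. Their effect on higher orders is harmless because
  those are treated later.\<close>

lemma bundle_iso_leading_part:
  fixes p :: "nat \<times> int \<Rightarrow> complex"
  assumes "k \<ge> 1"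
    and t: "\<And>r d. 2 \<le> r \<Longrightarrow> r \<le> (2 * j - 2) div k \<Longrightarrow> d \<in> window k j r \<Longrightarrow>
              0 \<le> \<tau> d \<and> \<tau> d \<le> 2 * int j + int k * (int r - 2)"
    and solve: "\<And>r y. 2 \<le> r \<Longrightarrow> r \<le> (2 * j - 2) div k \<Longrightarrow>
       \<exists>g. \<forall>s\<in>window k j r. (\<Sum>d\<in>window k j r. shift_form k j (\<tau> d) s (\<lambda>i. p (1, i)) * g d) = y s"
  shows "bundle_iso k (transition k j p) (transition k j (\<lambda>(r, s). if r = 1 then p (r, s) else 0))"
proof -
  let ?N = "(2 * j - 2) div k"
  let ?x = "\<lambda>i. p (1, i)"
  have sf: "shift_form k j t s x = shift_form k j t s y" if "\<And>i. i \<in> window k j 1 \<Longrightarrow> x i = y i" for t s x y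
    unfolding shift_form_def using that by (intro sum.cong refl) auto
  have moves: "\<exists>p''. bundle_iso k (transition k j p') (transition k j p'') \<and>
      (\<forall>m s. m < r \<longrightarrow> (m, s) \<in> coeff_index k j \<longrightarrow> p'' (m, s) = p' (m, s)) \<and>
      (\<forall>s\<in>window k j r. p'' (r, s) = p' (r, s) + (\<Sum>d\<in>D. shift_form k j (\<tau> d) s ?x * g d))"
    if r: "2 \<le> r" "r \<le> ?N" and "finite D" "D \<subseteq> window k j r"
      and p': "\<And>s. s \<in> window k j 1 \<Longrightarrow> p' (1, s) = p (1, s)" for p' r D g
    using that(3,4)
  proof (induction D)
    case empty
    then show ?case using bundle_iso_refl by auto
  next
    case (insert d D)
    then obtain p'' where p'': "bundle_iso k (transition k j p') (transition k j p'')"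
       "\<And>m s. m < r \<Longrightarrow> (m, s) \<in> coeff_index k j \<Longrightarrow> p'' (m, s) = p' (m, s)"
       "\<And>s. s \<in> window k j r \<Longrightarrow>
          p'' (r, s) = p' (r, s) + (\<Sum>d\<in>D. shift_form k j (\<tau> d) s ?x * g d)"
      by auto
    obtain q where q: "bundle_iso k (transition k j p'') (transition k j q)"
      "\<And>m s. m < r \<Longrightarrow> (m, s) \<in> coeff_index k j \<Longrightarrow> q (m, s) = p'' (m, s)"
      "\<And>s. (r, s) \<in> coeff_index k j \<Longrightarrow>
         q (r, s) = p'' (r, s) + g d * shift_form k j (\<tau> d) s (\<lambda>i. p'' (1, i))"
      using bundle_move[OF assms(1) r(1), of "\<tau> d" j p'' "g d"] t[OF r, of d] insert.prems by auto
    have "shift_form k j (\<tau> d) s (\<lambda>i. p'' (1, i)) = shift_form k j (\<tau> d) s ?x" for s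
      using r p''(2)[of 1] p' by (intro sf) (auto simp: coeff_index_iff)
    then have "q (r, s) = p' (r, s) + (\<Sum>d\<in>insert d D. shift_form k j (\<tau> d) s ?x * g d)"
      if "s \<in> window k j r" for s
      using q(3)[of s] p''(3)[of s] that r insert.hyps by (simp add: coeff_index_iff)
    moreover have "bundle_iso k (transition k j p') (transition k j q)"
      using p''(1) q(1) by (rule bundle_iso_trans)
    ultimately show ?case using q(2) p''(2) by (intro exI[of _ q]) auto
  qed
  have "\<exists>q. bundle_iso k (transition k j p) (transition k j q) \<and>
      (\<forall>s\<in>window k j 1. q (1, s) = p (1, s)) \<and>
      (\<forall>m s. 2 \<le> m \<longrightarrow> m \<le> n \<longrightarrow> (m, s) \<in> coeff_index k j \<longrightarrow> q (m, s) = 0)" if "n \<le> ?N" for n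
    using that
  proof (induction n)
    case 0
    then show ?case using bundle_iso_refl by (intro exI[of _ p]) auto
  next
    case (Suc n)
    then obtain q where q: "bundle_iso k (transition k j p) (transition k j q)"
      "\<And>s. s \<in> window k j 1 \<Longrightarrow> q (1, s) = p (1, s)"
      "\<And>m s. 2 \<le> m \<Longrightarrow> m \<le> n \<Longrightarrow> (m, s) \<in> coeff_index k j \<Longrightarrow> q (m, s) = 0" by auto
    show ?case
    proof (cases "n = 0")
      case True
      then show ?thesis using q by (intro exI[of _ q]) auto
    next
      case False
      then have r: "2 \<le> Suc n" by simp
      obtain g where g: "\<And>s. s \<in> window k j (Suc n) \<Longrightarrow>
         (\<Sum>d\<in>window k j (Suc n). shift_form k j (\<tau> d) s ?x * g d) = - q (Suc n, s)"
        using solve[OF r Suc.prems, of "\<lambda>s. - q (Suc n, s)"] by blast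
      have "finite (window k j (Suc n))" by (simp add: window_def)
      from moves[OF r Suc.prems this order_refl q(2), of g]
      obtain q' where q': "bundle_iso k (transition k j q) (transition k j q')"
        "\<And>m s. m < Suc n \<Longrightarrow> (m, s) \<in> coeff_index k j \<Longrightarrow> q' (m, s) = q (m, s)"
        "\<And>s. s \<in> window k j (Suc n) \<Longrightarrow> q' (Suc n, s) = 0"
        using g by auto
      show ?thesis
      proof (intro exI[of _ q'] conjI ballI allI impI)
        show "bundle_iso k (transition k j p) (transition k j q')"
          using q(1) q'(1) by (rule bundle_iso_trans)
        show "q' (1, s) = p (1, s)" if "s \<in> window k j 1" for s
          using that q(2) q'(2)[of 1 s] Suc.prems False by (auto simp: coeff_index_iff)
        show "q' (m, s) = 0" if "2 \<le> m" "m \<le> Suc n" "(m, s) \<in> coeff_index k j" for m s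
        proof (cases "m = Suc n")
          case True
          then show ?thesis using q'(3) that by (auto simp: coeff_index_iff)
        next
          case False
          then show ?thesis using q'(2)[of m s] q(3)[of m s] that by auto
        qed
      qed
    qed
  qed
  from this[of ?N] obtain q where q: "bundle_iso k (transition k j p) (transition k j q)"
      "\<And>s. s \<in> window k j 1 \<Longrightarrow> q (1, s) = p (1, s)"
      "\<And>m s. 2 \<le> m \<Longrightarrow> m \<le> ?N \<Longrightarrow> (m, s) \<in> coeff_index k j \<Longrightarrow> q (m, s) = 0" by auto
  have "laurent_of k j q = laurent_of k j (\<lambda>(r, s). if r = 1 then p (r, s) else 0)"
    unfolding laurent_of_def using q(2,3)
    by (intro sum.cong refl) (auto simp: coeff_index_iff)
  then show ?thesis using q(1) by (simp add: transition_eq_laurent)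
qed

section \<open>First order part as an invariant\<close>

lemma holomorphic2_on_slice:
  assumes "holomorphic2_on f UNIV"
  shows "(\<lambda>z. f (z, u)) holomorphic_on UNIV" "(\<lambda>u. f (z, u)) holomorphic_on UNIV"
proof -
  have 1: "\<exists>D. ((\<lambda>z. f (z, u)) has_field_derivative D) (at z)" for z
  proof -
    obtain a b where "(f has_derivative (\<lambda>h. a * fst h + b * snd h)) (at (z, u))"
      using assms unfolding holomorphic2_on_def by blast
    from has_derivative_compose[OF has_derivative_Pair[OF has_derivative_ident has_derivative_const] this]
    have "((\<lambda>z. f (z, u)) has_derivative (\<lambda>h. a * h)) (at z)" by simp
    then show ?thesis by (auto simp: has_field_derivative_def)
  qed
  have 2: "\<exists>D. ((\<lambda>u. f (z, u)) has_field_derivative D) (at u)" for u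
  proof -
    obtain a b where "(f has_derivative (\<lambda>h. a * fst h + b * snd h)) (at (z, u))"
      using assms unfolding holomorphic2_on_def by blast
    from has_derivative_compose[OF has_derivative_Pair[OF has_derivative_const has_derivative_ident] this]
    have "((\<lambda>u. f (z, u)) has_derivative (\<lambda>h. b * h)) (at u)" by simp
    then show ?thesis by (auto simp: has_field_derivative_def)
  qed
  show "(\<lambda>z. f (z, u)) holomorphic_on UNIV" "(\<lambda>u. f (z, u)) holomorphic_on UNIV"
    using 1 2 by (auto simp: holomorphic_on_open)
qed

lemma holomorphic2_on_continuous:
  assumes "holomorphic2_on f UNIV" shows "continuous_on S f"
  using assms unfolding holomorphic2_on_def
  by (meson UNIV_I continuous_at_imp_continuous_on has_derivative_continuous)

text \<open>Cauchy's inequality on discs of radius 1/2 bounds the second derivative by 2 M / (1/2)^2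
  = 8 M. The constant depends on g only through M, so the estimate is uniform in a
  parameter.\<close>

lemma difference_quotient_bound:
  assumes g: "g holomorphic_on UNIV" and M: "\<And>w. norm w \<le> 1 \<Longrightarrow> norm (g w) \<le> M"
    and h: "norm h \<le> 1 / 2" "h \<noteq> 0"
  shows "norm ((g h - g 0) / h - deriv g 0) \<le> 8 * M * norm h"
proof -
  have D: "((deriv ^^ i) g has_field_derivative (deriv ^^ Suc i) g x) (at x within cball 0 (1/2))" for i x
    using has_field_derivative_at_within[OF
        holomorphic_derivI[OF holomorphic_higher_deriv[OF g open_UNIV] open_UNIV UNIV_I, of i x]]
    by simp
  have B: "norm ((deriv ^^ Suc 1) g x) \<le> 8 * M" if "x \<in> cball 0 (1/2)" for x
  proof -
    have "norm ((deriv ^^ 2) g x) \<le> fact 2 * M / (1/2) ^ 2"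
    proof (rule Cauchy_inequality)
      show "g holomorphic_on ball x (1/2)" using g by (rule holomorphic_on_subset) simp
      show "continuous_on (cball x (1/2)) g"
        using g by (meson holomorphic_on_imp_continuous_on continuous_on_subset subset_UNIV)
      show "norm (g y) \<le> M" if "norm (x - y) = 1/2" for y
      proof (rule M)
        have "norm y \<le> norm x + norm (x - y)" by norm
        then show "norm y \<le> 1" using that \<open>x \<in> cball 0 (1/2)\<close> by simp
      qed
    qed simp
    then show ?thesis by (simp add: numeral_2_eq_2 power2_eq_square)
  qed
  have "norm ((deriv ^^ 0) g h - (\<Sum>i\<le>1. (deriv ^^ i) g 0 * (h - 0) ^ i / fact i))
      \<le> 8 * M * norm (h - 0) ^ Suc 1 / fact 1"
    by (rule complex_Taylor[of "cball 0 (1/2)"]) (use D B h in auto)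
  then have "norm (g h - g 0 - deriv g 0 * h) \<le> 8 * M * norm h * norm h"
    by (simp add: algebra_simps)
  moreover have "(g h - g 0) / h - deriv g 0 = (g h - g 0 - deriv g 0 * h) / h"
    using h by (simp add: field_simps)
  ultimately show ?thesis using h by (simp add: norm_divide divide_simps)
qed

text \<open>The derivative is a locally uniform limit of difference quotients, each holomorphic in
  z. Uniformity comes from a bound of f on a compact polydisc.\<close>

lemma holomorphic_deriv_snd:
  assumes f: "holomorphic2_on f UNIV"
  shows "(\<lambda>z. deriv (\<lambda>u. f (z, u)) 0) holomorphic_on UNIV"
proof (rule holomorphic_uniform_sequence[OF open_UNIV])
  \<comment> \<open>The shift by 2 keeps the increments within the radius 1/2 of
    \<open>difference_quotient_bound\<close>.\<close>
  define e where "e n = complex_of_real (1 / real (n + 2))" for n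
  show "(\<lambda>z. (f (z, e n) - f (z, 0)) / e n) holomorphic_on UNIV" for n
    using holomorphic2_on_slice(1)[OF f] by (intro holomorphic_intros) (simp_all add: e_def)
  fix x :: complex
  have "compact (cball x 1 \<times> cball (0::complex) 1)" by (intro compact_Times compact_cball)
  then have "bounded (f ` (cball x 1 \<times> cball 0 1))"
    by (intro compact_imp_bounded compact_continuous_image holomorphic2_on_continuous[OF f])
  then obtain M where M: "\<And>z w. z \<in> cball x 1 \<Longrightarrow> norm w \<le> 1 \<Longrightarrow> norm (f (z, w)) \<le> M"
    unfolding bounded_iff by fastforce
  have M0: "M \<ge> 0" using M[of x 0] order_trans[OF norm_ge_zero] by simp
  have "uniform_limit (cball x 1) (\<lambda>n z. (f (z, e n) - f (z, 0)) / e n)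
          (\<lambda>z. deriv (\<lambda>u. f (z, u)) 0) sequentially"
  proof (rule uniform_limitI)
    fix \<epsilon> :: real assume "\<epsilon> > 0"
    have "(\<lambda>n. 8 * M * (1 / real (n + 2))) \<longlonglongrightarrow> 8 * M * 0"
      by (intro tendsto_mult tendsto_const LIMSEQ_ignore_initial_segment lim_1_over_n)
    then have "\<forall>\<^sub>F n in sequentially. 8 * M * (1 / real (n + 2)) < \<epsilon>"
      using \<open>\<epsilon> > 0\<close> order_tendstoD(2) by fastforce
    then show "\<forall>\<^sub>F n in sequentially. \<forall>z\<in>cball x 1.
        dist ((f (z, e n) - f (z, 0)) / e n) (deriv (\<lambda>u. f (z, u)) 0) < \<epsilon>"
    proof eventually_elim
      case (elim n)
      show ?case
      proof
        fix z assume "z \<in> cball x 1"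
        have "norm (e n) = 1 / real (n + 2)" unfolding e_def by (simp only: norm_of_real) simp
        moreover have "norm ((f (z, e n) - f (z, 0)) / e n - deriv (\<lambda>u. f (z, u)) 0) \<le> 8 * M * norm (e n)"
          using M[OF \<open>z \<in> cball x 1\<close>] calculation
          by (intro difference_quotient_bound holomorphic2_on_slice(2)[OF f]) (auto simp: e_def)
        ultimately show "dist ((f (z, e n) - f (z, 0)) / e n) (deriv (\<lambda>u. f (z, u)) 0) < \<epsilon>"
          using elim by (simp add: dist_norm)
      qed
    qed
  qed
  then show "\<exists>d>0. cball x d \<subseteq> UNIV \<and> uniform_limit (cball x d)
      (\<lambda>n z. (f (z, e n) - f (z, 0)) / e n) (\<lambda>z. deriv (\<lambda>u. f (z, u)) 0) sequentially"
    by (intro exI[of _ 1]) auto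
qed

section \<open>Functions on the two charts of the projective line\<close>

lemma tendsto_inverse_at_infinity:
  assumes "h holomorphic_on UNIV"
  shows "((\<lambda>z. h (inverse z)) \<longlongrightarrow> h (0::complex)) at_infinity"
proof -
  have "isCont h 0"
    using assms by (metis UNIV_I continuous_on_eq_continuous_at holomorphic_on_imp_continuous_on open_UNIV)
  then show ?thesis
    using isCont_tendsto_compose[of 0 h inverse at_infinity] tendsto_inverse_0 by blast
qed

lemma eventually_nonzero_at_infinity: "\<forall>\<^sub>F z::complex in at_infinity. z \<noteq> 0"
  by (auto simp: eventually_at_infinity intro!: exI[of _ 1])

text \<open>A global holomorphic function on the projective line is constant, here with its value
  read off at infinity.\<close>

lemma entire_eq_at_infinity:
  assumes "E holomorphic_on UNIV" "h holomorphic_on UNIV"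
    and "\<And>z. z \<noteq> 0 \<Longrightarrow> E z = h (inverse z)"
  shows "E z = h 0"
proof (rule Liouville_weak[OF assms(1)])
  have "\<forall>\<^sub>F z in at_infinity. h (inverse z) = E z"
    using eventually_nonzero_at_infinity by eventually_elim (simp add: assms(3))
  then show "(E \<longlongrightarrow> h 0) at_infinity"
    using tendsto_inverse_at_infinity[OF assms(2)] by (rule Lim_transform_eventually[rotated])
qed

text \<open>The classes of \<open>1, z, \<dots>, z\<^bsup>m-1\<^esup>\<close> are linearly independent in the first cohomology of
  \<open>\<O>(-m-1)\<close> on the projective line.\<close>

lemma laurent_splitting_zero:
  assumes g: "g holomorphic_on UNIV" and h: "h holomorphic_on UNIV"
    and eq: "\<And>z. z \<noteq> 0 \<Longrightarrow> (\<Sum>i<m. c i * z ^ i) = z ^ m * g z - inverse z * h (inverse z)"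
    and "i < m"
  shows "c i = (0::complex)"
proof -
  let ?Q = "\<lambda>z. \<Sum>i<m. c i * z ^ i"
  \<comment> \<open>In the coordinate w = 1/z this function is w h(w), so its value at infinity is
    0.\<close>
  have "z ^ m * g z - ?Q z = 0 * h 0" for z
    by (rule entire_eq_at_infinity[of "\<lambda>z. z ^ m * g z - ?Q z" "\<lambda>w. w * h w"])
       (use g h eq in \<open>auto intro!: holomorphic_intros\<close>)
  then have Q: "?Q z = z ^ m * g z" for z by simp
  \<comment> \<open>The polynomial has degree below m, so dividing by z^m leaves a polynomial in 1/z
    without constant term; hence g vanishes as well.\<close>
  have "g z = (\<Sum>i<m. c i * 0 ^ (m - i))" for z
  proof (rule entire_eq_at_infinity[of g "\<lambda>w. \<Sum>i<m. c i * w ^ (m - i)", OF g])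
    show "g z = (\<Sum>i<m. c i * inverse z ^ (m - i))" if "z \<noteq> 0" for z
    proof -
      have "g z = ?Q z / z ^ m" using Q[of z] that by simp
      also have "\<dots> = (\<Sum>i<m. c i * inverse z ^ (m - i))"
        unfolding sum_divide_distrib using that
        by (intro sum.cong refl) (simp add: power_diff field_simps)
      finally show ?thesis .
    qed
  qed (intro holomorphic_intros)
  moreover have "(\<Sum>i<m. c i * 0 ^ (m - i)) = 0" by (intro sum.neutral) auto
  ultimately have g0: "g z = 0" for z by simp
  have "(\<Sum>i\<le>m-1. c i * z ^ i) = 0" for z
    using Q[of z] g0 \<open>i < m\<close> lessThan_Suc_atMost[of "m - 1"] by simp
  then show ?thesis using polyfun_eq_0[of c "m - 1"] \<open>i < m\<close> by auto
qed

section \<open>Comparison of the first order parts of isomorphic bundles\<close>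

lemma has_field_derivative_ext_poly:
  assumes "1 \<le> (2 * j - 2) div k"
  shows "((\<lambda>u. ext_poly k j p (z, u)) has_field_derivative
      (\<Sum>s\<in>window k j 1. p (1, s) * z powi s)) (at 0)"
proof -
  let ?c = "\<lambda>r. \<Sum>s\<in>window k j r. p (r, s) * z powi s"
  have 1: "((\<lambda>u. \<Sum>r = 1..(2 * j - 2) div k. ?c r * u ^ r) has_field_derivative
      (\<Sum>r = 1..(2 * j - 2) div k. ?c r * (of_nat r * 0 ^ (r - Suc 0)))) (at 0)"
    by (auto intro!: derivative_eq_intros DERIV_sum simp: mult_ac)
  have "(\<Sum>r = 1..(2 * j - 2) div k. ?c r * (of_nat r * 0 ^ (r - Suc 0))) =
      (\<Sum>r = 1..(2 * j - 2) div k. if r = 1 then ?c 1 else 0)"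
    by (rule sum.cong[OF refl]) (simp add: power_0_left)
  also have "\<dots> = ?c 1" using assms by (subst sum.delta) auto
  finally have 2: "(\<Sum>r = 1..(2 * j - 2) div k. ?c r * (of_nat r * 0 ^ (r - Suc 0))) = ?c 1" .
  have 3: "(\<Sum>r = 1..(2 * j - 2) div k. ?c r * u ^ r) = ext_poly k j p (z, u)" for u
    by (simp add: ext_poly_def window_def sum_distrib_right)
  show ?thesis using 1 unfolding 2 3 .
qed

lemma ext_poly_zero_section: "ext_poly k j p (z, 0) = 0"
  unfolding ext_poly_def by (intro sum.neutral ballI) simp

text \<open>On the zero section the diagonal entries of A are constants a0, d0 by Liouville and its
  upper right entry vanishes, so both constants are nonzero. Differentiating the upper right entry
  of B T = T' A in u at u = 0 gives a0 P - d0 P' = z^j g(z) - z^(k-j) h(1/z) for the first order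
  parts P, P'. Multiplied by z^(j-k-1), the left side is a polynomial of degree below 2 j - k - 1 to
  which \<open>laurent_splitting_zero\<close> applies.\<close>

lemma bundle_iso_leading:
  assumes "k \<ge> 1" "j \<ge> k" "1 \<le> (2 * j - 2) div k"
    and "bundle_iso k (transition k j p) (transition k j p')"
  obtains c where "c \<noteq> 0" "\<And>s. s \<in> window k j 1 \<Longrightarrow> p' (1, s) = c * p (1, s)"
proof -
  have j: "j \<ge> 1" using assms by simp
  obtain A B where A: "holomorphic_GL2_on A UNIV" and B: "holomorphic_GL2_on B UNIV"
    and eq: "\<And>x. x \<in> overlap \<Longrightarrow> B (to_V k x) ** transition k j p x = transition k j p' x ** A x"
    using assms(4) unfolding bundle_iso_def by blast
  define Ae where "Ae i l x = A x $ i $ l" for i l x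
  define Be where "Be i l x = B x $ i $ l" for i l x
  have A2: "holomorphic2_on (Ae i l) UNIV" and B2: "holomorphic2_on (Be i l) UNIV" for i l
    using A B by (simp_all add: holomorphic_GL2_on_def Ae_def[abs_def] Be_def[abs_def])
  let ?p = "\<lambda>z u. ext_poly k j p (z, u)" and ?p' = "\<lambda>z u. ext_poly k j p' (z, u)"
  have e: "Be 1 1 (inverse z, z ^ k * u) * z ^ j = z ^ j * Ae 1 1 (z, u) + ?p' z u * Ae 2 1 (z, u)"
    "Be 1 1 (inverse z, z ^ k * u) * ?p z u + Be 1 2 (inverse z, z ^ k * u) * inverse z ^ j =
       z ^ j * Ae 1 2 (z, u) + ?p' z u * Ae 2 2 (z, u)"
    "Be 2 1 (inverse z, z ^ k * u) * ?p z u + Be 2 2 (inverse z, z ^ k * u) * inverse z ^ j =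
       inverse z ^ j * Ae 2 2 (z, u)" if "z \<noteq> 0" for z u
  proof -
    have m: "B (to_V k (z, u)) ** transition k j p (z, u) = transition k j p' (z, u) ** A (z, u)"
      by (rule eq) (use that in \<open>simp add: overlap_def\<close>)
    show "Be 1 1 (inverse z, z ^ k * u) * z ^ j = z ^ j * Ae 1 1 (z, u) + ?p' z u * Ae 2 1 (z, u)"
      using arg_cong[OF m, of "\<lambda>M :: complex^2^2. M $ 1 $ 1"]
      by (simp add: matrix_matrix_mult_def sum_2 transition_def to_V_def Ae_def Be_def)
    show "Be 1 1 (inverse z, z ^ k * u) * ?p z u + Be 1 2 (inverse z, z ^ k * u) * inverse z ^ j =
       z ^ j * Ae 1 2 (z, u) + ?p' z u * Ae 2 2 (z, u)"
      using arg_cong[OF m, of "\<lambda>M :: complex^2^2. M $ 1 $ 2"]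
      by (simp add: matrix_matrix_mult_def sum_2 transition_def to_V_def Ae_def Be_def)
    show "Be 2 1 (inverse z, z ^ k * u) * ?p z u + Be 2 2 (inverse z, z ^ k * u) * inverse z ^ j =
       inverse z ^ j * Ae 2 2 (z, u)"
      using arg_cong[OF m, of "\<lambda>M :: complex^2^2. M $ 2 $ 2"]
      by (simp add: matrix_matrix_mult_def sum_2 transition_def to_V_def Ae_def Be_def)
  qed
  define a0 where "a0 = Be 1 1 (0, 0)"
  define d0 where "d0 = Be 2 2 (0, 0)"
  have a0: "Ae 1 1 (z, 0) = a0" for z
    unfolding a0_def
    by (rule entire_eq_at_infinity[of "\<lambda>z. Ae 1 1 (z, 0)" "\<lambda>w. Be 1 1 (w, 0)"])
       (use e(1)[of _ 0] in \<open>auto simp: ext_poly_zero_section intro!: holomorphic2_on_slice A2 B2\<close>)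
  have d0: "Ae 2 2 (z, 0) = d0" for z
    unfolding d0_def
    by (rule entire_eq_at_infinity[of "\<lambda>z. Ae 2 2 (z, 0)" "\<lambda>w. Be 2 2 (w, 0)"])
       (use e(3)[of _ 0] in \<open>auto simp: ext_poly_zero_section intro!: holomorphic2_on_slice A2 B2\<close>)
  \<comment> \<open>The value at infinity carries the factor \<open>0 ^ (2 * j)\<close>, so for j
    \<ge> 1 this entry is 0 and the determinant on the zero section is a0 d0.\<close>
  have b0: "Ae 1 2 (z, 0) = 0 ^ (2 * j) * Be 1 2 (0, 0)" for z
  proof (rule entire_eq_at_infinity[of "\<lambda>z. Ae 1 2 (z, 0)" "\<lambda>w. w ^ (2 * j) * Be 1 2 (w, 0)"])
    show "Ae 1 2 (z, 0) = inverse z ^ (2 * j) * Be 1 2 (inverse z, 0)" if "z \<noteq> 0" for z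
      using e(2)[of z 0] that
      by (simp add: ext_poly_zero_section field_simps power_mult power2_eq_square power_mult_distrib)
  qed (intro holomorphic_intros holomorphic2_on_slice A2 B2)+
  have "det (A (0, 0)) \<noteq> 0" using A by (simp add: holomorphic_GL2_on_def invertible_det_nz)
  then have nz: "a0 \<noteq> 0" "d0 \<noteq> 0" using j by (auto simp: det_2 a0 d0 b0 Ae_def[symmetric])
  have B0: "Be 1 1 (inverse z, 0) = a0" if "z \<noteq> 0" for z
    using e(1)[of z 0] that by (simp add: ext_poly_zero_section a0)
  define P where "P z = (\<Sum>s\<in>window k j 1. p (1, s) * z powi s)" for z
  define P' where "P' z = (\<Sum>s\<in>window k j 1. p' (1, s) * z powi s)" for z
  define g where "g z = deriv (\<lambda>u. Ae 1 2 (z, u)) 0" for z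
  define h where "h z = deriv (\<lambda>u. Be 1 2 (z, u)) 0" for z
  have g: "g holomorphic_on UNIV" and h: "h holomorphic_on UNIV"
    unfolding g_def h_def by (intro holomorphic_deriv_snd A2 B2)+
  have D: "a0 * P z + h (inverse z) * z ^ k * inverse z ^ j = z ^ j * g z + P' z * d0" if z: "z \<noteq> 0" for z
  proof -
    have dA: "((\<lambda>u. Ae i l (z, u)) has_field_derivative deriv (\<lambda>u. Ae i l (z, u)) 0) (at 0)" for i l
      by (rule holomorphic_derivI[OF holomorphic2_on_slice(2)[OF A2] open_UNIV]) simp
    have "((\<lambda>u. Be i l (inverse z, u)) has_field_derivative deriv (\<lambda>u. Be i l (inverse z, u)) 0)
        (at (z ^ k * 0))" for i l
      using holomorphic_derivI[OF holomorphic2_on_slice(2)[OF B2[of i l], of "inverse z"] open_UNIV, of 0] by simp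
    then have dB: "((\<lambda>u. Be i l (inverse z, z ^ k * u)) has_field_derivative
        deriv (\<lambda>u. Be i l (inverse z, u)) 0 * z ^ k) (at 0)" for i l
      by (rule DERIV_chain2[of "\<lambda>u. Be i l (inverse z, u)"]) (auto intro!: derivative_eq_intros)
    note dp = has_field_derivative_ext_poly[OF assms(3), of p z]
    note dp' = has_field_derivative_ext_poly[OF assms(3), of p' z]
    have 1: "((\<lambda>u. Be 1 1 (inverse z, z ^ k * u) * ?p z u +
        Be 1 2 (inverse z, z ^ k * u) * inverse z ^ j) has_field_derivative
        (a0 * P z + h (inverse z) * z ^ k * inverse z ^ j)) (at 0)"
      using DERIV_add[OF DERIV_mult[OF dB[of 1 1] dp] DERIV_cmult_right[OF dB[of 1 2], of "inverse z ^ j"]] z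
      by (simp add: ext_poly_zero_section B0 P_def h_def mult_ac)
    have 2: "((\<lambda>u. z ^ j * Ae 1 2 (z, u) + ?p' z u * Ae 2 2 (z, u)) has_field_derivative
        (z ^ j * g z + P' z * d0)) (at 0)"
      using DERIV_add[OF DERIV_cmult[OF dA[of 1 2], of "z ^ j"] DERIV_mult[OF dp' dA[of 2 2]]]
      by (simp add: ext_poly_zero_section d0 P'_def g_def mult_ac)
    show ?thesis using DERIV_unique[OF 1 2[folded e(2)[OF z]]] .
  qed
  \<comment> \<open>The number of first order coefficients; i + (k - j + 1) enumerates their
    exponents from the lowest.\<close>
  define m where "m = 2 * j - k - 1"
  define c where "c i = a0 * p (1, int i + (int k - int j + 1)) - d0 * p' (1, int i + (int k - int j + 1))" for i
  have j2: "2 * j \<ge> k + 2"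
  proof -
    have "k * 1 \<le> k * ((2 * j - 2) div k)" using assms(3) by (rule mult_left_mono) simp
    also have "\<dots> \<le> 2 * j - 2" by simp
    finally show ?thesis using j by simp
  qed
  have c0: "c i = 0" if "i < m" for i
  proof (rule laurent_splitting_zero[OF g h _ that])
    fix z :: complex assume z: "z \<noteq> 0"
    have "(\<Sum>s\<in>window k j 1. (a0 * p (1, s) - d0 * p' (1, s)) * z powi s) =
        (\<Sum>i<m. c i * z powi (int i + (int k - int j + 1)))"
      unfolding c_def using j2
      by (intro sum.reindex_bij_witness[of _ "\<lambda>i. int i + (int k - int j + 1)" "\<lambda>s. nat (s - (int k - int j + 1))"])
         (auto simp: window_def m_def)
    then have "a0 * P z - d0 * P' z = (\<Sum>i<m. c i * z powi (int i + (int k - int j + 1)))"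
      by (simp add: P_def P'_def algebra_simps sum_subtractf sum_distrib_left)
    also have "\<dots> = z powi (int k - int j + 1) * (\<Sum>i<m. c i * z ^ i)"
      using z by (simp add: power_int_add sum_distrib_left mult_ac)
    finally have "z powi (int k - int j + 1) * (\<Sum>i<m. c i * z ^ i) = z ^ j * g z - h (inverse z) * z ^ k * inverse z ^ j"
      using D[OF z] by (simp add: algebra_simps)
    then have "(\<Sum>i<m. c i * z ^ i) =
        z powi (int j - int k - 1) * (z ^ j * g z - h (inverse z) * z ^ k * inverse z ^ j)"
    proof -
      have "z powi (int j - int k - 1) * z powi (int k - int j + 1) = 1"
        using z by (simp flip: power_int_add)
      then show ?thesis
        by (metis (no_types, lifting) mult.assoc mult_1
          \<open>z powi (int k - int j + 1) * (\<Sum>i<m. c i * z ^ i) = z ^ j * g z - h (inverse z) * z ^ k * inverse z ^ j\<close>)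
    qed
    also have "\<dots> = z powi (int j - int k - 1) * z ^ j * g z
        - z powi (int j - int k - 1) * (z ^ k * inverse z ^ j) * h (inverse z)"
      by (simp add: algebra_simps)
    also have "z powi (int j - int k - 1) * z ^ j = z powi (int j - int k - 1 + int j)"
      using power_int_add[of z "int j - int k - 1" "int j"] z by simp
    also have "int j - int k - 1 + int j = int m" using j2 by (simp add: m_def)
    also have "z powi (int j - int k - 1) * (z ^ k * inverse z ^ j) = inverse z"
      using z power_int_add[of z 1 "int k"] by (simp add: power_int_diff field_simps)
    finally show "(\<Sum>i<m. c i * z ^ i) = z ^ m * g z - inverse z * h (inverse z)" by simp
  qed
  show ?thesis
  proof (rule that[of "a0 / d0"])
    show "a0 / d0 \<noteq> 0" using nz by simp
    fix s assume "s \<in> window k j 1"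
    then have "nat (s - (int k - int j + 1)) < m" "int (nat (s - (int k - int j + 1))) + (int k - int j + 1) = s"
      using j2 by (auto simp: window_def m_def)
    with c0[of "nat (s - (int k - int j + 1))"] have "a0 * p (1, s) = d0 * p' (1, s)"
      by (simp add: c_def)
    then show "p' (1, s) = a0 / d0 * p (1, s)" using nz by (simp add: field_simps)
  qed
qed

section \<open>Forms and projective subvarieties\<close>

definition monom_eval :: "nat \<Rightarrow> (nat \<Rightarrow> nat) \<Rightarrow> (nat \<Rightarrow> complex) \<Rightarrow> complex"
  where "monom_eval n e x = (\<Prod>i\<le>n. x i ^ e i)"

definition expo :: "nat \<Rightarrow> nat \<Rightarrow> (nat \<Rightarrow> nat) set"
  where "expo n d = {e. (\<forall>i>n. e i = 0) \<and> (\<Sum>i\<le>n. e i) = d}"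

text \<open>For K the cone over a subvariety this is membership in the span of the monomials of E
  modulo the ideal of K. The homogeneous coordinate ring enters the proof only in this way.\<close>

definition span_on ::
    "(nat \<Rightarrow> complex) set \<Rightarrow> nat \<Rightarrow> (nat \<Rightarrow> nat) set \<Rightarrow> ((nat \<Rightarrow> complex) \<Rightarrow> complex) \<Rightarrow> bool"
  where "span_on K n E f \<longleftrightarrow> (\<exists>a. \<forall>x\<in>K. f x = (\<Sum>e\<in>E. a e * monom_eval n e x))"

lemma expo_le: "e \<in> expo n d \<Longrightarrow> e i \<le> d"
proof (cases "i \<le> n")
  case True
  assume "e \<in> expo n d"
  then show ?thesis using member_le_sum[of i "{..n}" e] True by (simp add: expo_def)
qed (simp add: expo_def)

lemma finite_expo: "finite (expo n d)"
proof (rule finite_subset)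
  show "expo n d \<subseteq> {e. \<forall>i. (i \<in> {..n} \<longrightarrow> e i \<in> {..d}) \<and> (i \<notin> {..n} \<longrightarrow> e i = 0)}"
    using expo_le by (auto simp: expo_def)
  show "finite {e. \<forall>i. (i \<in> {..n} \<longrightarrow> e i \<in> {..d}) \<and> (i \<notin> {..n} \<longrightarrow> e i = (0::nat))}"
    by (intro finite_set_of_finite_funs) auto
qed

lemma monom_eval_add: "monom_eval n (\<lambda>i. e i + f i) x = monom_eval n e x * monom_eval n f x"
  by (simp add: monom_eval_def power_add prod.distrib)

lemma expo_add: "e \<in> expo n d \<Longrightarrow> f \<in> expo n d' \<Longrightarrow> (\<lambda>i. e i + f i) \<in> expo n (d + d')"
  by (auto simp: expo_def sum.distrib)

lemma span_on_monomial:
  assumes "finite E" "e \<in> E"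
  shows "span_on K n E (monom_eval n e)"
  unfolding span_on_def
proof (intro exI ballI)
  fix x
  have "(\<Sum>e'\<in>E. (if e' = e then 1 else 0) * monom_eval n e' x) = (\<Sum>e'\<in>E. if e' = e then monom_eval n e x else 0)"
    by (intro sum.cong) auto
  then show "monom_eval n e x = (\<Sum>e'\<in>E. (if e' = e then 1 else 0) * monom_eval n e' x)"
    using assms by simp
qed

lemma span_on_zero: "span_on K n E (\<lambda>x. 0)"
  unfolding span_on_def by (intro exI[of _ "\<lambda>_. 0"]) simp

lemma span_on_add:
  assumes "span_on K n E f" "span_on K n E g"
  shows "span_on K n E (\<lambda>x. f x + g x)"
proof -
  obtain a b where "\<forall>x\<in>K. f x = (\<Sum>e\<in>E. a e * monom_eval n e x)" "\<forall>x\<in>K. g x = (\<Sum>e\<in>E. b e * monom_eval n e x)"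
    using assms unfolding span_on_def by blast
  then show ?thesis unfolding span_on_def
    by (intro exI[of _ "\<lambda>e. a e + b e"]) (simp add: algebra_simps sum.distrib)
qed

lemma span_on_scale:
  assumes "span_on K n E f" shows "span_on K n E (\<lambda>x. c * f x)"
proof -
  obtain a where "\<forall>x\<in>K. f x = (\<Sum>e\<in>E. a e * monom_eval n e x)"
    using assms unfolding span_on_def by blast
  then show ?thesis unfolding span_on_def
    by (intro exI[of _ "\<lambda>e. c * a e"]) (simp add: sum_distrib_left mult_ac)
qed

lemma span_on_diff:
  assumes "span_on K n E f" "span_on K n E g"
  shows "span_on K n E (\<lambda>x. f x - g x)"
  using span_on_add[OF assms(1) span_on_scale[OF assms(2), of "-1"]] by simp

lemma span_on_sum:
  assumes "\<And>i. i \<in> I \<Longrightarrow> span_on K n E (f i)"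
  shows "span_on K n E (\<lambda>x. \<Sum>i\<in>I. f i x)"
  using assms
  by (induction I rule: infinite_finite_induct) (simp_all add: span_on_zero span_on_add)

lemma span_on_cong:
  assumes "span_on K n E f" "\<And>x. x \<in> K \<Longrightarrow> g x = f x"
  shows "span_on K n E g"
  using assms unfolding span_on_def by simp

lemma span_on_trans:
  assumes "span_on K n E f" "\<And>e. e \<in> E \<Longrightarrow> span_on K n E' (monom_eval n e)"
  shows "span_on K n E' f"
proof -
  obtain a where a: "\<forall>x\<in>K. f x = (\<Sum>e\<in>E. a e * monom_eval n e x)"
    using assms unfolding span_on_def by blast
  have "span_on K n E' (\<lambda>x. \<Sum>e\<in>E. a e * monom_eval n e x)"
    by (intro span_on_sum span_on_scale assms(2))
  then show ?thesis by (rule span_on_cong) (use a in simp)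
qed

lemma span_on_subset: "span_on K n E f \<Longrightarrow> K' \<subseteq> K \<Longrightarrow> span_on K' n E f"
  unfolding span_on_def by blast

lemma span_on_mono:
  assumes "span_on K n E f" "E \<subseteq> E'" "finite E'"
  shows "span_on K n E' f"
  using span_on_trans[OF assms(1)] span_on_monomial[OF assms(3)] assms(2) by blast

lemma span_on_mult:
  assumes "span_on K n E f" "span_on K n E' g" "finite G"
    and "\<And>e e'. e \<in> E \<Longrightarrow> e' \<in> E' \<Longrightarrow> (\<lambda>i. e i + e' i) \<in> G"
  shows "span_on K n G (\<lambda>x. f x * g x)"
proof -
  obtain a b where a: "\<forall>x\<in>K. f x = (\<Sum>e\<in>E. a e * monom_eval n e x)"
    and b: "\<forall>x\<in>K. g x = (\<Sum>e\<in>E'. b e * monom_eval n e x)"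
    using assms unfolding span_on_def by blast
  have "span_on K n G (\<lambda>x. \<Sum>e\<in>E. \<Sum>e'\<in>E'. (a e * b e') * monom_eval n (\<lambda>i. e i + e' i) x)"
    by (intro span_on_sum span_on_scale span_on_monomial assms)
  then show ?thesis
    by (rule span_on_cong) (use a b in \<open>simp add: sum_product monom_eval_add mult_ac\<close>)
qed

definition form :: "nat \<Rightarrow> nat \<Rightarrow> ((nat \<Rightarrow> complex) \<Rightarrow> complex) \<Rightarrow> bool"
  where "form n d f \<longleftrightarrow> span_on UNIV n (expo n d) f"

lemma form_mult: "form n d f \<Longrightarrow> form n d' g \<Longrightarrow> form n (d + d') (\<lambda>x. f x * g x)"
  unfolding form_def by (rule span_on_mult) (auto simp: finite_expo expo_add)

lemma form_sum: "(\<And>i. i \<in> I \<Longrightarrow> form n d (f i)) \<Longrightarrow> form n d (\<lambda>x. \<Sum>i\<in>I. f i x)"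
  unfolding form_def by (rule span_on_sum)

lemma form_scale: "form n d f \<Longrightarrow> form n d (\<lambda>x. c * f x)"
  unfolding form_def by (rule span_on_scale)

lemma form_diff: "form n d f \<Longrightarrow> form n d g \<Longrightarrow> form n d (\<lambda>x. f x - g x)"
  unfolding form_def by (rule span_on_diff)

lemma form_add: "form n d f \<Longrightarrow> form n d g \<Longrightarrow> form n d (\<lambda>x. f x + g x)"
  unfolding form_def by (rule span_on_add)

lemma form_one: "form n 0 (\<lambda>x. 1)"
proof -
  have "(\<lambda>_. 0) \<in> expo n 0" by (simp add: expo_def)
  then have "span_on UNIV n (expo n 0) (monom_eval n (\<lambda>_. 0))" by (intro span_on_monomial finite_expo)
  then show ?thesis by (simp add: form_def monom_eval_def[abs_def])
qed

lemma form_power: "form n d f \<Longrightarrow> form n (m * d) (\<lambda>x. f x ^ m)"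
  by (induction m) (simp_all add: form_one form_mult)

lemma form_prod:
  "(\<And>i. i \<in> I \<Longrightarrow> form n (d i) (f i)) \<Longrightarrow> form n (\<Sum>i\<in>I. d i) (\<lambda>x. \<Prod>i\<in>I. f i x)"
  by (induction I rule: infinite_finite_induct) (simp_all add: form_one form_mult)

definition unit_expo :: "nat \<Rightarrow> nat \<Rightarrow> nat \<Rightarrow> nat"
  where "unit_expo s m i = (if i = s then m else 0)"

lemma unit_expo_in_expo: "s \<le> n \<Longrightarrow> unit_expo s m \<in> expo n m"
  by (auto simp: expo_def unit_expo_def)

lemma monom_eval_unit_expo: "s \<le> n \<Longrightarrow> monom_eval n (unit_expo s m) x = x s ^ m"
proof -
  assume "s \<le> n"
  have "monom_eval n (unit_expo s m) x = (\<Prod>i\<le>n. if i = s then x s ^ m else 1)"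
    unfolding monom_eval_def unit_expo_def by (intro prod.cong) auto
  then show ?thesis using \<open>s \<le> n\<close> by simp
qed

lemma form_coordinate: "s \<le> n \<Longrightarrow> form n 1 (\<lambda>x. x s)"
proof -
  assume s: "s \<le> n"
  have "span_on UNIV n (expo n 1) (monom_eval n (unit_expo s 1))"
    by (intro span_on_monomial finite_expo unit_expo_in_expo s)
  then show ?thesis unfolding form_def by (rule span_on_cong) (simp add: monom_eval_unit_expo s)
qed

lemma form_restrict_scale:
  assumes "form n d f"
  shows "f (\<lambda>i\<in>{..n}. c * x i) = c ^ d * f x"
proof -
  obtain a where a: "\<And>x. f x = (\<Sum>e\<in>expo n d. a e * monom_eval n e x)"
    using assms unfolding form_def span_on_def by blast
  have "monom_eval n e (\<lambda>i\<in>{..n}. c * x i) = c ^ d * monom_eval n e x" if "e \<in> expo n d" for e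
    using that by (simp add: monom_eval_def power_mult_distrib prod.distrib expo_def flip: power_sum)
  then show ?thesis unfolding a sum_distrib_left by (intro sum.cong) (auto simp: mult_ac)
qed

lemma homogeneous_poly_form:
  assumes "homogeneous_poly n f"
  shows "\<exists>d. form n d (mpoly_eval f)"
proof -
  obtain d where d: "\<And>m. m \<in> Poly_Mapping.keys f \<Longrightarrow> Poly_Mapping.keys m \<subseteq> {..n} \<and>
       (\<Sum>i\<in>Poly_Mapping.keys m. Poly_Mapping.lookup m i) = d"
    using assms unfolding homogeneous_poly_def by blast
  have m: "Poly_Mapping.lookup m \<in> expo n d"
      "(\<Prod>i\<in>Poly_Mapping.keys m. x i ^ Poly_Mapping.lookup m i) = monom_eval n (Poly_Mapping.lookup m) x"
    if "m \<in> Poly_Mapping.keys f" for m x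
  proof -
    have "(\<Sum>i\<le>n. Poly_Mapping.lookup m i) = (\<Sum>i\<in>Poly_Mapping.keys m. Poly_Mapping.lookup m i)"
      using d[OF that] by (intro sum.mono_neutral_right) (auto simp: in_keys_iff)
    then show "Poly_Mapping.lookup m \<in> expo n d"
      using d[OF that] by (fastforce simp: expo_def in_keys_iff)
    show "(\<Prod>i\<in>Poly_Mapping.keys m. x i ^ Poly_Mapping.lookup m i) = monom_eval n (Poly_Mapping.lookup m) x"
      unfolding monom_eval_def using d[OF that] by (intro prod.mono_neutral_left) (auto simp: in_keys_iff)
  qed
  have "span_on UNIV n (expo n d) (\<lambda>x. \<Sum>m\<in>Poly_Mapping.keys f.
      Poly_Mapping.lookup f m * monom_eval n (Poly_Mapping.lookup m) x)"
    by (intro span_on_sum span_on_scale span_on_monomial finite_expo m)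
  then have "form n d (mpoly_eval f)"
    unfolding form_def by (rule span_on_cong) (simp add: mpoly_eval_def m)
  then show ?thesis by blast
qed

lemma form_homogeneous_poly:
  assumes "form n d g"
  obtains f where "homogeneous_poly n f" "mpoly_eval f = g"
proof -
  obtain a where a: "\<And>x. g x = (\<Sum>e\<in>expo n d. a e * monom_eval n e x)"
    using assms unfolding form_def span_on_def by blast
  define M where "M = {m :: nat \<Rightarrow>\<^sub>0 nat. Poly_Mapping.lookup m \<in> expo n d}"
  have inj: "inj_on Poly_Mapping.lookup M"
    by (auto intro!: inj_onI poly_mapping_eqI)
  have "Poly_Mapping.lookup ` M = expo n d"
  proof
    show "expo n d \<subseteq> Poly_Mapping.lookup ` M"
    proof
      fix e assume e: "e \<in> expo n d"
      have "{i. e i \<noteq> 0} \<subseteq> {..n}" using e by (auto simp: expo_def not_less[symmetric])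
      then have "finite {i. e i \<noteq> 0}" by (rule finite_subset) simp
      then have "Poly_Mapping.lookup (Abs_poly_mapping e) = e" by simp
      then show "e \<in> Poly_Mapping.lookup ` M" using e unfolding M_def by (metis image_eqI mem_Collect_eq)
    qed
  qed (auto simp: M_def)
  note im = this
  have fM: "finite M" using finite_expo[of n d] im inj finite_imageD by metis
  define f where "f = Abs_poly_mapping (\<lambda>m. if m \<in> M then a (Poly_Mapping.lookup m) else 0)"
  have "finite {m. (if m \<in> M then a (Poly_Mapping.lookup m) else 0) \<noteq> 0}"
    by (rule finite_subset[OF _ fM]) auto
  then have f: "Poly_Mapping.lookup f m = (if m \<in> M then a (Poly_Mapping.lookup m) else 0)" for m
    by (simp add: f_def)
  have kf: "Poly_Mapping.keys f \<subseteq> M" by (auto simp: in_keys_iff f split: if_splits)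
  have km: "Poly_Mapping.keys m \<subseteq> {..n}" if "m \<in> M" for m
    using that by (auto simp: M_def expo_def in_keys_iff not_less[symmetric])
  show ?thesis
  proof (rule that)
    show "homogeneous_poly n f" unfolding homogeneous_poly_def
    proof (intro exI ballI conjI)
      fix m assume "m \<in> Poly_Mapping.keys f"
      then have m: "m \<in> M" using kf by blast
      show "Poly_Mapping.keys m \<subseteq> {..n}" by (rule km[OF m])
      then have "(\<Sum>i\<in>Poly_Mapping.keys m. Poly_Mapping.lookup m i) = (\<Sum>i\<le>n. Poly_Mapping.lookup m i)"
        by (intro sum.mono_neutral_left) (auto simp: in_keys_iff)
      then show "(\<Sum>i\<in>Poly_Mapping.keys m. Poly_Mapping.lookup m i) = d"
        using m by (simp add: M_def expo_def)
    qed
    show "mpoly_eval f = g"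
    proof
      fix x
      have "mpoly_eval f x = (\<Sum>m\<in>M. Poly_Mapping.lookup f m *
          (\<Prod>i\<in>Poly_Mapping.keys m. x i ^ Poly_Mapping.lookup m i))"
        unfolding mpoly_eval_def using kf fM
        by (intro sum.mono_neutral_left) (auto simp: in_keys_iff)
      also have "\<dots> = (\<Sum>m\<in>M. a (Poly_Mapping.lookup m) * monom_eval n (Poly_Mapping.lookup m) x)"
      proof (rule sum.cong[OF refl])
        fix m assume m: "m \<in> M"
        have "(\<Prod>i\<in>Poly_Mapping.keys m. x i ^ Poly_Mapping.lookup m i) = monom_eval n (Poly_Mapping.lookup m) x"
          unfolding monom_eval_def using km[OF m] by (intro prod.mono_neutral_left) (auto simp: in_keys_iff)
        then show "Poly_Mapping.lookup f m * (\<Prod>i\<in>Poly_Mapping.keys m. x i ^ Poly_Mapping.lookup m i) =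
          a (Poly_Mapping.lookup m) * monom_eval n (Poly_Mapping.lookup m) x" using m by (simp add: f)
      qed
      also have "\<dots> = g x" unfolding a im[symmetric] by (simp add: sum.reindex[OF inj])
      finally show "mpoly_eval f x = g x" .
    qed
  qed
qed

section \<open>Affine cones over projective subvarieties\<close>

definition pts :: "nat \<Rightarrow> (nat \<Rightarrow> complex) set"
  where "pts n = {x \<in> extensional {..n}. \<exists>i\<le>n. x i \<noteq> 0}"

lemma topspace_punctured: "topspace (punctured_space n) = pts n"
  by (auto simp: punctured_space_def pts_def PiE_UNIV_domain PiE_def)

lemma line_through_eq_iff:
  assumes "x \<in> pts n" "y \<in> pts n"
  shows "line_through n x = line_through n y \<longleftrightarrow> (\<exists>c. c \<noteq> 0 \<and> y = (\<lambda>i\<in>{..n}. c * x i))"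
proof
  assume "line_through n x = line_through n y"
  moreover have "y = (\<lambda>i\<in>{..n}. 1 * y i)"
    using assms by (auto simp: pts_def extensional_def)
  then have "y \<in> line_through n y" unfolding line_through_def by (auto intro: exI[of _ 1])
  ultimately have "y \<in> line_through n x" by simp
  then show "\<exists>c. c \<noteq> 0 \<and> y = (\<lambda>i\<in>{..n}. c * x i)" unfolding line_through_def by auto
next
  assume "\<exists>c. c \<noteq> 0 \<and> y = (\<lambda>i\<in>{..n}. c * x i)"
  then obtain c where c: "c \<noteq> 0" "y = (\<lambda>i\<in>{..n}. c * x i)" by blast
  show "line_through n x = line_through n y" unfolding line_through_def
  proof (intro equalityI subsetI; clarify)
    fix b :: complex assume "b \<noteq> 0"
    then show "\<exists>d. (\<lambda>i\<in>{..n}. b * x i) = (\<lambda>i\<in>{..n}. d * y i) \<and> d \<noteq> 0"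
      using c by (intro exI[of _ "b / c"]) (auto simp: restrict_def)
    show "\<exists>d. (\<lambda>i\<in>{..n}. b * y i) = (\<lambda>i\<in>{..n}. d * x i) \<and> d \<noteq> 0"
      using c \<open>b \<noteq> 0\<close> by (intro exI[of _ "b * c"]) (auto simp: restrict_def)
  qed
qed

definition zero_locus :: "nat \<Rightarrow> ((nat \<Rightarrow> complex) \<Rightarrow> complex) set \<Rightarrow> (nat \<Rightarrow> complex) set set"
  where "zero_locus n F = line_through n ` {x \<in> pts n. \<forall>f\<in>F. f x = 0}"

text \<open>The affine cone without its vertex; forms are evaluated here, since they have no values
  on lines.\<close>

definition cone :: "nat \<Rightarrow> (nat \<Rightarrow> complex) set set \<Rightarrow> (nat \<Rightarrow> complex) set"
  where "cone n X = {x \<in> pts n. line_through n x \<in> X}"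

definition forms :: "nat \<Rightarrow> ((nat \<Rightarrow> complex) \<Rightarrow> complex) set"
  where "forms n = {f. \<exists>d. form n d f}"

lemma cone_zero_locus:
  assumes "F \<subseteq> forms n"
  shows "cone n (zero_locus n F) = {x \<in> pts n. \<forall>f\<in>F. f x = 0}"
proof
  show "cone n (zero_locus n F) \<subseteq> {x \<in> pts n. \<forall>f\<in>F. f x = 0}"
  proof
    fix x assume "x \<in> cone n (zero_locus n F)"
    then obtain y where x: "x \<in> pts n" and y: "y \<in> pts n" "\<forall>f\<in>F. f y = 0"
      and "line_through n y = line_through n x"
      unfolding cone_def zero_locus_def by auto
    then obtain c where "x = (\<lambda>i\<in>{..n}. c * y i)" using line_through_eq_iff by blast
    moreover have "f (\<lambda>i\<in>{..n}. c * y i) = 0" if "f \<in> F" for f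
    proof -
      have "f \<in> forms n" using \<open>f \<in> F\<close> assms by blast
      then obtain d where "form n d f" unfolding forms_def by blast
      from form_restrict_scale[OF this, of c y] show ?thesis using y that by simp
    qed
    ultimately show "x \<in> {x \<in> pts n. \<forall>f\<in>F. f x = 0}" using x by simp
  qed
qed (auto simp: cone_def zero_locus_def)

lemma closed_subvariety_iff:
  "closed_subvariety n X \<longleftrightarrow> (\<exists>F\<subseteq>forms n. X = zero_locus n F)"
proof
  assume "closed_subvariety n X"
  then obtain F where F: "\<forall>f\<in>F. homogeneous_poly n f"
    "X = line_through n ` {x \<in> pts n. \<forall>f\<in>F. mpoly_eval f x = 0}"
    unfolding closed_subvariety_def topspace_punctured by blast
  then have "mpoly_eval ` F \<subseteq> forms n" using homogeneous_poly_form by (auto simp: forms_def)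
  moreover have "X = zero_locus n (mpoly_eval ` F)" unfolding F zero_locus_def by simp
  ultimately show "\<exists>F\<subseteq>forms n. X = zero_locus n F" by blast
next
  assume "\<exists>F\<subseteq>forms n. X = zero_locus n F"
  then obtain F where F: "F \<subseteq> forms n" "X = zero_locus n F" by blast
  define G where "G = {g. homogeneous_poly n g \<and> mpoly_eval g \<in> F}"
  have "F = mpoly_eval ` G"
  proof
    show "F \<subseteq> mpoly_eval ` G"
    proof
      fix f assume f: "f \<in> F"
      then have "f \<in> forms n" using F(1) by blast
      then obtain d where "form n d f" unfolding forms_def by blast
      then obtain g where "homogeneous_poly n g" "mpoly_eval g = f" by (rule form_homogeneous_poly)
      then show "f \<in> mpoly_eval ` G" using f unfolding G_def by blast
    qed
  qed (auto simp: G_def)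
  then have "X = line_through n ` {x \<in> pts n. \<forall>g\<in>G. mpoly_eval g x = 0}"
    unfolding F zero_locus_def by simp
  then show "closed_subvariety n X"
    unfolding closed_subvariety_def topspace_punctured by (intro exI[of _ G]) (simp add: G_def)
qed

lemma closed_subvariety_image_cone:
  assumes "closed_subvariety n X" shows "X = line_through n ` cone n X"
  using assms unfolding closed_subvariety_iff cone_def zero_locus_def by auto

lemma cone_subset_iff:
  assumes "closed_subvariety n X" "closed_subvariety n Y"
  shows "cone n X \<subseteq> cone n Y \<longleftrightarrow> X \<subseteq> Y"
proof
  assume "cone n X \<subseteq> cone n Y"
  then have "line_through n ` cone n X \<subseteq> line_through n ` cone n Y" by (rule image_mono)
  then show "X \<subseteq> Y" using assms[THEN closed_subvariety_image_cone] by simp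
qed (auto simp: cone_def)

text \<open>X is the union of its intersections with f = 0 and g = 0, so irreducibility makes one of
  them all of X. This is primality of the homogeneous ideal of X.\<close>

lemma irreducible_prime:
  assumes X: "irreducible_subvariety n X" and f: "f \<in> forms n" and g: "g \<in> forms n"
    and fg: "\<And>x. x \<in> cone n X \<Longrightarrow> f x * g x = 0"
  shows "(\<forall>x\<in>cone n X. f x = 0) \<or> (\<forall>x\<in>cone n X. g x = 0)"
proof -
  have cl: "closed_subvariety n X" using X by (simp add: irreducible_subvariety_def)
  then obtain F where F: "F \<subseteq> forms n" "X = zero_locus n F"
    unfolding closed_subvariety_iff by blast
  let ?Y = "zero_locus n (insert f F)" and ?Z = "zero_locus n (insert g F)"
  have c: "cone n X = {x \<in> pts n. \<forall>f\<in>F. f x = 0}" unfolding F(2) by (rule cone_zero_locus[OF F(1)])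
  have Y: "cone n ?Y = {x \<in> pts n. \<forall>h\<in>insert f F. h x = 0}"
    and Z: "cone n ?Z = {x \<in> pts n. \<forall>h\<in>insert g F. h x = 0}"
    using F f g by (intro cone_zero_locus; simp)+
  have "{x \<in> pts n. \<forall>f\<in>F. f x = 0} =
      {x \<in> pts n. \<forall>h\<in>insert f F. h x = 0} \<union> {x \<in> pts n. \<forall>h\<in>insert g F. h x = 0}"
    using fg unfolding c by auto
  then have "X = ?Y \<union> ?Z" unfolding F(2) zero_locus_def by (simp only: image_Un)
  moreover have "closed_subvariety n ?Y"
    unfolding closed_subvariety_iff by (rule exI[of _ "insert f F"]) (use F f in simp)
  moreover have "closed_subvariety n ?Z"
    unfolding closed_subvariety_iff by (rule exI[of _ "insert g F"]) (use F g in simp)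
  ultimately have "X = ?Y \<or> X = ?Z" using X unfolding irreducible_subvariety_def by blast
  then show ?thesis
  proof
    assume "X = ?Y"
    then have "cone n X = cone n ?Y" by simp
    then show ?thesis unfolding Y by blast
  next
    assume "X = ?Z"
    then have "cone n X = cone n ?Z" by simp
    then show ?thesis unfolding Z by blast
  qed
qed

lemma separating_form:
  assumes "closed_subvariety n X" "closed_subvariety n Y" "\<not> Y \<subseteq> X"
  obtains f where "f \<in> forms n" "\<And>x. x \<in> cone n X \<Longrightarrow> f x = 0" "\<exists>x\<in>cone n Y. f x \<noteq> 0"
proof -
  obtain F where F: "F \<subseteq> forms n" "X = zero_locus n F"
    using assms(1) unfolding closed_subvariety_iff by blast
  have c: "cone n X = {x \<in> pts n. \<forall>f\<in>F. f x = 0}" unfolding F(2) by (rule cone_zero_locus[OF F(1)])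
  obtain x where x: "x \<in> cone n Y" "x \<notin> cone n X"
    using cone_subset_iff[OF assms(2,1)] assms(3) by blast
  then have "x \<in> pts n" by (simp add: cone_def)
  then obtain f where "f \<in> F" "f x \<noteq> 0" using x c by auto
  then show ?thesis using that[of f] F x c by auto
qed

section \<open>Dimension bound\<close>

lemma underdetermined_system:
  fixes A :: "'e \<Rightarrow> 't \<Rightarrow> complex"
  assumes "finite S" "finite T" "card T < card S"
  shows "\<exists>a. (\<exists>e\<in>S. a e \<noteq> 0) \<and> (\<forall>t\<in>T. (\<Sum>e\<in>S. a e * A e t) = 0)"
  using assms(2,1,3)
proof (induction T arbitrary: S A rule: finite_induct)
  case empty
  then obtain e where "e \<in> S" by fastforce
  then show ?case by (intro exI[of _ "\<lambda>_. 1"]) auto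
next
  case (insert t T)
  show ?case
  proof (cases "\<forall>e\<in>S. A e t = 0")
    case True
    have "card T < card S" using insert by simp
    then obtain a where "\<exists>e\<in>S. a e \<noteq> 0" "\<forall>t\<in>T. (\<Sum>e\<in>S. a e * A e t) = 0"
      using insert.IH insert.prems(1) by blast
    then show ?thesis using True by (intro exI[of _ a]) simp
  next
    case False
    then obtain e0 where e0: "e0 \<in> S" "A e0 t \<noteq> 0" by blast
    have "finite (S - {e0})" "card T < card (S - {e0})" using insert e0 by simp_all
    from insert.IH[OF this, of "\<lambda>e s. A e s - A e t / A e0 t * A e0 s"] obtain a where
      a: "\<exists>e\<in>S - {e0}. a e \<noteq> 0"
        "\<forall>s\<in>T. (\<Sum>e\<in>S - {e0}. a e * (A e s - A e t / A e0 t * A e0 s)) = 0" by blast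
    define c where "c = - (\<Sum>e\<in>S - {e0}. a e * A e t) / A e0 t"
    have split: "(\<Sum>e\<in>S. (a(e0 := c)) e * A e s) = c * A e0 s + (\<Sum>e\<in>S - {e0}. a e * A e s)" for s
      using insert.prems(1) e0 by (subst sum.remove[of _ e0]) auto
    have "(\<Sum>e\<in>S. (a(e0 := c)) e * A e t) = 0"
      unfolding split using e0 by (simp add: c_def)
    moreover have "(\<Sum>e\<in>S. (a(e0 := c)) e * A e s) = 0" if "s \<in> T" for s
    proof -
      have "0 = (\<Sum>e\<in>S - {e0}. a e * (A e s - A e t / A e0 t * A e0 s))" using a that by simp
      also have "\<dots> = (\<Sum>e\<in>S - {e0}. a e * A e s) - (\<Sum>e\<in>S - {e0}. a e * A e t) / A e0 t * A e0 s"
        by (simp add: algebra_simps sum_subtractf sum_distrib_left sum_divide_distrib)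
      finally show ?thesis unfolding split by (simp add: c_def)
    qed
    ultimately show ?thesis using a(1) by (intro exI[of _ "a(e0 := c)"]) auto
  qed
qed

text \<open>One bound M serves all variables in I. Some of these monomials may still be reducible,
  but for fixed M their number up to degree D grows at most like the power n + 1 - card I of D,
  which is all that the count needs.\<close>

definition std_expo :: "nat \<Rightarrow> nat set \<Rightarrow> nat \<Rightarrow> nat \<Rightarrow> (nat \<Rightarrow> nat) set"
  where "std_expo n I M d = {e \<in> expo n d. \<forall>s\<in>I. e s < M}"

definition low_expo :: "nat \<Rightarrow> nat \<Rightarrow> nat \<Rightarrow> (nat \<Rightarrow> nat) set"
  where "low_expo n s d = {e \<in> expo n d. \<exists>a<s. e a > 0}"

lemma finite_std_expo: "finite (std_expo n I M d)" and finite_low_expo: "finite (low_expo n s d)"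
  using finite_expo[of n d] by (simp_all add: std_expo_def low_expo_def)

text \<open>Rewriting \<open>x\<^sub>s\<^sup>m\<close> by monomials with smaller variables increases the weight \<open>\<Sum>i\<le>n. e i * L ^ (n - i)\<close>,
  which is bounded on monomials of a given degree.\<close>

lemma span_on_standard:
  assumes I: "I \<subseteq> {..n}"
    and rel: "\<And>s. s \<in> I \<Longrightarrow> m s \<le> M \<and> span_on K n (low_expo n s (m s)) (\<lambda>x. x s ^ m s)"
    and "e \<in> expo n d"
  shows "span_on K n (std_expo n I M d) (monom_eval n e)"
proof -
  \<comment> \<open>The base exceeds every m s, so a single factor with a smaller index outweighs
    x_s^(m s).\<close>
  define L where "L = M + 1"
  define \<mu> where "\<mu> e = (\<Sum>i\<le>n. e i * L ^ (n - i))" for e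
  have \<mu>_add: "\<mu> (\<lambda>i. e i + f i) = \<mu> e + \<mu> f" for e f
    by (simp add: \<mu>_def algebra_simps sum.distrib)
  have \<mu>_le: "\<mu> e \<le> d * L ^ n" if "e \<in> expo n d" for e
  proof -
    have "\<mu> e \<le> (\<Sum>i\<le>n. e i * L ^ n)" unfolding \<mu>_def
      by (intro sum_mono mult_left_mono power_increasing) (auto simp: L_def)
    then show ?thesis using that by (simp add: expo_def flip: sum_distrib_right)
  qed
  show ?thesis using assms(3)
  proof (induction "d * L ^ n - \<mu> e" arbitrary: e rule: less_induct)
    case less
    show ?case
    proof (cases "e \<in> std_expo n I M d")
      case True
      then show ?thesis by (intro span_on_monomial finite_std_expo)
    next
      case False
      then obtain s where s: "s \<in> I" "e s \<ge> M" using less.prems by (auto simp: std_expo_def not_less)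
      have sn: "s \<le> n" using s I by auto
      have ms: "m s \<le> M" "m s \<le> e s" using rel[OF s(1)] s(2) by auto
      define f where "f = (\<lambda>i. e i - unit_expo s (m s) i)"
      have e: "e = (\<lambda>i. unit_expo s (m s) i + f i)"
        using ms by (auto simp: f_def unit_expo_def)
      have f: "f \<in> expo n (d - m s)"
      proof -
        have "(\<Sum>i\<le>n. unit_expo s (m s) i) + (\<Sum>i\<le>n. f i) = d"
          using less.prems unfolding expo_def by (subst (asm) e) (simp add: sum.distrib)
        moreover have "(\<Sum>i\<le>n. unit_expo s (m s) i) = m s"
          using unit_expo_in_expo[OF sn] by (simp add: expo_def)
        ultimately show ?thesis using less.prems by (auto simp: expo_def f_def)
      qed
      have md: "m s + (d - m s) = d" using expo_le[OF less.prems, of s] ms by simp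
      define E where "E = {e' \<in> expo n d. \<mu> e' > \<mu> e}"
      have "span_on K n E (\<lambda>x. x s ^ m s * monom_eval n f x)"
      proof (rule span_on_mult)
        show "span_on K n (low_expo n s (m s)) (\<lambda>x. x s ^ m s)" using rel[OF s(1)] by simp
        show "span_on K n {f} (monom_eval n f)" by (rule span_on_monomial) auto
        show "finite E" using finite_expo[of n d] by (simp add: E_def)
        fix g h assume g: "g \<in> low_expo n s (m s)" and "h \<in> {f}"
        then obtain a where a: "a < s" "g a > 0" by (auto simp: low_expo_def)
        have "\<mu> (unit_expo s (m s)) = (\<Sum>i\<le>n. if i = s then m s * L ^ (n - s) else 0)"
          unfolding \<mu>_def by (intro sum.cong) (auto simp: unit_expo_def)
        also have "\<dots> = m s * L ^ (n - s)" using sn by simp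
        also have "\<dots> < L * L ^ (n - s)" using ms by (intro mult_strict_right_mono) (simp_all add: L_def)
        also have "\<dots> = L ^ Suc (n - s)" by simp
        also have "\<dots> \<le> L ^ (n - a)" using a sn by (intro power_increasing) (auto simp: L_def)
        also have "\<dots> \<le> g a * L ^ (n - a)" using a by simp
        also have "\<dots> \<le> \<mu> g" unfolding \<mu>_def
          using member_le_sum[of a "{..n}" "\<lambda>i. g i * L ^ (n - i)"] a sn by simp
        finally have "\<mu> (\<lambda>i. g i + f i) > \<mu> e" unfolding \<mu>_add by (subst e) (simp add: \<mu>_add)
        moreover have "(\<lambda>i. g i + f i) \<in> expo n d"
          using expo_add[of g n "m s" f "d - m s"] g f md by (simp add: low_expo_def)
        ultimately show "(\<lambda>i. g i + h i) \<in> E" using \<open>h \<in> {f}\<close> by (simp add: E_def)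
      qed
      then have "span_on K n E (monom_eval n e)"
        by (rule span_on_cong) (subst e, simp add: monom_eval_add monom_eval_unit_expo sn)
      then show ?thesis
      proof (rule span_on_trans)
        fix e' assume "e' \<in> E"
        then show "span_on K n (std_expo n I M d) (monom_eval n e')"
          using less.hyps[of e'] \<mu>_le[of e'] by (auto simp: E_def)
      qed
    qed
  qed
qed

section \<open>Independence of forms along a chain of irreducible subvarieties\<close>

definition wdeg :: "(nat \<Rightarrow> nat) \<Rightarrow> nat \<Rightarrow> (nat \<Rightarrow> nat) \<Rightarrow> nat"
  where "wdeg d l e = (\<Sum>i\<le>l. e i * d i)"

definition power_prod ::
    "(nat \<Rightarrow> (nat \<Rightarrow> complex) \<Rightarrow> complex) \<Rightarrow> nat \<Rightarrow> (nat \<Rightarrow> nat) \<Rightarrow> (nat \<Rightarrow> complex) \<Rightarrow> complex"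
  where "power_prod f l e x = (\<Prod>i\<le>l. f i x ^ e i)"

lemma form_power_prod:
  assumes "\<And>i. i \<le> l \<Longrightarrow> form n (d i) (f i)"
  shows "form n (wdeg d l e) (power_prod f l e)"
  unfolding wdeg_def power_prod_def[abs_def] by (intro form_prod form_power assms) auto

text \<open>Restrict a relation between the monomials in \<open>f\<^sub>0, \<dots>, f\<^sub>l\<close> to \<open>C\<^bsub>l-1\<^esub>\<close>, where \<open>f\<^sub>l\<close> vanishes, then divide
  by \<open>f\<^sub>l\<close>, which is not a zero divisor on the irreducible \<open>C\<^sub>l\<close>.\<close>

lemma chain_independent:
  assumes C: "\<And>i. i \<le> l \<Longrightarrow> irreducible_subvariety n (C i)"
    and mono: "\<And>i. i < l \<Longrightarrow> C i \<subseteq> C (Suc i)"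
    and f: "\<And>i. i \<le> l \<Longrightarrow> form n (d i) (f i)"
    and van: "\<And>i x. i < l \<Longrightarrow> x \<in> cone n (C i) \<Longrightarrow> f (Suc i) x = 0"
    and nz: "\<And>i. i \<le> l \<Longrightarrow> \<exists>x\<in>cone n (C i). f i x \<noteq> 0"
    and d0: "d 0 = 1"
    and S: "finite S" "\<And>e. e \<in> S \<Longrightarrow> (\<forall>i>l. e i = 0) \<and> wdeg d l e = D"
    and rel: "\<And>x. x \<in> cone n (C l) \<Longrightarrow> (\<Sum>e\<in>S. a e * power_prod f l e x) = 0"
    and "e \<in> S"
  shows "a e = 0"
  using assms
proof (induction l arbitrary: S a e D)
  case 0
  \<comment> \<open>Since d 0 = 1, an exponent vector supported at 0 is determined by its weighted
    degree, so S is a singleton.\<close>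
  have "e' = e" if "e' \<in> S" for e'
  proof
    fix i
    have 1: "\<forall>i>0. e' i = 0" "wdeg d 0 e' = D" using 0(8)[OF that] by blast+
    have 2: "\<forall>i>0. e i = 0" "wdeg d 0 e = D" using 0(8)[OF 0(10)] by blast+
    have "e' 0 = e 0" using 1(2) 2(2) 0(6) unfolding wdeg_def by simp
    then show "e' i = e i" using 1(1) 2(1) by (cases "i = 0") simp_all
  qed
  then have S: "S = {e}" using 0(10) by blast
  obtain x where "x \<in> cone n (C 0)" "f 0 x \<noteq> 0" using 0(5) by blast
  with 0(9)[of x] show ?case by (simp add: S power_prod_def)
next
  case (Suc l)
  note IH = Suc.IH and C = Suc.prems(1) and mono = Suc.prems(2) and f = Suc.prems(3)
    and van = Suc.prems(4) and nz = Suc.prems(5) and d0 = Suc.prems(6)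
  \<comment> \<open>An inner induction on a bound b for the exponent of the last form: each round
    removes the terms free of that form and divides the rest by it once.\<close>
  have "\<forall>e\<in>S. a e = 0"
    if "finite S" "\<And>e. e \<in> S \<Longrightarrow> (\<forall>i>Suc l. e i = 0) \<and> wdeg d (Suc l) e = D" "\<And>e. e \<in> S \<Longrightarrow> e (Suc l) \<le> b"
      "\<And>x. x \<in> cone n (C (Suc l)) \<Longrightarrow> (\<Sum>e\<in>S. a e * power_prod f (Suc l) e x) = 0" for S a D b
    using that
  proof (induction b arbitrary: S a D)
    case (0 S a D)
    show ?case
    proof
      fix e assume "e \<in> S"
      have e0: "e (Suc l) = 0" if "e \<in> S" for e using 0(3)[OF that] by simp
      show "a e = 0"
      proof (rule IH[of S D a])
        show "(\<forall>i>l. e i = 0) \<and> wdeg d l e = D" if "e \<in> S" for e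
          using 0(2)[OF that] e0[OF that] by (auto simp: wdeg_def) (metis Suc_lessI)
        show "(\<Sum>e\<in>S. a e * power_prod f l e x) = 0" if "x \<in> cone n (C l)" for x
        proof -
          have "x \<in> cone n (C (Suc l))" using that mono[of l] by (auto simp: cone_def)
          moreover have "(\<Sum>e\<in>S. a e * power_prod f l e x) = (\<Sum>e\<in>S. a e * power_prod f (Suc l) e x)"
            by (intro sum.cong) (auto simp: power_prod_def e0)
          ultimately show ?thesis using 0(4) by simp
        qed
      qed (use 0(1) \<open>e \<in> S\<close> C mono f van nz d0 in auto)
    qed
  next
    case (Suc b S a D)
    define S0 where "S0 = {e \<in> S. e (Suc l) = 0}"
    define S1 where "S1 = {e \<in> S. e (Suc l) > 0}"
    have SS: "S = S0 \<union> S1" "S0 \<inter> S1 = {}" by (auto simp: S0_def S1_def)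
    have fin: "finite S0" "finite S1" using Suc.prems(1) SS(1) by auto
    have a0: "a e = 0" if "e \<in> S0" for e
    proof (rule IH[of S0 D a])
      show "(\<forall>i>l. e i = 0) \<and> wdeg d l e = D" if "e \<in> S0" for e
        using Suc.prems(2)[of e] that by (auto simp: wdeg_def S0_def) (metis Suc_lessI)
      show "(\<Sum>e\<in>S0. a e * power_prod f l e x) = 0" if "x \<in> cone n (C l)" for x
      proof -
        have "x \<in> cone n (C (Suc l))" using that mono[of l] by (auto simp: cone_def)
        then have "(\<Sum>e\<in>S0. a e * power_prod f (Suc l) e x) + (\<Sum>e\<in>S1. a e * power_prod f (Suc l) e x) = 0"
          using Suc.prems(4)[of x] fin SS by (simp add: sum.union_disjoint)
        moreover have "(\<Sum>e\<in>S1. a e * power_prod f (Suc l) e x) = 0"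
          using van[of l x] that by (intro sum.neutral) (auto simp: S1_def power_prod_def)
        moreover have "(\<Sum>e\<in>S0. a e * power_prod f (Suc l) e x) = (\<Sum>e\<in>S0. a e * power_prod f l e x)"
          by (intro sum.cong) (auto simp: S0_def power_prod_def)
        ultimately show ?thesis by simp
      qed
    qed (use fin \<open>e \<in> S0\<close> C mono f van nz d0 in auto)
    define dec where "dec e = e(Suc l := e (Suc l) - 1)" for e :: "nat \<Rightarrow> nat"
    define inc where "inc e = e(Suc l := Suc (e (Suc l)))" for e :: "nat \<Rightarrow> nat"
    have inc_dec: "inc (dec e) = e" if "e \<in> S1" for e using that by (auto simp: inc_def dec_def S1_def)
    have inj: "inj_on dec S1" using inc_dec by (metis inj_onI)
    have wd: "wdeg d (Suc l) (dec e) = D - d (Suc l)" if "e \<in> S1" for e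
    proof -
      have "D = wdeg d (Suc l) e" using Suc.prems(2)[of e] that by (simp add: S1_def)
      then show ?thesis using that
        by (simp add: wdeg_def dec_def S1_def diff_mult_distrib)
    qed
    have pd: "power_prod f (Suc l) e x = f (Suc l) x * power_prod f (Suc l) (dec e) x" if "e \<in> S1" for e x
      using that by (cases "e (Suc l)") (auto simp: power_prod_def dec_def S1_def mult_ac)
    define g where "g x = (\<Sum>e\<in>dec ` S1. a (inc e) * power_prod f (Suc l) e x)" for x
    have g: "g x = (\<Sum>e\<in>S1. a e * power_prod f (Suc l) (dec e) x)" for x
      unfolding g_def by (subst sum.reindex[OF inj]) (simp add: inc_dec)
    \<comment> \<open>Primality is stated for forms, so the quotient has to be homogeneous; this is
      why all exponents in S share the weighted degree D.\<close>
    have "form n (D - d (Suc l)) g"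
      unfolding g_def[abs_def]
    proof (intro form_sum form_scale)
      fix e assume "e \<in> dec ` S1"
      then have "wdeg d (Suc l) e = D - d (Suc l)" using wd by auto
      moreover have "form n (wdeg d (Suc l) e) (power_prod f (Suc l) e)"
        by (rule form_power_prod) (rule f)
      ultimately show "form n (D - d (Suc l)) (power_prod f (Suc l) e)" by simp
    qed
    then have "g \<in> forms n" "f (Suc l) \<in> forms n" using f[of "Suc l"] by (auto simp: forms_def)
    moreover have "f (Suc l) x * g x = 0" if "x \<in> cone n (C (Suc l))" for x
    proof -
      have "(\<Sum>e\<in>S. a e * power_prod f (Suc l) e x) = (\<Sum>e\<in>S1. a e * power_prod f (Suc l) e x)"
        using a0 fin SS by (simp add: sum.union_disjoint)
      also have "\<dots> = f (Suc l) x * g x"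
        unfolding g sum_distrib_left by (intro sum.cong) (auto simp: pd)
      finally show ?thesis using Suc.prems(4)[OF that] by simp
    qed
    ultimately have "\<forall>x\<in>cone n (C (Suc l)). g x = 0"
      using irreducible_prime[OF C[of "Suc l"], of "f (Suc l)" g] nz[of "Suc l"] by auto
    then have "\<forall>e\<in>dec ` S1. a (inc e) = 0"
    proof (intro Suc.IH[of "dec ` S1" "D - d (Suc l)"])
      show "(\<forall>i>Suc l. e i = 0) \<and> wdeg d (Suc l) e = D - d (Suc l)" if "e \<in> dec ` S1" for e
        using that wd Suc.prems(2) by (auto simp: S1_def dec_def)
      show "e (Suc l) \<le> b" if "e \<in> dec ` S1" for e
        using that Suc.prems(3) by (fastforce simp: S1_def dec_def)
    qed (use fin in \<open>auto simp: g_def\<close>)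
    then have "a e = 0" if "e \<in> S1" for e using that inc_dec by force
    with a0 SS show ?case by blast
  qed
  from this[OF Suc.prems(7,8) _ Suc.prems(9), of "Max ((\<lambda>e. e (Suc l)) ` S)"]
  show ?case using Suc.prems(7,10) by (meson Max_ge finite_imageI imageI)
qed

section \<open>Counting monomials against power products\<close>

lemma card_std_expo_le:
  assumes I: "I \<subseteq> {..n}"
  shows "card (\<Union>d\<le>D. std_expo n I M d) \<le> M ^ card I * (D + 1) ^ (n + 1 - card I)"
proof -
  let ?B = "\<lambda>i. if i \<in> I then {..<M} else {..D}"
  have "restrict e {..n} \<in> PiE {..n} ?B" if "d \<le> D" "e \<in> std_expo n I M d" for e d
    using that expo_le[of e n d] by (auto simp: std_expo_def PiE_iff intro: order_trans)
  then have sub: "(\<lambda>e. restrict e {..n}) ` (\<Union>d\<le>D. std_expo n I M d) \<subseteq> PiE {..n} ?B" by blast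
  have "inj_on (\<lambda>e. restrict e {..n}) (\<Union>d\<le>D. std_expo n I M d)"
  proof (rule inj_onI)
    fix e f assume ef: "e \<in> (\<Union>d\<le>D. std_expo n I M d)" "f \<in> (\<Union>d\<le>D. std_expo n I M d)"
      and eq: "restrict e {..n} = restrict f {..n}"
    show "e = f"
    proof
      fix i show "e i = f i"
        using ef fun_cong[OF eq, of i] by (cases "i \<le> n") (auto simp: std_expo_def expo_def)
    qed
  qed
  then have "card (\<Union>d\<le>D. std_expo n I M d) \<le> card (PiE {..n} ?B)"
    using sub by (intro card_inj_on_le) (auto intro!: finite_PiE)
  also have "\<dots> = (\<Prod>i\<le>n. if i \<in> I then M else D + 1)"
    by (subst card_PiE) (auto intro!: prod.cong)
  also have "\<dots> = (\<Prod>i\<in>I. M) * (\<Prod>i\<in>{..n} - I. D + 1)"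
    using I by (simp add: prod.If_cases Int_absorb1 Diff_eq)
  also have "\<dots> = M ^ card I * (D + 1) ^ (n + 1 - card I)"
    using I finite_subset[OF I] by (simp add: card_Diff_subset)
  finally show ?thesis .
qed

text \<open>There are E^(l+1) power products of f_0, ..., f_l with exponents below E, of degree at
  most E c. In each degree they are independent on the cone over C l and lie in the span of the
  standard monomials. Comparing numbers for all E, the power l + 1 cannot exceed n + 1 - card
  I.\<close>

lemma chain_length:
  assumes C: "\<And>i. i \<le> l \<Longrightarrow> irreducible_subvariety n (C i)"
    and mono: "\<And>i. i < l \<Longrightarrow> C i \<subset> C (Suc i)"
    and I: "I \<subseteq> {..n}"
    and rel: "\<And>s. s \<in> I \<Longrightarrow> m s \<le> M \<and> span_on (cone n (C l)) n (low_expo n s (m s)) (\<lambda>x. x s ^ m s)"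
  shows "l + card I \<le> n"
proof -
  have cl: "closed_subvariety n (C i)" if "i \<le> l" for i
    using C[OF that] by (simp add: irreducible_subvariety_def)
  have "\<exists>f. f \<in> forms n \<and> (\<forall>x\<in>cone n (C i). f x = 0) \<and> (\<exists>x\<in>cone n (C (Suc i)). f x \<noteq> 0)" if "i < l" for i
  proof -
    have "\<not> C (Suc i) \<subseteq> C i" using mono[OF that] by blast
    then show ?thesis using separating_form[OF cl[of i] cl[of "Suc i"]] that by (metis Suc_leI less_imp_le)
  qed
  then obtain g where g: "\<And>i. i < l \<Longrightarrow> g i \<in> forms n" "\<And>i x. i < l \<Longrightarrow> x \<in> cone n (C i) \<Longrightarrow> g i x = 0"
    "\<And>i. i < l \<Longrightarrow> \<exists>x\<in>cone n (C (Suc i)). g i x \<noteq> 0" by metis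
  obtain dg where dg: "\<And>i. i < l \<Longrightarrow> form n (dg i) (g i)"
    using g(1) unfolding forms_def mem_Collect_eq by metis
  have "C 0 \<noteq> {}" using C[of 0] by (simp add: irreducible_subvariety_def)
  then obtain x0 where x0: "x0 \<in> cone n (C 0)" using closed_subvariety_image_cone[OF cl[of 0]] by auto
  then obtain s0 where s0: "s0 \<le> n" "x0 s0 \<noteq> 0" by (auto simp: cone_def pts_def)
  \<comment> \<open>f 0 is a coordinate not vanishing identically on C 0, of degree 1 as
    \<open>chain_independent\<close> demands; f (Suc i) vanishes on C i but not identically on C
    (Suc i).\<close>
  define f where "f i = (case i of 0 \<Rightarrow> (\<lambda>x. x s0) | Suc i \<Rightarrow> g i)" for i
  define d where "d i = (case i of 0 \<Rightarrow> 1 | Suc i \<Rightarrow> dg i)" for i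
  have f: "form n (d i) (f i)" if "i \<le> l" for i
    using that dg form_coordinate[OF s0(1)] by (cases i) (auto simp: f_def d_def)
  have nz: "\<exists>x\<in>cone n (C i). f i x \<noteq> 0" if "i \<le> l" for i
    using that g(3) x0 s0 by (cases i) (auto simp: f_def)
  have van: "f (Suc i) x = 0" if "i < l" "x \<in> cone n (C i)" for i x
    using g(2) that by (simp add: f_def)
  define c where "c = (\<Sum>i\<le>l. d i)"
  have bound: "E ^ Suc l \<le> M ^ card I * (E * c + 1) ^ (n + 1 - card I)" for E
  proof -
    define S where "S = {e. \<forall>i. (i \<in> {..l} \<longrightarrow> e i \<in> {..<E}) \<and> (i \<notin> {..l} \<longrightarrow> e i = (0::nat))}"
    have fS: "finite S" unfolding S_def by (intro finite_set_of_finite_funs) auto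
    have cS: "card S = E ^ Suc l"
    proof -
      have "bij_betw (\<lambda>e. restrict e {..l}) S (PiE {..l} (\<lambda>_. {..<E}))"
        by (rule bij_betwI[of _ _ _ "\<lambda>e i. if i \<le> l then e i else 0"])
           (auto simp: S_def fun_eq_iff PiE_def extensional_def)
      then show ?thesis using bij_betw_same_card by (fastforce simp: card_PiE)
    qed
    have w: "wdeg d l e \<le> E * c" if "e \<in> S" for e
      unfolding wdeg_def c_def sum_distrib_left using that
      by (intro sum_mono mult_right_mono) (auto simp: S_def less_imp_le)
    have each: "card {e \<in> S. wdeg d l e = D} \<le> card (std_expo n I M D)" for D
    proof (rule ccontr)
      let ?S = "{e \<in> S. wdeg d l e = D}"
      assume "\<not> card ?S \<le> card (std_expo n I M D)"
      then have less: "card (std_expo n I M D) < card ?S" by simp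
      have "span_on (cone n (C l)) n (std_expo n I M D) (power_prod f l e)" if "e \<in> ?S" for e
      proof (rule span_on_trans)
        have "form n (wdeg d l e) (power_prod f l e)" by (rule form_power_prod) (rule f)
        moreover have "wdeg d l e = D" using that by blast
        ultimately have "form n D (power_prod f l e)" by (simp only:)
        then show "span_on (cone n (C l)) n (expo n D) (power_prod f l e)"
          unfolding form_def by (rule span_on_subset) simp
        show "span_on (cone n (C l)) n (std_expo n I M D) (monom_eval n e')" if "e' \<in> expo n D" for e'
          by (rule span_on_standard[OF I rel that])
      qed
      then have "\<forall>e\<in>?S. \<exists>a. \<forall>x\<in>cone n (C l). power_prod f l e x = (\<Sum>t\<in>std_expo n I M D. a t * monom_eval n t x)"
        unfolding span_on_def by blast
      from bchoice[OF this] obtain A where A: "\<And>e x. e \<in> ?S \<Longrightarrow> x \<in> cone n (C l) \<Longrightarrow>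
          power_prod f l e x = (\<Sum>t\<in>std_expo n I M D. A e t * monom_eval n t x)"
        by blast
      obtain a where a: "\<exists>e\<in>?S. a e \<noteq> 0" "\<forall>t\<in>std_expo n I M D. (\<Sum>e\<in>?S. a e * A e t) = 0"
        using underdetermined_system[OF _ finite_std_expo less, of A] fS by auto
      have "(\<Sum>e\<in>?S. a e * power_prod f l e x) = 0" if "x \<in> cone n (C l)" for x
      proof -
        have "(\<Sum>e\<in>?S. a e * power_prod f l e x) = (\<Sum>e\<in>?S. \<Sum>t\<in>std_expo n I M D. a e * A e t * monom_eval n t x)"
          using that by (intro sum.cong) (auto simp: A sum_distrib_left mult_ac)
        also have "\<dots> = (\<Sum>t\<in>std_expo n I M D. (\<Sum>e\<in>?S. a e * A e t) * monom_eval n t x)"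
          by (subst sum.swap) (simp add: sum_distrib_right)
        finally show ?thesis using a(2) by simp
      qed
      then have "a e = 0" if "e \<in> ?S" for e
        using that C mono f van nz fS
        by (intro chain_independent[of l n C d f ?S D a e]) (auto simp: d_def S_def)
      with a(1) show False by blast
    qed
    have "E ^ Suc l = card (\<Union>D\<le>E * c. {e \<in> S. wdeg d l e = D})"
      unfolding cS[symmetric] using w by (intro arg_cong[of _ _ card]) auto
    also have "\<dots> \<le> (\<Sum>D\<le>E * c. card {e \<in> S. wdeg d l e = D})" by (rule card_UN_le) simp
    also have "\<dots> \<le> (\<Sum>D\<le>E * c. card (std_expo n I M D))" by (intro sum_mono each)
    also have "\<dots> = card (\<Union>D\<le>E * c. std_expo n I M D)"
      by (rule card_UN_disjoint[symmetric])
         (use finite_std_expo in \<open>simp_all, auto simp: std_expo_def expo_def\<close>)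
    also have "\<dots> \<le> M ^ card I * (E * c + 1) ^ (n + 1 - card I)" by (rule card_std_expo_le[OF I])
    finally show ?thesis .
  qed
  have cI: "card I \<le> n + 1" using card_mono[OF _ I] by simp
  show ?thesis
  proof (rule ccontr)
    assume "\<not> l + card I \<le> n"
    then have l: "n + 1 - card I \<le> l" by simp
    define K where "K = M ^ card I * (c + 1) ^ (n + 1 - card I)"
    \<comment> \<open>As E \<ge> 1, E c + 1 \<le> E (c + 1), so the bound becomes E^(l+1) \<le> K
      E^(n+1-card I). With l at least the exponent on the right, any E > K refutes it.\<close>
    define E where "E = K + 1"
    have "E * E ^ (n + 1 - card I) \<le> E * E ^ l"
      using l by (intro mult_left_mono power_increasing) (auto simp: E_def)
    also have "\<dots> \<le> M ^ card I * (E * c + 1) ^ (n + 1 - card I)" using bound[of E] by simp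
    also have "\<dots> \<le> M ^ card I * (E * (c + 1)) ^ (n + 1 - card I)"
      by (intro mult_left_mono power_mono) (auto simp: E_def)
    also have "\<dots> = K * E ^ (n + 1 - card I)" by (simp only: K_def power_mult_distrib mult_ac)
    finally show False by (simp add: E_def)
  qed
qed

lemma subvariety_codim_ge:
  assumes I: "I \<subseteq> {..n}"
    and rel: "\<And>s. s \<in> I \<Longrightarrow> \<exists>m. span_on (cone n X) n (low_expo n s m) (\<lambda>x. x s ^ m)"
  shows "subvariety_codim n X \<ge> ereal (real (card I))"
proof -
  obtain m where m: "\<And>s. s \<in> I \<Longrightarrow> span_on (cone n X) n (low_expo n s (m s)) (\<lambda>x. x s ^ m s)"
    using rel by metis
  have fI: "finite I" using I by (rule finite_subset) simp
  have "subvariety_dim n X \<le> ereal (real n - real (card I))"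
    unfolding subvariety_dim_def
  proof (rule Sup_least)
    fix y assume "y \<in> {ereal (real l) |l. \<exists>C. (\<forall>i\<le>l. irreducible_subvariety n (C i) \<and> C i \<subseteq> X) \<and>
                                (\<forall>i<l. C i \<subset> C (Suc i))}"
    then obtain l C where y: "y = ereal (real l)"
      and C: "\<And>i. i \<le> l \<Longrightarrow> irreducible_subvariety n (C i) \<and> C i \<subseteq> X"
      and mono: "\<And>i. i < l \<Longrightarrow> C i \<subset> C (Suc i)" by blast
    have sub: "cone n (C l) \<subseteq> cone n X" using C[of l] by (auto simp: cone_def)
    \<comment> \<open>Relations on the cone over X restrict to the cone over C l, and the sum of the
      m s is a common bound for them.\<close>
    have "l + card I \<le> n"
      using C mono I m fI
      by (intro chain_length[of l n C I m "\<Sum>s\<in>I. m s"])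
         (auto intro: member_le_sum span_on_subset[OF _ sub])
    then have "real l + real (card I) \<le> real n" by (simp flip: of_nat_add)
    then show "y \<le> ereal (real n - real (card I))" by (simp add: y)
  qed
  then have "ereal (real n) - ereal (real n - real (card I)) \<le> ereal (real n) - subvariety_dim n X"
    by (intro ereal_minus_mono) auto
  then show ?thesis by (simp add: subvariety_codim_def)
qed

section \<open>Generic first order parts\<close>

text \<open>The degree d part of the ideal generated by the variables before x_s. Then
  \<open>lead_form\<close> is congruence to c x_s^d modulo this ideal, so leading coefficients
  multiply under products.\<close>

definition low_form :: "nat \<Rightarrow> nat \<Rightarrow> nat \<Rightarrow> ((nat \<Rightarrow> complex) \<Rightarrow> complex) \<Rightarrow> bool"
  where "low_form n s d f \<longleftrightarrow> span_on UNIV n (low_expo n s d) f"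

definition lead_form :: "nat \<Rightarrow> nat \<Rightarrow> nat \<Rightarrow> complex \<Rightarrow> ((nat \<Rightarrow> complex) \<Rightarrow> complex) \<Rightarrow> bool"
  where "lead_form n s d c f \<longleftrightarrow> low_form n s d (\<lambda>x. f x - c * x s ^ d)"

lemma low_form_form: "low_form n s d f \<Longrightarrow> form n d f"
  unfolding low_form_def form_def
  by (rule span_on_mono) (auto simp: low_expo_def finite_expo)

lemma low_form_mult: "low_form n s d f \<Longrightarrow> form n d' g \<Longrightarrow> low_form n s (d + d') (\<lambda>x. f x * g x)"
  unfolding low_form_def form_def
  by (rule span_on_mult) (auto simp: finite_low_expo, auto simp: low_expo_def expo_add)

lemma low_form_mult': "form n d g \<Longrightarrow> low_form n s d' f \<Longrightarrow> low_form n s (d + d') (\<lambda>x. g x * f x)"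
  using low_form_mult[of n s d' f d g] by (simp add: add.commute mult.commute)

lemma low_form_diff: "low_form n s d f \<Longrightarrow> low_form n s d g \<Longrightarrow> low_form n s d (\<lambda>x. f x - g x)"
  unfolding low_form_def by (rule span_on_diff)

lemma low_form_add: "low_form n s d f \<Longrightarrow> low_form n s d g \<Longrightarrow> low_form n s d (\<lambda>x. f x + g x)"
  unfolding low_form_def by (rule span_on_add)

lemma low_form_sum: "(\<And>i. i \<in> I \<Longrightarrow> low_form n s d (f i)) \<Longrightarrow> low_form n s d (\<lambda>x. \<Sum>i\<in>I. f i x)"
  unfolding low_form_def by (rule span_on_sum)

lemma low_form_scale: "low_form n s d f \<Longrightarrow> low_form n s d (\<lambda>x. c * f x)"
  unfolding low_form_def by (rule span_on_scale)

lemma low_form_zero: "low_form n s d (\<lambda>x. 0)"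
  unfolding low_form_def by (rule span_on_zero)

lemma low_form_coordinate: "a < s \<Longrightarrow> s \<le> n \<Longrightarrow> low_form n s 1 (\<lambda>x. x a)"
proof -
  assume "a < s" "s \<le> n"
  then have "unit_expo a 1 \<in> low_expo n s 1"
    using unit_expo_in_expo[of a n 1] by (auto simp: low_expo_def unit_expo_def)
  then have "span_on UNIV n (low_expo n s 1) (monom_eval n (unit_expo a 1))"
    by (intro span_on_monomial finite_low_expo)
  then show ?thesis unfolding low_form_def
    by (rule span_on_cong) (use \<open>a < s\<close> \<open>s \<le> n\<close> in \<open>simp add: monom_eval_unit_expo\<close>)
qed

lemma form_coordinate_power: "s \<le> n \<Longrightarrow> form n d (\<lambda>x. c * x s ^ d)"
  using form_scale[OF form_power[OF form_coordinate, of s n d], of c] by simp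

lemma lead_form_form: "s \<le> n \<Longrightarrow> lead_form n s d c f \<Longrightarrow> form n d f"
  using form_add[OF low_form_form form_coordinate_power[of s n d c], of s "\<lambda>x. f x - c * x s ^ d"]
  by (simp add: lead_form_def)

lemma lead_form_mult:
  assumes s: "s \<le> n" and f: "lead_form n s d c f" and g: "lead_form n s d' c' g"
  shows "lead_form n s (d + d') (c * c') (\<lambda>x. f x * g x)"
proof -
  have "low_form n s (d + d') (\<lambda>x. (f x - c * x s ^ d) * g x + c * x s ^ d * (g x - c' * x s ^ d'))"
    using f g lead_form_form[OF s g] unfolding lead_form_def
    by (intro low_form_add low_form_mult low_form_mult' form_coordinate_power s)
  then show ?thesis by (simp add: lead_form_def algebra_simps power_add)
qed

lemma lead_form_one: "lead_form n s 0 1 (\<lambda>x. 1)"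
  by (simp add: lead_form_def low_form_zero)

lemma lead_form_coordinate: "lead_form n s 1 1 (\<lambda>x. x s)"
  by (simp add: lead_form_def low_form_zero)

lemma lead_form_prod:
  assumes "s \<le> n" "finite R" "\<And>r. r \<in> R \<Longrightarrow> \<exists>d c. c \<noteq> 0 \<and> lead_form n s d c (F r)"
  shows "\<exists>d c. c \<noteq> 0 \<and> lead_form n s d c (\<lambda>x. \<Prod>r\<in>R. F r x)"
  using assms(2,3)
proof (induction R rule: finite_induct)
  case empty
  have "(1::complex) \<noteq> 0 \<and> lead_form n s 0 1 (\<lambda>x. \<Prod>r\<in>{}. F r x)" by (simp add: lead_form_one)
  then show ?case by blast
next
  case (insert r R)
  obtain d c where "c \<noteq> 0" "lead_form n s d c (F r)" using insert.prems by blast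
  moreover obtain d' c' where "c' \<noteq> 0" "lead_form n s d' c' (\<lambda>x. \<Prod>r\<in>R. F r x)"
    using insert.IH insert.prems by blast
  ultimately have "c * c' \<noteq> 0 \<and> lead_form n s (d + d') (c * c') (\<lambda>x. \<Prod>r\<in>insert r R. F r x)"
    using lead_form_mult[OF assms(1)] insert.hyps by simp
  then show ?case by blast
qed

lemma lead_form_nonzero:
  assumes "s \<le> n" "lead_form n s d c f" "c \<noteq> 0"
  shows "f (\<lambda>i. if i = s then 1 else 0) \<noteq> 0"
proof -
  let ?x = "\<lambda>i. if i = s then 1 else (0 :: complex)"
  obtain a where a: "\<And>x. f x - c * x s ^ d = (\<Sum>e\<in>low_expo n s d. a e * monom_eval n e x)"
    using assms(2) unfolding lead_form_def low_form_def span_on_def by blast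
  have "monom_eval n e ?x = 0" if "e \<in> low_expo n s d" for e
  proof -
    obtain b where "b < s" "e b > 0" using \<open>e \<in> low_expo n s d\<close> by (auto simp: low_expo_def)
    then show ?thesis unfolding monom_eval_def using assms(1) by (intro prod_zero) (auto intro!: bexI[of _ b])
  qed
  then have "(\<Sum>e\<in>low_expo n s d. a e * monom_eval n e ?x) = 0" by (intro sum.neutral) simp
  then show ?thesis using a[of ?x] assms(3) by simp
qed

text \<open>On the zero set the equation turns into a rule replacing x_s^d by monomials with a
  smaller variable, the input of the dimension bound.\<close>

lemma lead_form_relation:
  assumes "lead_form n s d c f" "c \<noteq> 0" "\<And>x. x \<in> K \<Longrightarrow> f x = 0"
  shows "span_on K n (low_expo n s d) (\<lambda>x. x s ^ d)"
proof -
  have "span_on UNIV n (low_expo n s d) (\<lambda>x. (- 1 / c) * (f x - c * x s ^ d))"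
    using assms(1) unfolding lead_form_def low_form_def by (rule span_on_scale)
  then have "span_on K n (low_expo n s d) (\<lambda>x. (- 1 / c) * (f x - c * x s ^ d))"
    by (rule span_on_subset) simp
  then show ?thesis by (rule span_on_cong) (use assms in simp)
qed

text \<open>Fraction-free Gaussian elimination; the form \<open>F\<close> is the product of the pivots.\<close>

lemma triangular_system:
  fixes M :: "int \<Rightarrow> int \<Rightarrow> (nat \<Rightarrow> complex) \<Rightarrow> complex"
  assumes "finite W" and s: "s \<le> n"
    and "\<And>i d. i \<in> W \<Longrightarrow> d \<in> W \<Longrightarrow> form n D (M i d)"
    and "\<And>i d. i \<in> W \<Longrightarrow> d \<in> W \<Longrightarrow> i < d \<Longrightarrow> low_form n s D (M i d)"
    and "\<And>i. i \<in> W \<Longrightarrow> c i \<noteq> 0 \<and> lead_form n s D (c i) (M i i)"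
  shows "\<exists>F. (\<exists>D' c'. c' \<noteq> 0 \<and> lead_form n s D' c' F) \<and>
    (\<forall>x. F x \<noteq> 0 \<longrightarrow> (\<forall>y. \<exists>g. \<forall>i\<in>W. (\<Sum>d\<in>W. M i d x * g d) = y i))"
  using assms(1,3-)
proof (induction W arbitrary: M D c rule: finite_linorder_min_induct)
  case empty
  have "(1::complex) \<noteq> 0 \<and> lead_form n s 0 1 (\<lambda>x. 1)" by (simp add: lead_form_one)
  then have "\<exists>D' c'. c' \<noteq> 0 \<and> lead_form n s D' c' (\<lambda>x. 1)" by blast
  then show ?case by (intro exI[of _ "\<lambda>x. 1"]) simp
next
  case (insert m A)
  \<comment> \<open>The Schur complement of the entry (m, m), cleared of denominators. As m is the
    least index, every M m d with d in A is a low form, so the subtracted product changes nothing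
    modulo the smaller variables and the triangular shape persists.\<close>
  define M' where "M' i d x = M m m x * M i d x - M i m x * M m d x" for i d x
  have mA: "m \<notin> A" using insert.hyps by auto
  have 1: "form n (D + D) (M' i d)" if "i \<in> A" "d \<in> A" for i d
    unfolding M'_def[abs_def] using that by (intro form_diff form_mult insert.prems(1)) auto
  have low: "low_form n s (D + D) (\<lambda>x. M i m x * M m d x)" if "i \<in> A" "d \<in> A" for i d
    using that insert.hyps by (intro low_form_mult' insert.prems(1,2)) auto
  have 2: "low_form n s (D + D) (M' i d)" if "i \<in> A" "d \<in> A" "i < d" for i d
    unfolding M'_def[abs_def] using that
    by (intro low_form_diff low low_form_mult' insert.prems(1,2)) auto
  have 3: "c m * c i \<noteq> 0 \<and> lead_form n s (D + D) (c m * c i) (M' i i)" if "i \<in> A" for i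
  proof
    have "lead_form n s (D + D) (c m * c i) (\<lambda>x. M m m x * M i i x)"
      using insert.prems(3)[of m] insert.prems(3)[of i] that by (intro lead_form_mult s) auto
    then have "low_form n s (D + D) (\<lambda>x. (M m m x * M i i x - c m * c i * x s ^ (D + D)) - M i m x * M m i x)"
      unfolding lead_form_def by (rule low_form_diff[OF _ low[OF that that]])
    then show "lead_form n s (D + D) (c m * c i) (M' i i)"
      by (simp add: lead_form_def M'_def algebra_simps)
    show "c m * c i \<noteq> 0" using insert.prems(3)[of m] insert.prems(3)[of i] that by simp
  qed
  obtain F D' c' where F: "c' \<noteq> 0" "lead_form n s D' c' F"
    "\<And>x y. F x \<noteq> 0 \<Longrightarrow> \<exists>g. \<forall>i\<in>A. (\<Sum>d\<in>A. M' i d x * g d) = y i"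
    using insert.IH[of "D + D" M' "\<lambda>i. c m * c i", OF 1 2 3] by blast
  show ?case
  proof (intro exI[of _ "\<lambda>x. M m m x * F x"] conjI allI impI)
    have "c m * c' \<noteq> 0 \<and> lead_form n s (D + D') (c m * c') (\<lambda>x. M m m x * F x)"
      using insert.prems(3)[of m] F by (simp add: lead_form_mult s)
    then show "\<exists>D' c'. c' \<noteq> 0 \<and> lead_form n s D' c' (\<lambda>x. M m m x * F x)" by blast
    fix x :: "nat \<Rightarrow> complex" and y :: "int \<Rightarrow> complex"
    assume "M m m x * F x \<noteq> 0"
    then have nz: "M m m x \<noteq> 0" "F x \<noteq> 0" by auto
    \<comment> \<open>The right-hand side undergoes the same row operation as the matrix; the
      remaining unknown is recovered from row m.\<close>
    obtain g where g: "\<And>i. i \<in> A \<Longrightarrow> (\<Sum>d\<in>A. M' i d x * g d) = M m m x * y i - M i m x * y m"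
      using F(3)[OF nz(2), of "\<lambda>i. M m m x * y i - M i m x * y m"] by blast
    define g' where "g' = g(m := (y m - (\<Sum>d\<in>A. M m d x * g d)) / M m m x)"
    have split: "(\<Sum>d\<in>insert m A. M i d x * g' d) = M i m x * g' m + (\<Sum>d\<in>A. M i d x * g d)" for i
    proof -
      have "(\<Sum>d\<in>A. M i d x * g' d) = (\<Sum>d\<in>A. M i d x * g d)"
        using mA by (intro sum.cong) (auto simp: g'_def)
      then show ?thesis using insert.hyps mA by simp
    qed
    show "\<exists>g. \<forall>i\<in>insert m A. (\<Sum>d\<in>insert m A. M i d x * g d) = y i"
    proof (intro exI[of _ g'] ballI)
      fix i assume i: "i \<in> insert m A"
      show "(\<Sum>d\<in>insert m A. M i d x * g' d) = y i"
      proof (cases "i = m")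
        case True
        then show ?thesis unfolding split using nz by (simp add: g'_def)
      next
        case False
        then have iA: "i \<in> A" using i by simp
        have "M m m x * y i - M i m x * y m =
            M m m x * (\<Sum>d\<in>A. M i d x * g d) - M i m x * (\<Sum>d\<in>A. M m d x * g d)"
          unfolding g[OF iA, symmetric] M'_def
          by (simp add: algebra_simps sum_subtractf sum_distrib_left)
        then show ?thesis unfolding split using nz by (simp add: g'_def field_simps)
      qed
    qed
  qed
qed

text \<open>Numbers the first order exponents from 0 in increasing order, so a smaller homogeneous
  coordinate belongs to a smaller power of z.\<close>

definition window_index :: "nat \<Rightarrow> nat \<Rightarrow> int \<Rightarrow> nat"
  where "window_index k j s = nat (s - (int k - int j + 1))"

definition leading :: "nat \<Rightarrow> nat \<Rightarrow> (nat \<times> int \<Rightarrow> complex) \<Rightarrow> nat \<Rightarrow> complex"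
  where "leading k j p = (\<lambda>i\<in>{..2 * j - k - 2}. p (1, int i + (int k - int j + 1)))"

lemma window_index_le: "s \<in> window k j 1 \<Longrightarrow> window_index k j s \<le> 2 * j - k - 2"
  by (auto simp: window_index_def window_def)

lemma leading_window_index: "s \<in> window k j 1 \<Longrightarrow> leading k j p (window_index k j s) = p (1, s)"
  using window_index_le[of s k j] by (simp add: leading_def window_index_def window_def)

lemma window_index_less_iff:
  "s \<in> window k j 1 \<Longrightarrow> t \<in> window k j 1 \<Longrightarrow> window_index k j s < window_index k j t \<longleftrightarrow> s < t"
  by (auto simp: window_index_def window_def)

section \<open>Solvability of the quadratic systems\<close>

lemma shift_form_cong:
  "(\<And>i. i \<in> window k j 1 \<Longrightarrow> x i = y i) \<Longrightarrow> shift_form k j t s x = shift_form k j t s y"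
  unfolding shift_form_def by (intro sum.cong refl) auto

text \<open>With t = d - 2 s + j the entry (i, d) sums \<plusminus>x_a x_b over a + b = 2 s + i - d.
  If i < d, one of a, b is below s; if i = d, this holds except for a = b = s, whose sign is
  \<open>pm_sign (d - s)\<close>. So modulo the variables before x_s the matrix is triangular with
  diagonal \<plusminus>x_s^2.\<close>

lemma shift_form_system:
  fixes s :: int
  assumes s: "s \<in> window k j 1" and "finite W"
  defines "n \<equiv> 2 * j - k - 2"
  shows "\<exists>F. (\<exists>D c. c \<noteq> 0 \<and> lead_form n (window_index k j s) D c F) \<and>
    (\<forall>x. F x \<noteq> 0 \<longrightarrow> (\<forall>y. \<exists>g. \<forall>i\<in>W.
      (\<Sum>d\<in>W. shift_form k j (d - 2 * s + int j) i (\<lambda>a. x (window_index k j a)) * g d) = y i))"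
proof (rule triangular_system[OF assms(2), where D = 2 and c = "\<lambda>d. pm_sign (d - s)"])
  let ?w = "window_index k j" and ?W = "window k j 1"
  let ?T = "\<lambda>i d a b x. if a + b + (d - 2 * s + int j) - int j = i
    then pm_sign (b + (d - 2 * s + int j) - int j) * x (?w a) * x (?w b) else (0::complex)"
  show sn: "?w s \<le> n" unfolding n_def by (rule window_index_le[OF s])
  have c: "form n 1 (\<lambda>x. x (?w a))" if "a \<in> ?W" for a
    unfolding n_def by (rule form_coordinate[OF window_index_le[OF that]])
  have form: "form n 2 (?T i d a b)" if "a \<in> ?W" "b \<in> ?W" for i d a b
  proof (cases "a + b + (d - 2 * s + int j) - int j = i")
    case True
    then show ?thesis using form_scale[OF form_mult[OF c[OF that(1)] c[OF that(2)]]]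
      by (simp add: mult.assoc numeral_2_eq_2)
  next
    case False
    then show ?thesis using low_form_form[OF low_form_zero] by simp
  qed
  have low: "low_form n (?w s) 2 (\<lambda>x. e * x (?w a) * x (?w b))"
    if ab: "a \<in> ?W" "b \<in> ?W" "a < s \<or> b < s" for a b e
    using ab(3)
  proof
    assume "a < s"
    then have "?w a < ?w s" using window_index_less_iff ab(1) s by blast
    from low_form_scale[OF low_form_mult[OF low_form_coordinate[OF this sn] c[OF ab(2)]]]
    show ?thesis by (simp add: mult.assoc numeral_2_eq_2)
  next
    assume "b < s"
    then have "?w b < ?w s" using window_index_less_iff ab(2) s by blast
    from low_form_scale[OF low_form_mult'[OF c[OF ab(1)] low_form_coordinate[OF this sn]]]
    show ?thesis by (simp add: mult.assoc numeral_2_eq_2)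
  qed
  have M: "(\<lambda>x. shift_form k j (d - 2 * s + int j) i (\<lambda>a. x (?w a))) =
      (\<lambda>x. \<Sum>a\<in>?W. \<Sum>b\<in>?W. ?T i d a b x)" for i d
    unfolding shift_form_def ..
  show "form n 2 (\<lambda>x. shift_form k j (d - 2 * s + int j) i (\<lambda>a. x (?w a)))" for i d
    unfolding M by (intro form_sum form)
  show "low_form n (?w s) 2 (\<lambda>x. shift_form k j (d - 2 * s + int j) i (\<lambda>a. x (?w a)))" if "i < d" for i d
    unfolding M
  proof (intro low_form_sum)
    fix a b assume ab: "a \<in> ?W" "b \<in> ?W"
    show "low_form n (?w s) 2 (?T i d a b)"
    proof (cases "a + b + (d - 2 * s + int j) - int j = i")
      case True
      then have "a < s \<or> b < s" using that by linarith
      from low[OF ab this] show ?thesis using True by simp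
    qed (simp add: low_form_zero)
  qed
  show "pm_sign (d - s) \<noteq> 0 \<and>
      lead_form n (?w s) 2 (pm_sign (d - s)) (\<lambda>x. shift_form k j (d - 2 * s + int j) d (\<lambda>a. x (?w a)))" for d
  proof
    show "pm_sign (d - s) \<noteq> 0" by (simp add: pm_sign_def)
    have fin: "finite ?W" by (simp add: window_def)
    have "pm_sign (d - s) * x (?w s) ^ 2 =
        (\<Sum>a\<in>?W. \<Sum>b\<in>?W. if a = s \<and> b = s then pm_sign (d - s) * x (?w s) ^ 2 else 0)" for x :: "nat \<Rightarrow> complex"
    proof -
      have "(\<Sum>a\<in>?W. \<Sum>b\<in>?W. if a = s \<and> b = s then pm_sign (d - s) * x (?w s) ^ 2 else 0) =
        (\<Sum>a\<in>?W. if a = s then pm_sign (d - s) * x (?w s) ^ 2 else 0)"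
        using s fin by (intro sum.cong) auto
      then show ?thesis using s fin by simp
    qed
    then have eq: "(\<lambda>x. shift_form k j (d - 2 * s + int j) d (\<lambda>a. x (?w a)) - pm_sign (d - s) * x (?w s) ^ 2) =
        (\<lambda>x. \<Sum>a\<in>?W. \<Sum>b\<in>?W. ?T d d a b x -
           (if a = s \<and> b = s then pm_sign (d - s) * x (?w s) ^ 2 else 0))"
      unfolding shift_form_def by (simp add: sum_subtractf)
    show "lead_form n (?w s) 2 (pm_sign (d - s))
        (\<lambda>x. shift_form k j (d - 2 * s + int j) d (\<lambda>a. x (?w a)))"
      unfolding lead_form_def eq
    proof (intro low_form_sum)
      fix a b assume ab: "a \<in> ?W" "b \<in> ?W"
      show "low_form n (?w s) 2 (\<lambda>x. ?T d d a b x -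
           (if a = s \<and> b = s then pm_sign (d - s) * x (?w s) ^ 2 else 0))"
      proof (cases "a + b = 2 * s \<and> a \<noteq> s")
        case True
        then have "a < s \<or> b < s" by linarith
        from low[OF ab this] show ?thesis using True by simp
      next
        case False
        then have "(\<lambda>x. ?T d d a b x - (if a = s \<and> b = s then pm_sign (d - s) * x (?w s) ^ 2 else 0)) =
            (\<lambda>x. 0)"
          by (intro ext) (auto simp: power2_eq_square)
        then show ?thesis by (simp only: low_form_zero)
      qed
    qed
  qed
qed

text \<open>One form for each order r \<ge> 2 certifies solvability at that order; the product
  certifies all of them and is still a pure power of x_s modulo the variables before it.\<close>

lemma good_form_exists:
  fixes s :: int
  assumes "k \<ge> 1" "j \<ge> k + 1" "0 \<le> s" "s \<le> int k"
  defines "n \<equiv> 2 * j - k - 2"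
  obtains F D c where "c \<noteq> 0" "lead_form n (window_index k j s) D c F"
    "\<And>x. F x \<noteq> 0 \<Longrightarrow> \<exists>i\<le>n. x i \<noteq> 0"
    "\<And>p. F (leading k j p) \<noteq> 0 \<Longrightarrow>
       bundle_iso k (transition k j p) (transition k j (\<lambda>(r, s). if r = 1 then p (r, s) else 0))"
proof -
  let ?w = "window_index k j" and ?R = "{2..(2 * j - 2) div k}"
  have s: "s \<in> window k j 1" using assms by (auto simp: window_def)
  have sn: "?w s \<le> n" unfolding n_def by (rule window_index_le[OF s])
  define solvable where "solvable r x \<longleftrightarrow> (\<forall>y. \<exists>g. \<forall>i\<in>window k j r.
      (\<Sum>d\<in>window k j r. shift_form k j (d - 2 * s + int j) i (\<lambda>a. x (?w a)) * g d) = y i)" for r x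
  have "\<exists>F. (\<exists>D c. c \<noteq> 0 \<and> lead_form n (?w s) D c F) \<and> (\<forall>x. F x \<noteq> 0 \<longrightarrow> solvable r x)" for r
    unfolding n_def solvable_def by (rule shift_form_system[OF s]) (simp add: window_def)
  then have "\<forall>r. \<exists>F. (\<exists>D c. c \<noteq> 0 \<and> lead_form n (?w s) D c F) \<and> (\<forall>x. F x \<noteq> 0 \<longrightarrow> solvable r x)" ..
  from choice[OF this] obtain G where G: "\<And>r. \<exists>D c. c \<noteq> 0 \<and> lead_form n (?w s) D c (G r)"
    "\<And>r x. G r x \<noteq> 0 \<Longrightarrow> solvable r x" by blast
  obtain D c where D: "c \<noteq> 0" "lead_form n (?w s) D c (\<lambda>x. \<Prod>r\<in>?R. G r x)"
    using lead_form_prod[OF sn, of ?R G, OF _ G(1)] by auto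
  show ?thesis
  \<comment> \<open>The extra factor x_s ensures a nonzero vector even when no order r \<ge> 2
    occurs and the product is empty.\<close>
  proof (rule that[of "1 * c" "1 + D" "\<lambda>x. x (?w s) * (\<Prod>r\<in>?R. G r x)"])
    show "1 * c \<noteq> 0" using D by simp
    show "lead_form n (?w s) (1 + D) (1 * c) (\<lambda>x. x (?w s) * (\<Prod>r\<in>?R. G r x))"
      by (intro lead_form_mult sn lead_form_coordinate D)
    show "\<exists>i\<le>n. x i \<noteq> 0" if "x (?w s) * (\<Prod>r\<in>?R. G r x) \<noteq> 0" for x
      using that sn by auto
    fix p assume nz: "leading k j p (?w s) * (\<Prod>r\<in>?R. G r (leading k j p)) \<noteq> 0"
    show "bundle_iso k (transition k j p) (transition k j (\<lambda>(r, s). if r = 1 then p (r, s) else 0))"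
    proof (rule bundle_iso_leading_part[OF assms(1), of j "\<lambda>d. d - 2 * s + int j"])
      fix r d assume r: "2 \<le> r" "r \<le> (2 * j - 2) div k" and d: "d \<in> window k j r"
      \<comment> \<open>On the window, t lies between k r + 1 - 2 s and 2 j - 1 - 2 s: s \<le> k and
        r \<ge> 2 give the lower bound, s \<ge> 0 the upper one.\<close>
      have "int k * 2 \<le> int k * int r" using r by (intro mult_left_mono) auto
      then show "0 \<le> d - 2 * s + int j \<and> d - 2 * s + int j \<le> 2 * int j + int k * (int r - 2)"
        using d assms(3,4) by (auto simp: window_def algebra_simps)
    next
      fix r y assume r: "2 \<le> r" "r \<le> (2 * j - 2) div k"
      then have "G r (leading k j p) \<noteq> 0" using nz by auto
      have eq: "shift_form k j t i (\<lambda>a. leading k j p (?w a)) = shift_form k j t i (\<lambda>a. p (1, a))" for t i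
        by (rule shift_form_cong) (rule leading_window_index)
      from G(2)[OF \<open>G r (leading k j p) \<noteq> 0\<close>, unfolded solvable_def, rule_format, of y]
      show "\<exists>g. \<forall>s'\<in>window k j r.
          (\<Sum>d\<in>window k j r. shift_form k j (d - 2 * s + int j) s' (\<lambda>i. p (1, i)) * g d) = y s'"
        unfolding eq .
    qed
  qed
qed

section \<open>The open part of the moduli space\<close>

lemma form_restrict: "form n d f \<Longrightarrow> f (restrict x {..n}) = f x"
  using form_restrict_scale[of n d f 1 x] by simp

lemma form_continuous:
  assumes "form n d f" and x: "\<And>i. i \<le> n \<Longrightarrow> continuous_map X euclidean (\<lambda>t. x t i)"
  shows "continuous_map X euclidean (\<lambda>t. f (x t))"
proof -
  obtain a where a: "\<And>x. f x = (\<Sum>e\<in>expo n d. a e * monom_eval n e x)"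
    using assms(1) unfolding form_def span_on_def by blast
  show ?thesis
    unfolding continuous_map_atin limitin_canonical_iff a monom_eval_def
    using x unfolding continuous_map_atin limitin_canonical_iff
    by (auto intro!: tendsto_intros)
qed

text \<open>For density: a form that is nonzero somewhere on a line vanishes at only finitely many
  parameters.\<close>

lemma form_along_line:
  assumes "form n d f"
  obtains q where "\<And>t. f (\<lambda>i. u i + t * v i) = poly q t"
proof -
  obtain a where a: "\<And>x. f x = (\<Sum>e\<in>expo n d. a e * monom_eval n e x)"
    using assms unfolding form_def span_on_def by blast
  show ?thesis
  proof (rule that)
    show "f (\<lambda>i. u i + t * v i) = poly (\<Sum>e\<in>expo n d. smult (a e) (\<Prod>i\<le>n. [:u i, v i:] ^ e i)) t" for t
      by (simp add: a monom_eval_def poly_sum poly_prod)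
  qed
qed

lemma topspace_coeff_space: "topspace (coeff_space k j) = extensional (coeff_index k j)"
  by (auto simp: coeff_space_def PiE_def)

lemma coordinate_continuous:
  "a \<in> coeff_index k j \<Longrightarrow> continuous_map (coeff_space k j) euclidean (\<lambda>p. p a)"
  unfolding coeff_space_def by (rule continuous_map_product_projection)

lemma transition_cong:
  assumes "\<And>a. a \<in> coeff_index k j \<Longrightarrow> p a = p' a"
  shows "transition k j p = transition k j p'"
proof -
  have "laurent_of k j p = laurent_of k j p'"
    unfolding laurent_of_def using assms by (intro sum.cong) auto
  then show ?thesis by (simp add: transition_eq_laurent)
qed

lemma bundle_iso_scale:
  assumes "c \<noteq> 0"
  shows "bundle_iso k (transition k j p) (transition k j (\<lambda>a. c * p a))"
proof -
  let ?A = "\<lambda>x :: complex \<times> complex. mat2 c 0 0 1"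
  have "ext_poly k j (\<lambda>a. c * p a) x = c * ext_poly k j p x" for x
    by (simp add: ext_poly_def sum_distrib_left mult_ac)
  then have "?A (to_V k x) ** transition k j p x = transition k j (\<lambda>a. c * p a) x ** ?A x" for x
    by (simp add: transition_def mat2_mult mult.commute)
  moreover have "holomorphic_GL2_on ?A UNIV"
    using assms
    by (auto simp: holomorphic_GL2_on_def forall_2 invertible_det_nz det_mat2)
  ultimately show ?thesis unfolding bundle_iso_def by blast
qed

definition first_order :: "nat \<Rightarrow> nat \<Rightarrow> (nat \<Rightarrow> complex) \<Rightarrow> nat \<times> int \<Rightarrow> complex"
  where "first_order k j x = (\<lambda>a\<in>coeff_index k j. if fst a = 1 then x (window_index k j (snd a)) else 0)"

lemma window_index_inverse:
  assumes "k \<le> 2 * j - 2" "j \<ge> 1" "i \<le> 2 * j - k - 2"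
  shows "int i + (int k - int j + 1) \<in> window k j 1"
    "window_index k j (int i + (int k - int j + 1)) = i"
  using assms by (auto simp: window_def window_index_def)

lemma first_order_window:
  "1 \<le> (2 * j - 2) div k \<Longrightarrow> s \<in> window k j 1 \<Longrightarrow> first_order k j x (1, s) = x (window_index k j s)"
  by (simp add: first_order_def coeff_index_iff)

text \<open>The projection to the first order coefficients and the section \<open>first_order\<close> induce mutually
  inverse homeomorphisms.\<close>

lemma moduli_open_part:
  fixes k j :: nat and F :: "((nat \<Rightarrow> complex) \<Rightarrow> complex) set"
  defines "n \<equiv> 2 * j - k - 2"
  assumes k: "k \<ge> 1" and jk: "j \<ge> k" and N: "1 \<le> (2 * j - 2) div k"
    and F: "F \<subseteq> forms n" and ex: "\<exists>f\<in>F. \<exists>x. f x \<noteq> 0"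
    and pts: "\<And>f x. f \<in> F \<Longrightarrow> f x \<noteq> 0 \<Longrightarrow> \<exists>i\<le>n. x i \<noteq> 0"
    and iso: "\<And>f p. f \<in> F \<Longrightarrow> f (leading k j p) \<noteq> 0 \<Longrightarrow>
       bundle_iso k (transition k j p) (transition k j (\<lambda>(r, s). if r = 1 then p (r, s) else 0))"
  shows "\<exists>S. openin (moduli k j) S \<and> (moduli k j) closure_of S = topspace (moduli k j) \<and>
    subtopology (moduli k j) S homeomorphic_space
      subtopology (proj_space n) (topspace (proj_space n) - zero_locus n F)"
proof -
  have j1: "j \<ge> 1" using k jk by simp
  have kj: "k \<le> 2 * j - 2"
  proof -
    have "k * 1 \<le> k * ((2 * j - 2) div k)" using N by (rule mult_left_mono) simp
    also have "\<dots> \<le> 2 * j - 2" by simp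
    finally show ?thesis by simp
  qed
  define C where "C = coeff_space k j"
  define M where "M = moduli k j"
  define P where "P = proj_space n"
  define X where "X = zero_locus n F"
  define q where "q p = bundle_class k (transition k j p)" for p
  define \<sigma> where "\<sigma> = first_order k j"
  define ld where "ld = leading k j"
  define G where "G = {p \<in> topspace C. \<exists>f\<in>F. f (ld p) \<noteq> 0}"
  define S where "S = q ` G"
  have tC: "topspace C = extensional (coeff_index k j)" unfolding C_def by (rule topspace_coeff_space)
  have qM: "quotient_map C M q"
    unfolding M_def C_def moduli_def q_def by (rule quotient_map_quotient_topology)
  have qP: "quotient_map (punctured_space n) P (line_through n)"
    unfolding P_def proj_space_def by (rule quotient_map_quotient_topology)
  have q_eq: "q p = q p' \<longleftrightarrow> bundle_iso k (transition k j p) (transition k j p')" for p p'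
    unfolding q_def by (rule bundle_class_eq_iff)
  have ld_ext: "ld p \<in> extensional {..n}" for p by (simp add: ld_def leading_def n_def)
  have ld_pts: "ld p \<in> pts n" if "f \<in> F" "f (ld p) \<noteq> 0" for f p
    using pts[OF that] ld_ext by (auto simp: pts_def)
  have ld_iso: "\<exists>c. c \<noteq> 0 \<and> ld p' = (\<lambda>i\<in>{..n}. c * ld p i)" if eq: "q p = q p'" for p p'
  proof -
    obtain c where "c \<noteq> 0" and c: "\<And>s. s \<in> window k j 1 \<Longrightarrow> p' (1, s) = c * p (1, s)"
      using bundle_iso_leading[OF k jk N] eq unfolding q_eq by blast
    have "ld p' = (\<lambda>i\<in>{..n}. c * ld p i)"
      using c window_index_inverse(1)[OF kj j1]
      by (auto simp: ld_def leading_def n_def restrict_def)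
    with \<open>c \<noteq> 0\<close> show ?thesis by blast
  qed
  have F_scale: "f (\<lambda>i\<in>{..n}. c * x i) \<noteq> 0 \<longleftrightarrow> f x \<noteq> 0" if "f \<in> F" "c \<noteq> 0" for f c x
  proof -
    obtain d where "form n d f" using \<open>f \<in> F\<close> F unfolding forms_def by blast
    from form_restrict_scale[OF this, of c x] show ?thesis using \<open>c \<noteq> 0\<close> by simp
  qed
  \<comment> \<open>Saturation: isomorphic bundles have proportional leading parts, and nonvanishing
    of a form is unaffected by scaling.\<close>
  have sat: "{p \<in> topspace C. q p \<in> S} = G"
  proof
    show "{p \<in> topspace C. q p \<in> S} \<subseteq> G"
    proof
      fix p assume "p \<in> {p \<in> topspace C. q p \<in> S}"
      then obtain p' where p: "p \<in> topspace C" and p': "p' \<in> G" "q p' = q p" by (auto simp: S_def)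
      from ld_iso[OF p'(2)] obtain c where "c \<noteq> 0" "ld p = (\<lambda>i\<in>{..n}. c * ld p' i)" by blast
      moreover obtain f where "f \<in> F" "f (ld p') \<noteq> 0" using p'(1) by (auto simp: G_def)
      ultimately show "p \<in> G" using F_scale p by (auto simp: G_def)
    qed
  qed (auto simp: S_def G_def)
  have ld_cont: "continuous_map C euclidean (\<lambda>p. ld p i)" if "i \<le> n" for i
  proof -
    have "(1, int i + (int k - int j + 1)) \<in> coeff_index k j"
      using window_index_inverse(1)[OF kj j1, of i] that N by (simp add: coeff_index_iff n_def)
    from coordinate_continuous[OF this] show ?thesis
      using that unfolding C_def ld_def leading_def n_def by simp
  qed
  have f_cont: "continuous_map C euclidean (\<lambda>p. f (ld p))" if "f \<in> F" for f
  proof -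
    obtain d where "form n d f" using \<open>f \<in> F\<close> F unfolding forms_def by blast
    then show ?thesis using ld_cont by (rule form_continuous)
  qed
  have G_open: "openin C G"
  proof -
    have "openin C {p \<in> topspace C. f (ld p) \<in> - {0}}" if "f \<in> F" for f
      using f_cont[OF that] by (rule openin_continuous_map_preimage) auto
    then have "openin C (\<Union>f\<in>F. {p \<in> topspace C. f (ld p) \<in> - {0}})" by blast
    also have "(\<Union>f\<in>F. {p \<in> topspace C. f (ld p) \<in> - {0}}) = G" by (auto simp: G_def)
    finally show ?thesis .
  qed
  have S_sub: "S \<subseteq> topspace M"
    unfolding S_def using quotient_imp_surjective_map[OF qM] by (auto simp: G_def)
  have S_open: "openin M S"
    using qM S_sub G_open sat unfolding quotient_map_def by blast
  have \<sigma>_C: "\<sigma> x \<in> topspace C" for x by (simp add: tC \<sigma>_def first_order_def)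
  have ld_\<sigma>: "ld (\<sigma> x) = restrict x {..n}" for x
  proof
    fix i
    show "ld (\<sigma> x) i = restrict x {..n} i"
    proof (cases "i \<le> n")
      case True
      then have "i \<le> 2 * j - k - 2" by (simp add: n_def)
      note w = window_index_inverse[OF kj j1 this]
      have "ld (\<sigma> x) i = \<sigma> x (1, int i + (int k - int j + 1))"
        using True by (simp add: ld_def leading_def n_def)
      also have "\<dots> = x i" unfolding \<sigma>_def first_order_window[OF N w(1)] w(2) ..
      finally show ?thesis using True by simp
    next
      case False
      then show ?thesis by (simp add: ld_def leading_def n_def)
    qed
  qed
  have q_\<sigma>: "q (\<sigma> (ld p)) = q p" if "f \<in> F" "f (ld p) \<noteq> 0" for f p
  proof -
    have "transition k j (\<sigma> (ld p)) = transition k j (\<lambda>(r, s). if r = 1 then p (r, s) else 0)"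
    proof (rule transition_cong)
      fix a assume a: "a \<in> coeff_index k j"
      obtain r s where rs: "a = (r, s)" by (cases a)
      show "\<sigma> (ld p) a = (case a of (r, s) \<Rightarrow> if r = 1 then p (r, s) else 0)"
      proof (cases "r = 1")
        case True
        then have "s \<in> window k j 1" using a unfolding rs coeff_index_iff by blast
        from leading_window_index[OF this] show ?thesis
          using a True by (simp add: rs \<sigma>_def first_order_def ld_def)
      next
        case False
        then show ?thesis using a by (simp add: rs \<sigma>_def first_order_def)
      qed
    qed
    moreover have "bundle_iso k (transition k j p) (transition k j (\<lambda>(r, s). if r = 1 then p (r, s) else 0))"
      by (rule iso[OF that[unfolded ld_def]])
    ultimately have "bundle_iso k (transition k j p) (transition k j (\<sigma> (ld p)))" by (simp only:)
    then show ?thesis unfolding q_eq by (rule bundle_iso_sym)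
  qed
  have closure: "M closure_of S = topspace M"
  proof (rule equalityI[OF closure_of_subset_topspace subsetI])
    fix y assume y: "y \<in> topspace M"
    then have "y \<in> q ` topspace C" using quotient_imp_surjective_map[OF qM] by simp
    then obtain p where p: "p \<in> topspace C" "q p = y" by blast
    show "y \<in> M closure_of S" unfolding in_closure_of
    proof (intro conjI allI impI y)
      fix T assume T: "y \<in> T \<and> openin M T"
      define U where "U = {p \<in> topspace C. q p \<in> T}"
      have U: "openin C U" unfolding U_def
        by (rule openin_continuous_map_preimage[OF quotient_imp_continuous_map[OF qM]]) (use T in simp)
      obtain f x where f: "f \<in> F" "f x \<noteq> 0" using ex by blast
      obtain d where d: "form n d f" using f(1) F unfolding forms_def by blast
      \<comment> \<open>The complex line through p at t = 0 and \<sigma> x at t = 1. Its parameters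
        in the open preimage U form a nonempty open, hence infinite, set, while f vanishes at only
        finitely many of them, being nonzero at t = 1.\<close>
      define \<gamma> where "\<gamma> t = (\<lambda>a\<in>coeff_index k j. p a + t * (\<sigma> x a - p a))" for t
      have "continuous_map euclidean C \<gamma>"
        unfolding C_def coeff_space_def continuous_map_componentwise \<gamma>_def
        by (auto intro!: continuous_intros simp: continuous_map_iff_continuous2)
      from openin_continuous_map_preimage[OF this U] have "open {t. \<gamma> t \<in> U}" by simp
      moreover have "\<gamma> 0 = p"
        using p(1) by (auto simp: \<gamma>_def tC extensional_def fun_eq_iff)
      then have "0 \<in> {t. \<gamma> t \<in> U}" using p T by (simp add: U_def)
      ultimately have inf: "infinite {t. \<gamma> t \<in> U}" using finite_imp_not_open by blast
      obtain h where h: "\<And>t. f (\<lambda>i. ld p i + t * (ld (\<sigma> x) i - ld p i)) = poly h t"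
        using form_along_line[OF d, of "ld p" "\<lambda>i. ld (\<sigma> x) i - ld p i"] by blast
      have ldg: "f (ld (\<gamma> t)) = poly h t" for t
      proof -
        have "ld (\<gamma> t) i = ld p i + t * (ld (\<sigma> x) i - ld p i)" if "i \<le> n" for i
          using window_index_inverse(1)[OF kj j1, of i] that N
          by (simp add: ld_def leading_def n_def \<gamma>_def coeff_index_iff)
        then have "restrict (ld (\<gamma> t)) {..n} = restrict (\<lambda>i. ld p i + t * (ld (\<sigma> x) i - ld p i)) {..n}"
          by (auto simp: restrict_def)
        then show ?thesis using form_restrict[OF d] h by metis
      qed
      have "\<gamma> 1 = \<sigma> x"
        using \<sigma>_C[of x] by (auto simp: \<gamma>_def tC extensional_def fun_eq_iff)
      then have "poly h 1 \<noteq> 0" using ldg[of 1] f form_restrict[OF d, of x] by (simp add: ld_\<sigma>)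
      then have "finite {t. poly h t = 0}" by (intro poly_roots_finite) auto
      then have "\<not> {t. \<gamma> t \<in> U} \<subseteq> {t. poly h t = 0}" using inf finite_subset by blast
      then obtain t where t: "\<gamma> t \<in> U" "f (ld (\<gamma> t)) \<noteq> 0" using ldg by auto
      then have "\<gamma> t \<in> G" using f(1) by (auto simp: G_def U_def)
      then show "\<exists>z. z \<in> S \<and> z \<in> T" using t by (auto simp: S_def U_def)
    qed
  qed
  have X_iff: "line_through n x \<in> topspace P - X \<longleftrightarrow> (\<exists>f\<in>F. f x \<noteq> 0)" if "x \<in> pts n" for x
  proof -
    have "line_through n x \<in> topspace P"
      using quotient_imp_surjective_map[OF qP] that by (auto simp: topspace_punctured)
    moreover have "line_through n x \<in> X \<longleftrightarrow> x \<in> cone n X" using that by (simp add: cone_def)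
    ultimately show ?thesis using cone_zero_locus[OF F] that by (auto simp: X_def)
  qed
  \<comment> \<open>Restricted to a saturated open set the projection is again a quotient map, so
    continuous maps out of S can be defined on G.\<close>
  have quoG: "quotient_map (subtopology C G) (subtopology M S) q"
    by (rule quotient_map_restriction[OF qM sat]) (simp add: S_open)
  have topG: "topspace (subtopology C G) = G" by (auto simp: G_def)
  have ldP: "continuous_map (subtopology C G) (subtopology P (topspace P - X)) (\<lambda>p. line_through n (ld p))"
  proof (rule continuous_map_into_subtopology)
    have "continuous_map (subtopology C G) (punctured_space n) ld"
      unfolding punctured_space_def
    proof (rule continuous_map_into_subtopology)
      show "continuous_map (subtopology C G) (product_topology (\<lambda>_. euclidean) {..n}) ld"
        unfolding continuous_map_componentwise
        using ld_ext by (auto intro!: continuous_map_from_subtopology ld_cont)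
      show "ld \<in> topspace (subtopology C G) \<rightarrow> {x. \<exists>i\<le>n. x i \<noteq> 0}"
        using ld_pts unfolding topG by (auto simp: G_def pts_def)
    qed
    from continuous_map_compose[OF this quotient_imp_continuous_map[OF qP]]
    show "continuous_map (subtopology C G) P (\<lambda>p. line_through n (ld p))" by (simp add: o_def)
    show "(\<lambda>p. line_through n (ld p)) \<in> topspace (subtopology C G) \<rightarrow> topspace P - X"
      unfolding topG using X_iff ld_pts by (auto simp: G_def)
  qed
  have "line_through n (ld p) = line_through n (ld p')" if "p \<in> G" "p' \<in> G" "q p = q p'" for p p'
  proof -
    have "ld p \<in> pts n" "ld p' \<in> pts n" using that ld_pts by (auto simp: G_def)
    then show ?thesis using line_through_eq_iff ld_iso[OF that(3)] by blast
  qed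
  with quotient_map_lift_exists[OF quoG ldP] obtain \<alpha> where
    \<alpha>: "continuous_map (subtopology M S) (subtopology P (topspace P - X)) \<alpha>"
      "\<And>p. p \<in> G \<Longrightarrow> \<alpha> (q p) = line_through n (ld p)" unfolding topG by metis
  have "continuous_map (punctured_space n) C \<sigma>"
    unfolding C_def coeff_space_def continuous_map_componentwise
  proof (intro conjI ballI)
    fix a assume a: "a \<in> coeff_index k j"
    show "continuous_map (punctured_space n) euclidean (\<lambda>x. \<sigma> x a)"
    proof (cases "fst a = 1")
      case True
      then have "snd a \<in> window k j 1" using a by (cases a) (auto simp: coeff_index_iff)
      then have "window_index k j (snd a) \<in> {..n}" using window_index_le by (simp add: n_def)
      then show ?thesis using a True unfolding \<sigma>_def first_order_def punctured_space_def
        by (auto intro!: continuous_map_from_subtopology continuous_map_product_projection)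
    next
      case False
      then show ?thesis using a by (simp add: \<sigma>_def first_order_def)
    qed
  qed (auto simp: \<sigma>_def first_order_def)
  from continuous_map_compose[OF this quotient_imp_continuous_map[OF qM]]
  have q\<sigma>: "continuous_map (punctured_space n) M (\<lambda>x. q (\<sigma> x))" by (simp add: o_def)
  have "q (\<sigma> x) = q (\<sigma> y)" if xy: "x \<in> pts n" "y \<in> pts n" "line_through n x = line_through n y" for x y
  proof -
    obtain c where c: "c \<noteq> 0" "y = (\<lambda>i\<in>{..n}. c * x i)"
      using xy(3) line_through_eq_iff[OF xy(1,2)] by blast
    have "transition k j (\<sigma> y) = transition k j (\<lambda>a. c * \<sigma> x a)"
    proof (rule transition_cong)
      fix a assume a: "a \<in> coeff_index k j"
      show "\<sigma> y a = c * \<sigma> x a"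
        using a window_index_le[of "snd a" k j]
        by (cases a) (auto simp: \<sigma>_def first_order_def c(2) n_def coeff_index_iff)
    qed
    then show ?thesis unfolding q_eq using bundle_iso_scale[OF c(1)] by simp
  qed
  \<comment> \<open>Rescaling x rescales \<sigma> x, which gives an isomorphic bundle. So this map
    descends to all of projective space and is restricted afterwards.\<close>
  with quotient_map_lift_exists[OF qP q\<sigma>] obtain \<beta> where
    \<beta>: "continuous_map P M \<beta>" "\<And>x. x \<in> pts n \<Longrightarrow> \<beta> (line_through n x) = q (\<sigma> x)"
    unfolding topspace_punctured by metis
  have PX: "\<exists>x. x \<in> pts n \<and> y = line_through n x \<and> \<sigma> x \<in> G" if y: "y \<in> topspace P - X" for y
  proof -
    have "y \<in> line_through n ` pts n"
      using y quotient_imp_surjective_map[OF qP] by (simp add: topspace_punctured)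
    then obtain x where x: "x \<in> pts n" "y = line_through n x" by blast
    then obtain f where f: "f \<in> F" "f x \<noteq> 0" using X_iff y by blast
    then obtain d where "form n d f" using F unfolding forms_def by blast
    from form_restrict[OF this, of x] have "f (ld (\<sigma> x)) \<noteq> 0" using f by (simp add: ld_\<sigma>)
    then show ?thesis using x f \<sigma>_C by (auto simp: G_def)
  qed
  have "homeomorphic_maps (subtopology M S) (subtopology P (topspace P - X)) \<alpha> \<beta>"
    unfolding homeomorphic_maps_def
  proof (intro conjI ballI \<alpha>(1))
    show "continuous_map (subtopology P (topspace P - X)) (subtopology M S) \<beta>"
    proof (rule continuous_map_into_subtopology)
      show "continuous_map (subtopology P (topspace P - X)) M \<beta>"
        using \<beta>(1) by (rule continuous_map_from_subtopology)
      show "\<beta> \<in> topspace (subtopology P (topspace P - X)) \<rightarrow> S"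
        using PX \<beta>(2) by (force simp: S_def)
    qed
    fix y assume "y \<in> topspace (subtopology M S)"
    then obtain p where p: "p \<in> G" "y = q p" by (auto simp: S_def)
    then obtain f where f: "f \<in> F" "f (ld p) \<noteq> 0" by (auto simp: G_def)
    show "\<beta> (\<alpha> y) = y" using p \<alpha>(2) \<beta>(2)[OF ld_pts[OF f]] q_\<sigma>[OF f] by simp
  next
    fix y assume "y \<in> topspace (subtopology P (topspace P - X))"
    then obtain x where x: "x \<in> pts n" "y = line_through n x" "\<sigma> x \<in> G" using PX by auto
    have "restrict x {..n} = x" using x(1) by (simp add: pts_def extensional_restrict)
    then show "\<alpha> (\<beta> y) = y" using x \<alpha>(2) \<beta>(2) by (simp add: ld_\<sigma>)
  qed
  then have "subtopology M S homeomorphic_space subtopology P (topspace P - X)"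
    unfolding homeomorphic_space_def by blast
  with S_open closure show ?thesis unfolding M_def P_def X_def by blast
qed

section \<open>The empty subvariety, the case j = k, and the conclusion\<close>

lemma subvariety_codim_empty: "subvariety_codim n {} = \<infinity>"
proof -
  have "{ereal (real l) |l. \<exists>C. (\<forall>i\<le>l. irreducible_subvariety n (C i) \<and> C i \<subseteq> {}) \<and>
      (\<forall>i<l. C i \<subset> C (Suc i))} = {}"
    by (auto simp: irreducible_subvariety_def)
  then have "subvariety_dim n {} = - \<infinity>"
    unfolding subvariety_dim_def by (simp only: Sup_empty bot_ereal_def)
  then show ?thesis unfolding subvariety_codim_def by simp
qed

lemma closed_subvariety_empty: "closed_subvariety n {}"
proof -
  have "zero_locus n {\<lambda>x. 1} = {}" by (simp add: zero_locus_def)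
  moreover have "(\<lambda>x. 1) \<in> forms n" using form_one by (auto simp: forms_def)
  ultimately show ?thesis unfolding closed_subvariety_iff by (intro exI[of _ "{\<lambda>x. 1}"]) simp
qed

lemma homeomorphic_space_singletons:
  assumes "topspace X = {a}" "topspace Y = {b}"
  shows "X homeomorphic_space Y"
proof -
  have "homeomorphic_maps X Y (\<lambda>_. b) (\<lambda>_. a)"
    using assms by (simp add: homeomorphic_maps_def)
  then show ?thesis unfolding homeomorphic_space_def by blast
qed

theorem theorem4p11:
  fixes k j :: nat
  assumes "k \<ge> 1" and "j \<ge> k"
  shows "\<exists>S X. openin (moduli k j) S \<and>
               (moduli k j) closure_of S = topspace (moduli k j) \<and>
               closed_subvariety (2 * j - k - 2) X \<and>
               subvariety_codim (2 * j - k - 2) X \<ge> ereal (real (k + 1)) \<and>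
               subtopology (moduli k j) S homeomorphic_space
                 subtopology (proj_space (2 * j - k - 2))
                   (topspace (proj_space (2 * j - k - 2)) - X)"
proof (cases "j = k")
  \<comment> \<open>For j \<ge> k + 1 the first order exponents k - j + 1, ..., j - 1 include all of
    0, ..., k; this fails for j = k.\<close>
  case False
  define n where "n = 2 * j - k - 2"
  have jk: "j \<ge> k + 1" using assms False by simp
  have "\<exists>F. (\<exists>D c. c \<noteq> 0 \<and> lead_form n (window_index k j s) D c F) \<and>
      (\<forall>x. F x \<noteq> 0 \<longrightarrow> (\<exists>i\<le>n. x i \<noteq> 0)) \<and>
      (\<forall>p. F (leading k j p) \<noteq> 0 \<longrightarrow>
         bundle_iso k (transition k j p) (transition k j (\<lambda>(r, s). if r = 1 then p (r, s) else 0)))"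
    if "s \<in> {0..int k}" for s
  proof -
    have "0 \<le> s" "s \<le> int k" using that by auto
    then show ?thesis
    proof (rule good_form_exists[OF assms(1) jk, folded n_def])
      fix F D c
      assume H: "c \<noteq> 0" "lead_form n (window_index k j s) D c F" "\<And>x. F x \<noteq> 0 \<Longrightarrow> \<exists>i\<le>n. x i \<noteq> 0"
        "\<And>p. F (leading k j p) \<noteq> 0 \<Longrightarrow>
           bundle_iso k (transition k j p) (transition k j (\<lambda>(r, s). if r = 1 then p (r, s) else 0))"
      show ?thesis
      proof (intro exI[of _ F] conjI allI impI)
        show "\<exists>D c. c \<noteq> 0 \<and> lead_form n (window_index k j s) D c F" using H(1,2) by blast
      qed (rule H, assumption)+
    qed
  qed
  then have "\<forall>s\<in>{0..int k}. \<exists>F. (\<exists>D c. c \<noteq> 0 \<and> lead_form n (window_index k j s) D c F) \<and>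
      (\<forall>x. F x \<noteq> 0 \<longrightarrow> (\<exists>i\<le>n. x i \<noteq> 0)) \<and>
      (\<forall>p. F (leading k j p) \<noteq> 0 \<longrightarrow>
         bundle_iso k (transition k j p) (transition k j (\<lambda>(r, s). if r = 1 then p (r, s) else 0)))"
    by blast
  from bchoice[OF this] obtain f where
    f: "\<And>s. s \<in> {0..int k} \<Longrightarrow> \<exists>D c. c \<noteq> 0 \<and> lead_form n (window_index k j s) D c (f s)"
      "\<And>s x. s \<in> {0..int k} \<Longrightarrow> f s x \<noteq> 0 \<Longrightarrow> \<exists>i\<le>n. x i \<noteq> 0"
      "\<And>s p. s \<in> {0..int k} \<Longrightarrow> f s (leading k j p) \<noteq> 0 \<Longrightarrow>
         bundle_iso k (transition k j p) (transition k j (\<lambda>(r, s). if r = 1 then p (r, s) else 0))"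
    by blast
  define F where "F = f ` {0..int k}"
  define I where "I = window_index k j ` {0..int k}"
  have win: "{0..int k} \<subseteq> window k j 1" using jk by (auto simp: window_def)
  have In: "window_index k j s \<le> n" if "s \<in> {0..int k}" for s
    unfolding n_def using window_index_le win that by blast
  have FF: "F \<subseteq> forms n"
    using f(1) lead_form_form[OF In] unfolding F_def forms_def by blast
  have "1 * k \<le> 2 * j - 2" using jk assms(1) by simp
  then have N: "1 \<le> (2 * j - 2) div k" using assms(1) by (simp add: less_eq_div_iff_mult_less_eq)
  have ex: "\<exists>f\<in>F. \<exists>x. f x \<noteq> 0"
  proof -
    have "0 \<in> {0..int k}" by simp
    then show ?thesis using f(1)[of 0] lead_form_nonzero[OF In] unfolding F_def by blast
  qed
  have "\<exists>S. openin (moduli k j) S \<and> (moduli k j) closure_of S = topspace (moduli k j) \<and>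
    subtopology (moduli k j) S homeomorphic_space
      subtopology (proj_space n) (topspace (proj_space n) - zero_locus n F)"
    unfolding n_def
    by (rule moduli_open_part[OF assms N FF[unfolded n_def] ex])
       (use f(2,3) in \<open>auto simp: F_def n_def\<close>)
  moreover have "closed_subvariety n (zero_locus n F)"
    unfolding closed_subvariety_iff using FF by blast
  moreover have "subvariety_codim n (zero_locus n F) \<ge> ereal (real (k + 1))"
  proof -
    have "inj_on (window_index k j) {0..int k}"
    proof (rule inj_onI)
      fix s t assume "s \<in> {0..int k}" "t \<in> {0..int k}" "window_index k j s = window_index k j t"
      then show "s = t" using window_index_less_iff[of s k j t] window_index_less_iff[of t k j s] win
        by (metis less_irrefl linorder_neqE subsetD)
    qed
    then have "card I = k + 1" unfolding I_def by (simp add: card_image)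
    moreover have "subvariety_codim n (zero_locus n F) \<ge> ereal (real (card I))"
    proof (rule subvariety_codim_ge)
      show "I \<subseteq> {..n}" using In by (auto simp: I_def)
      fix i assume "i \<in> I"
      then obtain s where s: "s \<in> {0..int k}" "i = window_index k j s" by (auto simp: I_def)
      from f(1)[OF s(1)] obtain D c where "c \<noteq> 0" "lead_form n i D c (f s)" using s(2) by blast
      moreover have "f s x = 0" if "x \<in> cone n (zero_locus n F)" for x
        using cone_zero_locus[OF FF] that s(1) by (auto simp: F_def)
      ultimately show "\<exists>m. span_on (cone n (zero_locus n F)) n (low_expo n i m) (\<lambda>x. x i ^ m)"
        using lead_form_relation by blast
    qed
    ultimately show ?thesis by simp
  qed
  ultimately show ?thesis unfolding n_def by blast
next
  \<comment> \<open>For j = k no coefficient of order r \<ge> 2 occurs, so nothing has to be removed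
    from the projective space.\<close>
  case True
  show ?thesis
  proof (cases "k = 1")
    \<comment> \<open>For j = k = 1 there are no coefficients at all: the moduli space is a point,
      and so is \<open>proj_space 0\<close>.\<close>
    case k1: True
    have idx: "coeff_index k j = {}" using True k1 by (auto simp: coeff_index_def)
    let ?q = "\<lambda>p. bundle_class k (transition k j p)"
    have tM: "topspace (moduli k j) = {?q (\<lambda>_. undefined)}"
      unfolding moduli_def topspace_quotient_topology topspace_coeff_space idx by simp
    have n0: "2 * j - k - 2 = 0" using True k1 by simp
    have tP: "topspace (proj_space 0) = {line_through 0 (\<lambda>i\<in>{..0}. 1)}"
    proof -
      have one: "(\<lambda>i\<in>{..0}. 1) \<in> pts 0" by (auto simp: pts_def)
      have "line_through 0 ` pts 0 = (\<lambda>_. line_through 0 (\<lambda>i\<in>{..0}. 1)) ` pts 0"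
      proof (rule image_cong[OF refl])
        fix x assume x: "x \<in> pts 0"
        have "x = (\<lambda>i\<in>{..0}. x 0 * (\<lambda>i\<in>{..0}. 1) i)"
          using x by (auto simp: pts_def extensional_def fun_eq_iff)
        moreover have "x 0 \<noteq> 0" using x by (auto simp: pts_def)
        ultimately show "line_through 0 x = line_through 0 (\<lambda>i\<in>{..0}. 1)"
          using line_through_eq_iff[OF one x] by metis
      qed
      also have "\<dots> = {line_through 0 (\<lambda>i\<in>{..0}. 1)}" using one by blast
      finally show ?thesis
        unfolding proj_space_def topspace_quotient_topology topspace_punctured .
    qed
    have "moduli k j homeomorphic_space proj_space 0"
      by (rule homeomorphic_space_singletons[OF tM tP])
    then show ?thesis
      unfolding n0
      by (intro exI[of _ "topspace (moduli k j)"] exI[of _ "{}"])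
         (simp add: closed_subvariety_empty subvariety_codim_empty)
  next
    case k1: False
    define n where "n = 2 * j - k - 2"
    have k2: "k \<ge> 2" using assms k1 by simp
    \<comment> \<open>2 k - 2 lies between k and 2 k - 1, so p consists of its first order
      part.\<close>
    have N: "(2 * j - 2) div k = 1"
      by (rule div_nat_eqI) (use True k2 in auto)
    \<comment> \<open>The coordinates have no common zero, so every nonzero first order part counts
      as generic and the removed locus is empty.\<close>
    define F where "F = (\<lambda>i x. x i :: complex) ` {..n}"
    have FF: "F \<subseteq> forms n" using form_coordinate unfolding F_def forms_def by blast
    have ex: "\<exists>f\<in>F. \<exists>x. f x \<noteq> 0" unfolding F_def by (auto intro!: exI[of _ "\<lambda>_. 1"])
    have "\<exists>S. openin (moduli k j) S \<and> (moduli k j) closure_of S = topspace (moduli k j) \<and>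
      subtopology (moduli k j) S homeomorphic_space
        subtopology (proj_space n) (topspace (proj_space n) - zero_locus n F)"
      unfolding n_def
    proof (rule moduli_open_part[OF assms _ FF[unfolded n_def] ex])
      show "bundle_iso k (transition k j p) (transition k j (\<lambda>(r, s). if r = 1 then p (r, s) else 0))" for p
        by (rule bundle_iso_leading_part[OF assms(1), of j "\<lambda>_. 0"]) (use N in auto)
    qed (use N in \<open>auto simp: F_def n_def\<close>)
    moreover have "zero_locus n F = {}" by (auto simp: zero_locus_def F_def pts_def)
    ultimately obtain S where "openin (moduli k j) S" "(moduli k j) closure_of S = topspace (moduli k j)"
      "subtopology (moduli k j) S homeomorphic_space
        subtopology (proj_space n) (topspace (proj_space n) - {})" by auto
    then show ?thesis
      unfolding n_def
      by (intro exI[of _ S] exI[of _ "{}"])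
         (simp only: closed_subvariety_empty subvariety_codim_empty simp_thms ereal_less_eq)
  qed
qed

end
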